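(* Consider the contaminated AR($p$) model described in the context, and suppose that the local alternative $H_{1n}(\rho)$ holds, i.e. for sample size $n$ the innovations have distribution function $A_n(x)=(1-\rho_n)\Phi(x/\theta_0)+\rho_n H(x)$ with $\rho_n=\min(1,\rho n^{-1/2})$. Assume that (i) a random variable with distribution function $H$ has zero mean and finite variance, and (ii) $H$ is twice differentiable with bounded second derivative. Let $\hat\mu_n$ and $\hat{\boldsymbol\beta}_n=(\hat\beta_{1n},\dots,\hat\beta_{pn})^T$ be any sequences of estimators such that, under $H_{1n}(\rho)$, for all finite $\Gamma,R\ge 0$, $n^{1/2}(\hat\mu_n-\mu)=O_P(1)$ and $n^{1/2}(\hat{\boldsymbol\beta}_n-\boldsymbol\beta)=O_P(1)$ as $n\to\infty$, uniformly in $\rho\le R$, $\gamma\le\Gamma$. Let $\varphi$ be the standard Gaussian density. Then for any finite $\Gamma\ge 0$, $R\ge 0$, any $x\in\mathbb{R}$ and any $\delta>0$, $$\sup_{0\le\rho\le R,\;0\le\gamma\le\Gamma} P\Big(\Big|n^{1/2}[\hat G_n(x)-G_n(x)]-\frac{1}{\theta_0}\varphi\Big(\frac{x}{\theta_0}\Big)\hat\delta_n\, n^{1/2}(\hat\mu_n-\mu)-\gamma\Delta_0(x,\Pi)\Big|>\delta\Big)\to 0,\quad n\to\infty,$$ where $$\Delta_0(x,\Pi)=\sum_{j=0}^p\big[E\,G_0(x+\beta_j\xi_1)-G_0(x)\big],\quad \beta_0=-1,\quad G_0(x)=\Phi(x/\theta_0),\quad \hat\delta_n=1-\hat\beta_{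1n}-\dots-\hat\beta_{pn}.$$
   Context: Model. $\{v_t\}_{t\in\mathbb{Z}}$ is the stationary solution of $v_t=\beta_1v_{t-1}+\dots+\beta_pv_{t-p}+\nu+\varepsilon_t$, $t\in\mathbb{Z}$, where $\{\varepsilon_t\}$ are i.i.d. with distribution function $G$, $E\varepsilon_1=0$, $0<E\varepsilon_1^2<\infty$; $\boldsymbol\beta=(\beta_1,\dots,\beta_p)^T\in\mathbb{R}^p$ is such that all roots of the characteristic equation $z^p=\beta_1z^{p-1}+\dots+\beta_p$ are less than one in modulus; $\nu\in\mathbb{R}$. The constant $\mu$ is defined by $\nu=(1-\beta_1-\dots-\beta_p)\mu$. The parameters $\boldsymbol\beta,\nu$ are unknown. Observations. One observes $y_t=v_t+z_t^{\gamma_n}\xi_t$, $t=1-p,\dots,n$, where $\{z_t^{\gamma_n}\}$ are i.i.d. Bernoulli variables (values $0,1$) with $P(z_t^{\gamma_n}=1)=\gamma_n=\min(1,\gamma n^{-1/2})$, $\gamma\ge0$, and $\{\xi_t\}$ are i.i.d. with an arbitrary distribution $\Pi$ on $\mathbb{R}$. The sequences $\{\varepsilon_t\}$, $\{z_t^{\gamma_n}\}$, $\{\xi_t\}$ are mutually independent. Local alternative. $\Phi$ is the standard normal distribution function, $\theta_0>0$ is fixed, $H$ is a distribution function, and $\rho\ge0$. $H_{1n}(\rho)$ is the assumption that for sample size $n$ the innovation distribution function is $G(x)=A_n(x):=(1-\rho_n)\Phi(x/\theta_0)+\rho_nH(x)$, $\rho_n=\min(1,\rho n^{-1/2})$. The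 quantities $\boldsymbol\beta,\nu,\theta_0,H,\Pi$ do not depend on $n$. Residuals and empirical distribution functions. $\hat u_t=y_t-\hat\mu_n$ for $t=1-p,\dots,n$; the residuals are $\hat\varepsilon_t=\hat u_t-\hat\beta_{1n}\hat u_{t-1}-\dots-\hat\beta_{pn}\hat u_{t-p}$, $t=1,\dots,n$. With $I(\cdot)$ the indicator, $\hat G_n(x)=n^{-1}\sum_{t=1}^nI(\hat\varepsilon_t\le x)$ and $G_n(x)=n^{-1}\sum_{t=1}^nI(\varepsilon_t\le x)$. Convention. $X_n=O_P(1)$ uniformly in $\rho\le R$, $\gamma\le\Gamma$ means $\lim_{K\to\infty}\limsup_{n\to\infty}\sup_{0\le\rho\le R,0\le\gamma\le\Gamma}P(|X_n|>K)=0$. *)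

theory Defs
  imports "HOL-Probability.Probability"
begin

text \<open>
  Coefficient vectors are functions on \<^typ>\<open>nat\<close> of which only the values at \<open>1..p\<close> are used;
  processes are indexed by \<^typ>\<open>int\<close>.
\<close>

definition strictly_stationary :: "'a measure \<Rightarrow> (int \<Rightarrow> 'a \<Rightarrow> real) \<Rightarrow> bool" where
  "strictly_stationary M v \<longleftrightarrow>
     (\<forall>h. distr M (\<Pi>\<^sub>M t\<in>UNIV. borel) (\<lambda>\<omega> t. v (t + h) \<omega>) =
          distr M (\<Pi>\<^sub>M t\<in>UNIV. borel) (\<lambda>\<omega> t. v t \<omega>))"

definition char_roots_inside :: "nat \<Rightarrow> (nat \<Rightarrow> real) \<Rightarrow> bool" where
  "char_roots_inside p \<beta> \<longleftrightarrow>
     (\<forall>w::complex. w ^ p = (\<Sum>j=1..p. of_real (\<beta> j) * w ^ (p - j)) \<longrightarrow> norm w < 1)"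

text \<open>
  The model at one sample size and one parameter value: \<open>G\<close> is the innovation distribution
  function, \<open>g\<close> the contamination probability and \<open>Q\<close> the law of the outliers. Strict
  stationarity together with the root condition determines \<open>v\<close> almost surely.
\<close>

locale contaminated_ar = prob_space M
  for M :: "'a measure" +
  fixes p :: nat and \<beta> :: "nat \<Rightarrow> real" and \<nu> :: real
    and G :: "real \<Rightarrow> real" and g :: real and Q :: "real measure"
    and \<epsilon> z \<xi> v :: "int \<Rightarrow> 'a \<Rightarrow> real"
  assumes roots: "char_roots_inside p \<beta>"
    and eps_indep: "indep_vars (\<lambda>_. borel) \<epsilon> UNIV"
    and eps_cdf: "\<And>t. cdf (distr M borel (\<epsilon> t)) = G"
    and eps_integrable: "integrable M (\<epsilon> 1)"
    and eps_mean: "expectation (\<epsilon> 1) = 0"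
    and eps_sq_integrable: "integrable M (\<lambda>\<omega>. (\<epsilon> 1 \<omega>)\<^sup>2)"
    and eps_sq_pos: "0 < expectation (\<lambda>\<omega>. (\<epsilon> 1 \<omega>)\<^sup>2)"
    and z_indep: "indep_vars (\<lambda>_. borel) z UNIV"
    and z_values: "\<And>t. AE \<omega> in M. z t \<omega> \<in> {0, 1}"
    and z_prob: "\<And>t. prob {\<omega> \<in> space M. z t \<omega> = 1} = g"
    and xi_indep: "indep_vars (\<lambda>_. borel) \<xi> UNIV"
    and xi_law: "\<And>t. distr M borel (\<xi> t) = Q"
    and sequences_indep:
      "indep_vars (\<lambda>_. \<Pi>\<^sub>M t\<in>UNIV. borel) (\<lambda>i \<omega> t. ([\<epsilon>, z, \<xi>] ! i) t \<omega>) {0, 1, 2}"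
    and v_measurable: "\<And>t. random_variable borel (v t)"
    and v_stationary: "strictly_stationary M v"
    and v_ar: "\<And>t. AE \<omega> in M. v t \<omega> = (\<Sum>j=1..p. \<beta> j * v (t - int j) \<omega>) + \<nu> + \<epsilon> t \<omega>"

definition local_rate :: "real \<Rightarrow> nat \<Rightarrow> real" where
  "local_rate c n = min 1 (c / sqrt (real n))"

definition std_normal_cdf :: "real \<Rightarrow> real" where
  "std_normal_cdf = cdf std_normal_distribution"

definition local_alternative :: "real \<Rightarrow> (real \<Rightarrow> real) \<Rightarrow> real \<Rightarrow> nat \<Rightarrow> real \<Rightarrow> real" where
  "local_alternative \<theta> H \<rho> n x =
     (1 - local_rate \<rho> n) * std_normal_cdf (x / \<theta>) + local_rate \<rho> n * H x"

definition obs_times :: "nat \<Rightarrow> nat \<Rightarrow> int set" where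
  "obs_times p n = {1 - int p..int n}"

definition observations ::
    "nat \<Rightarrow> nat \<Rightarrow> (int \<Rightarrow> 'a \<Rightarrow> real) \<Rightarrow> (int \<Rightarrow> 'a \<Rightarrow> real) \<Rightarrow> (int \<Rightarrow> 'a \<Rightarrow> real)
      \<Rightarrow> 'a \<Rightarrow> int \<Rightarrow> real" where
  "observations p n v z \<xi> \<omega> = (\<lambda>t\<in>obs_times p n. v t \<omega> + z t \<omega> * \<xi> t \<omega>)"

text \<open>An estimator (for each \<open>n\<close>) is a measurable function of \<open>y t\<close>, \<open>1 - p \<le> t \<le> n\<close>.\<close>

definition estimator :: "nat \<Rightarrow> (nat \<Rightarrow> (int \<Rightarrow> real) \<Rightarrow> real) \<Rightarrow> bool" where
  "estimator p T \<longleftrightarrow> (\<forall>n\<ge>1. T n \<in> borel_measurable (\<Pi>\<^sub>M t\<in>obs_times p n. borel))"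

definition residual :: "nat \<Rightarrow> real \<Rightarrow> (nat \<Rightarrow> real) \<Rightarrow> (int \<Rightarrow> real) \<Rightarrow> int \<Rightarrow> real" where
  "residual p m b y t = (y t - m) - (\<Sum>j=1..p. b j * (y (t - int j) - m))"

definition edf :: "nat \<Rightarrow> (int \<Rightarrow> real) \<Rightarrow> real \<Rightarrow> real" where
  "edf n e x = (\<Sum>t=1..int n. indicator {..x} (e t)) / real n"

definition Delta0 :: "nat \<Rightarrow> (nat \<Rightarrow> real) \<Rightarrow> real \<Rightarrow> real measure \<Rightarrow> real \<Rightarrow> real" where
  "Delta0 p \<beta> \<theta> Q x =
     (let \<beta>' = \<beta>(0 := -1); G0 = (\<lambda>x. std_normal_cdf (x / \<theta>))
      in \<Sum>j=0..p. ((\<integral>u. G0 (x + \<beta>' j * u) \<partial>Q) - G0 x))"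

text \<open>The probability spaces \<open>M n \<rho> \<gamma>\<close> may differ with \<open>n\<close> and with the parameter values.\<close>

definition sup_prob ::
    "real \<Rightarrow> real \<Rightarrow> (nat \<Rightarrow> real \<Rightarrow> real \<Rightarrow> 'a measure) \<Rightarrow> (nat \<Rightarrow> real \<Rightarrow> real \<Rightarrow> 'a \<Rightarrow> real)
      \<Rightarrow> real \<Rightarrow> nat \<Rightarrow> ereal" where
  "sup_prob R \<Gamma> M X K n =
     (SUP (\<rho>, \<gamma>) \<in> {0..R} \<times> {0..\<Gamma>}.
        ereal (measure (M n \<rho> \<gamma>) {\<omega> \<in> space (M n \<rho> \<gamma>). \<bar>X n \<rho> \<gamma> \<omega>\<bar> > K}))"

definition unif_OP1 ::
    "real \<Rightarrow> real \<Rightarrow> (nat \<Rightarrow> real \<Rightarrow> real \<Rightarrow> 'a measure) \<Rightarrow> (nat \<Rightarrow> real \<Rightarrow> real \<Rightarrow> 'a \<Rightarrow> real)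
      \<Rightarrow> bool" where
  "unif_OP1 R \<Gamma> M X \<longleftrightarrow> ((\<lambda>K. limsup (sup_prob R \<Gamma> M X K)) \<longlongrightarrow> 0) at_top"

end

theory Submission
  imports Defs "HOL-Complex_Analysis.Cauchy_Integral_Formula"
begin

text \<open>
  Write \<open>u\<close> for the centred process \<open>v - \<mu>\<close>, \<open>b\<close> and \<open>m\<close> for the estimates of \<open>\<beta>\<close> and \<open>\<mu>\<close>. A residual
  equals the innovation minus a threshold shift, so that the residual at \<open>t\<close> is at most \<open>x\<close> exactly
  when the innovation at \<open>t\<close> is at most \<open>x + d t\<close>. The shift is the sum of an outlier part of order
  one, \<open>\<Sum>j\<le>p. \<beta> j * z (t - j) * \<xi> (t - j)\<close> with \<open>\<beta> 0 = -1\<close>, and of \<open>n powr (-1/2)\<close> times a linear form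
  in \<open>(1, y (t - 1) - \<mu>, \<dots>, y (t - p) - \<mu>)\<close>, whose coefficients \<open>\<tau>\<close> are the normalized estimation
  errors (\<open>edf_difference_eq_indicator_sum\<close>). These coefficients are bounded in probability, but
  they depend on the whole sample.

  For a deterministic \<open>\<tau>\<close> the shift at time \<open>t\<close> depends on the past innovations and on the
  contamination only, hence is independent of the innovation at \<open>t\<close>. The indicator sum minus
  its compensator, in which each indicator is replaced by the innovation distribution
  function, is therefore a martingale, whose variance is bounded by the mean increment of that
  distribution function and tends to zero (\<open>centred_indicator_sum_variance\<close>,
  \<open>indicator_sum_minus_compensator\<close>).

  The compensator is expanded pathwise (\<open>threshold_expansion\<close>, \<open>compensator_expansion\<close>). Only
  about \<open>n powr (1/2)\<close> of the windows \<open>t - p, \<dots>, t\<close> contain an outlier, and on average a bounded number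
  contain two or more. The windows without outliers contribute the derivative of the distribution
  function at \<open>x\<close> times the average linear form; as \<open>u\<close> has mean zero and satisfies a law of large
  numbers, only the coefficient \<open>\<tau> 0\<close> survives, and it is the normalized error of \<open>m\<close> times \<open>1 - \<Sum>j. b j\<close>. The windows with
  exactly one outlier contribute a sum of independent terms that concentrates at
  \<open>\<gamma> * Delta0\<close>. The outliers need not have any moment: they enter through bounded
  functions only.

  To insert the estimates, the box of possible \<open>\<tau>\<close> is covered by a finite grid. Each \<open>\<tau>\<close> in the box
  is bracketed by a grid point whose shift is widened by \<open>\<eta>\<close> times the size of the regressors, and
  the indicator sum is monotone in the shift (\<open>plug_in_bound\<close>). The widened shifts still
  depend on the past only, and the widening costs a multiple of \<open>\<eta>\<close>.

  Two points underlie this. A stationary solution coincides almost surely with the causal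
  series \<open>\<Sum>k. \<psi> k * \<epsilon> (t - k)\<close> with absolutely summable weights
  (\<open>stationary_solution_is_linear_process\<close>), which gives the independence and the moments.
  And all bounds are explicit for one model at one sample size, with constants that depend on
  \<open>R\<close> and \<open>\<Gamma>\<close> but not on \<open>\<rho>\<close> and \<open>\<gamma>\<close>, so that uniformity over the local parameters comes for free.
\<close>


section \<open>Inverting the autoregressive operator\<close>

text \<open>
  The lag polynomial is taken as a formal power series, in which it always has an inverse.
\<close>
definition ar_operator :: "nat \<Rightarrow> (nat \<Rightarrow> real) \<Rightarrow> real fps" where
  "ar_operator p \<beta> = Abs_fps (\<lambda>j. if j = 0 then 1 else if j \<le> p then - \<beta> j else 0)"

definition ma_weight :: "nat \<Rightarrow> (nat \<Rightarrow> real) \<Rightarrow> nat \<Rightarrow> real" where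
  "ma_weight p \<beta> = fps_nth (inverse (ar_operator p \<beta>))"

lemma ar_operator_times_ma: "ar_operator p \<beta> * Abs_fps (ma_weight p \<beta>) = 1"
  unfolding ma_weight_def fps_nth_inverse
  by (subst mult.commute, rule inverse_mult_eq_1) (simp add: ar_operator_def)

text \<open>
  The generating polynomial of the operator has no zero in the closed unit disc. It has finitely
  many zeros, so that its reciprocal is a power series that converges on a strictly larger disc.
\<close>
lemma summable_abs_ma_weight:
  assumes "char_roots_inside p \<beta>"
  shows "summable (\<lambda>k. \<bar>ma_weight p \<beta> k\<bar>)"
proof -
  define q :: "complex poly" where
    "q = (\<Sum>j\<le>p. monom (of_real (fps_nth (ar_operator p \<beta>) j)) j)"
  have coeff_q: "coeff q j = of_real (fps_nth (ar_operator p \<beta>) j)" for j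
    by (auto simp: q_def coeff_sum ar_operator_def)
  have poly_q: "poly q w = 1 - (\<Sum>j=1..p. of_real (\<beta> j) * w ^ j)" for w
  proof -
    have "poly q w = (\<Sum>j\<le>p. of_real (fps_nth (ar_operator p \<beta>) j) * w ^ j)"
      by (simp add: q_def poly_sum poly_monom)
    also have "\<dots> = 1 + (\<Sum>j=1..p. of_real (fps_nth (ar_operator p \<beta>) j) * w ^ j)"
      by (simp add: atMost_atLeast0 sum.atLeast_Suc_atMost ar_operator_def)
    also have "(\<Sum>j=1..p. of_real (fps_nth (ar_operator p \<beta>) j) * w ^ j) = - (\<Sum>j=1..p. of_real (\<beta> j) * w ^ j)"
      unfolding sum_negf[symmetric] by (intro sum.cong) (auto simp: ar_operator_def)
    finally show ?thesis by simp
  qed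
  have q_nz: "q \<noteq> 0"
    using coeff_q[of 0] by (auto simp: ar_operator_def)
  \<comment> \<open>A zero \<open>w\<close> of the reversed polynomial is the inverse of a characteristic root.\<close>
  have outside: "norm w > 1" if "poly q w = 0" for w
  proof -
    have w0: "w \<noteq> 0" using that by (auto simp: poly_q)
    have "inverse w ^ p = (\<Sum>j=1..p. of_real (\<beta> j) * inverse w ^ (p - j))"
    proof -
      have "1 = (\<Sum>j=1..p. of_real (\<beta> j) * w ^ j)" using that by (simp add: poly_q)
      then have "inverse w ^ p = (\<Sum>j=1..p. of_real (\<beta> j) * w ^ j) * inverse w ^ p" by simp
      also have "\<dots> = (\<Sum>j=1..p. of_real (\<beta> j) * (w ^ j * inverse w ^ p))"
        by (simp add: sum_distrib_right mult.assoc)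
      also have "\<dots> = (\<Sum>j=1..p. of_real (\<beta> j) * inverse w ^ (p - j))"
      proof (intro sum.cong refl)
        fix j assume "j \<in> {1..p}"
        then have "inverse w ^ p = inverse w ^ j * inverse w ^ (p - j)"
          by (simp flip: power_add)
        then show "of_real (\<beta> j) * (w ^ j * inverse w ^ p) = of_real (\<beta> j) * inverse w ^ (p - j)"
          using w0 by (simp add: power_inverse field_simps)
      qed
      finally show ?thesis .
    qed
    then have "norm (inverse w) < 1" using assms by (auto simp: char_roots_inside_def)
    then show ?thesis using w0 by (simp add: norm_inverse inverse_less_1_iff)
  qed
  obtain r :: real where r: "r > 1" "\<And>w. norm w < r \<Longrightarrow> poly q w \<noteq> 0"
  proof
    let ?S = "insert 2 (norm ` {w. poly q w = 0})"
    have fin: "finite ?S" using poly_roots_finite[OF q_nz] by simp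
    show "Min ?S > 1" using fin outside by (subst Min_gr_iff) auto
    show "poly q w \<noteq> 0" if "norm w < Min ?S" for w
      using that fin by (subst (asm) Min_gr_iff) auto
  qed
  let ?f = "fps_of_poly q"
  have "fps_conv_radius (inverse ?f) \<ge> min (ereal r) (fps_conv_radius ?f)"
    by (rule fps_conv_radius_inverse) (use r in simp)
  then have conv: "fps_conv_radius (inverse ?f) \<ge> ereal r" by simp
  have map: "fps_nth (inverse ?f) k = of_real (ma_weight p \<beta> k)" for k
  proof -
    have "?f * Abs_fps (\<lambda>k. of_real (ma_weight p \<beta> k)) = 1"
    proof (rule fps_ext)
      fix k
      have "fps_nth (?f * Abs_fps (\<lambda>k. complex_of_real (ma_weight p \<beta> k))) k
          = of_real (fps_nth (ar_operator p \<beta> * Abs_fps (ma_weight p \<beta>)) k)"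
        by (simp add: fps_mult_nth coeff_q)
      then show "fps_nth (?f * Abs_fps (\<lambda>k. complex_of_real (ma_weight p \<beta> k))) k = fps_nth 1 k"
        by (simp add: ar_operator_times_ma)
    qed
    then have "inverse ?f = Abs_fps (\<lambda>k. of_real (ma_weight p \<beta> k))"
      by (metis fps_inverse_unique mult.commute)
    then show ?thesis by simp
  qed
  have "summable (\<lambda>k. norm (fps_nth (inverse ?f) k * 1 ^ k))"
    unfolding fps_conv_radius_def[symmetric]
    by (rule abs_summable_in_conv_radius)
       (use conv r(1) in \<open>auto simp: fps_conv_radius_def intro: less_le_trans[of _ "ereal r"]\<close>)
  then show ?thesis by (simp add: map)
qed

section \<open>Second moments and independence\<close>

lemma expectation_square_orthogonal_sum:
  fixes X :: "'i \<Rightarrow> 'a \<Rightarrow> real"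
  assumes "finite T"
    and int: "\<And>s t. s \<in> T \<Longrightarrow> t \<in> T \<Longrightarrow> integrable M (\<lambda>\<omega>. X s \<omega> * X t \<omega>)"
    and orth: "\<And>s t. s \<in> T \<Longrightarrow> t \<in> T \<Longrightarrow> s \<noteq> t \<Longrightarrow> (\<integral>\<omega>. X s \<omega> * X t \<omega> \<partial>M) = 0"
  shows "integrable M (\<lambda>\<omega>. (\<Sum>t\<in>T. X t \<omega>)\<^sup>2)"
    and "(\<integral>\<omega>. (\<Sum>t\<in>T. X t \<omega>)\<^sup>2 \<partial>M) = (\<Sum>t\<in>T. \<integral>\<omega>. (X t \<omega>)\<^sup>2 \<partial>M)"
proof -
  have sq: "(\<Sum>t\<in>T. X t \<omega>)\<^sup>2 = (\<Sum>s\<in>T. \<Sum>t\<in>T. X s \<omega> * X t \<omega>)" for \<omega>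
    by (simp add: power2_eq_square sum_product)
  show "integrable M (\<lambda>\<omega>. (\<Sum>t\<in>T. X t \<omega>)\<^sup>2)"
    unfolding sq by (intro Bochner_Integration.integrable_sum int)
  have "(\<integral>\<omega>. (\<Sum>t\<in>T. X t \<omega>)\<^sup>2 \<partial>M) = (\<Sum>s\<in>T. \<Sum>t\<in>T. \<integral>\<omega>. X s \<omega> * X t \<omega> \<partial>M)"
  proof -
    have "(\<integral>\<omega>. (\<Sum>s\<in>T. \<Sum>t\<in>T. X s \<omega> * X t \<omega>) \<partial>M) = (\<Sum>s\<in>T. \<integral>\<omega>. (\<Sum>t\<in>T. X s \<omega> * X t \<omega>) \<partial>M)"
      by (intro Bochner_Integration.integral_sum Bochner_Integration.integrable_sum int)
    also have "\<dots> = (\<Sum>s\<in>T. \<Sum>t\<in>T. \<integral>\<omega>. X s \<omega> * X t \<omega> \<partial>M)"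
      by (intro sum.cong refl Bochner_Integration.integral_sum int)
    finally show ?thesis unfolding sq .
  qed
  also have "\<dots> = (\<Sum>s\<in>T. \<Sum>t\<in>T. if t = s then \<integral>\<omega>. (X s \<omega>)\<^sup>2 \<partial>M else 0)"
  proof (intro sum.cong refl)
    fix s t assume "s \<in> T" "t \<in> T"
    then show "(\<integral>\<omega>. X s \<omega> * X t \<omega> \<partial>M) = (if t = s then \<integral>\<omega>. (X s \<omega>)\<^sup>2 \<partial>M else 0)"
      using orth[of s t] unfolding power2_eq_square by (cases "t = s") auto
  qed
  also have "\<dots> = (\<Sum>t\<in>T. \<integral>\<omega>. (X t \<omega>)\<^sup>2 \<partial>M)"
    using \<open>finite T\<close> by simp
  finally show "(\<integral>\<omega>. (\<Sum>t\<in>T. X t \<omega>)\<^sup>2 \<partial>M) = (\<Sum>t\<in>T. \<integral>\<omega>. (X t \<omega>)\<^sup>2 \<partial>M)" .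
qed

lemma (in prob_space) expectation_abs_le_sqrt:
  fixes X :: "'a \<Rightarrow> real"
  assumes [measurable]: "random_variable borel X" and "integrable M (\<lambda>\<omega>. (X \<omega>)\<^sup>2)"
    and "expectation (\<lambda>\<omega>. (X \<omega>)\<^sup>2) \<le> c"
  shows "integrable M X" "expectation (\<lambda>\<omega>. \<bar>X \<omega>\<bar>) \<le> sqrt c"
proof -
  show "integrable M X"
    by (rule square_integrable_imp_integrable) (use assms(2) in auto)
  then have "integrable M (\<lambda>\<omega>. \<bar>X \<omega>\<bar>)" by (rule integrable_abs)
  have "variance (\<lambda>\<omega>. \<bar>X \<omega>\<bar>) = expectation (\<lambda>\<omega>. \<bar>X \<omega>\<bar>\<^sup>2) - (expectation (\<lambda>\<omega>. \<bar>X \<omega>\<bar>))\<^sup>2"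
    using assms(2) \<open>integrable M (\<lambda>\<omega>. \<bar>X \<omega>\<bar>)\<close> by (intro variance_eq) auto
  then have "(expectation (\<lambda>\<omega>. \<bar>X \<omega>\<bar>))\<^sup>2 \<le> c"
    using variance_positive[of "\<lambda>\<omega>. \<bar>X \<omega>\<bar>"] assms(3) by simp
  then show "expectation (\<lambda>\<omega>. \<bar>X \<omega>\<bar>) \<le> sqrt c" by (rule real_le_rsqrt)
qed

text \<open>
  Unlike \<^const>\<open>prob_space.indep_var\<close>, this relates random elements of two different types.
\<close>
definition (in prob_space) independent ::
    "'b measure \<Rightarrow> ('a \<Rightarrow> 'b) \<Rightarrow> 'c measure \<Rightarrow> ('a \<Rightarrow> 'c) \<Rightarrow> bool" where
  "independent S X T Y \<longleftrightarrow> random_variable S X \<and> random_variable T Y \<and>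
     distr M S X \<Otimes>\<^sub>M distr M T Y = distr M (S \<Otimes>\<^sub>M T) (\<lambda>\<omega>. (X \<omega>, Y \<omega>))"

lemma (in prob_space) independent_iff_indep_var: "independent S X T Y \<longleftrightarrow> indep_var S X T Y"
  by (simp add: independent_def indep_var_distribution_eq)

lemma (in prob_space) independent_rv:
  assumes "independent S X T Y"
  shows "random_variable S X" "random_variable T Y"
  using assms by (auto simp: independent_def)

lemma (in prob_space) independent_compose:
  assumes XY: "independent S X T Y"
    and [measurable]: "f \<in> measurable S S'" "g \<in> measurable T T'"
  shows "independent S' (\<lambda>\<omega>. f (X \<omega>)) T' (\<lambda>\<omega>. g (Y \<omega>))"
proof -
  note [measurable] = independent_rv[OF XY]
  interpret Y: prob_space "distr M T Y" by (rule prob_space_distr) simp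
  interpret gY: prob_space "distr (distr M T Y) T' g" by (rule Y.prob_space_distr) simp
  have "distr M S' (\<lambda>\<omega>. f (X \<omega>)) \<Otimes>\<^sub>M distr M T' (\<lambda>\<omega>. g (Y \<omega>))
      = distr (distr M S X) S' f \<Otimes>\<^sub>M distr (distr M T Y) T' g"
    by (simp add: distr_distr comp_def)
  also have "\<dots> = distr (distr M S X \<Otimes>\<^sub>M distr M T Y) (S' \<Otimes>\<^sub>M T') (\<lambda>(x, y). (f x, g y))"
    by (rule pair_measure_distr) (auto intro: gY.sigma_finite_measure)
  also have "distr M S X \<Otimes>\<^sub>M distr M T Y = distr M (S \<Otimes>\<^sub>M T) (\<lambda>\<omega>. (X \<omega>, Y \<omega>))"
    using XY by (simp add: independent_def)
  also have "distr (distr M (S \<Otimes>\<^sub>M T) (\<lambda>\<omega>. (X \<omega>, Y \<omega>))) (S' \<Otimes>\<^sub>M T') (\<lambda>(x, y). (f x, g y))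
      = distr M (S' \<Otimes>\<^sub>M T') (\<lambda>\<omega>. (f (X \<omega>), g (Y \<omega>)))"
    by (simp add: distr_distr comp_def)
  finally show ?thesis by (simp add: independent_def)
qed

text \<open>
  This turns independence between the three noise sequences, together with independence inside one
  of them, into independence of a single innovation from its past and the other two sequences.
\<close>
lemma (in prob_space) independent_assoc:
  assumes XY: "independent S X T Y" and XYZ: "independent (S \<Otimes>\<^sub>M T) (\<lambda>\<omega>. (X \<omega>, Y \<omega>)) N Z"
  shows "independent S X (T \<Otimes>\<^sub>M N) (\<lambda>\<omega>. (Y \<omega>, Z \<omega>))"
proof -
  note [measurable] = independent_rv[OF XY] independent_rv[OF XYZ]
  interpret X: prob_space "distr M S X" by (rule prob_space_distr) simp
  interpret Y: prob_space "distr M T Y" by (rule prob_space_distr) simp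
  interpret Z: prob_space "distr M N Z" by (rule prob_space_distr) simp
  interpret YZ: pair_prob_space "distr M T Y" "distr M N Z" ..
  interpret XY: pair_prob_space "distr M S X" "distr M T Y" ..
  have YZ: "distr M T Y \<Otimes>\<^sub>M distr M N Z = distr M (T \<Otimes>\<^sub>M N) (\<lambda>\<omega>. (Y \<omega>, Z \<omega>))"
  proof -
    have "independent T (\<lambda>\<omega>. snd (X \<omega>, Y \<omega>)) N Z"
      by (rule independent_compose[OF XYZ, where g="\<lambda>z. z"]) auto
    then show ?thesis by (simp add: independent_def)
  qed
  have dXY: "distr M (S \<Otimes>\<^sub>M T) (\<lambda>\<omega>. (X \<omega>, Y \<omega>)) = distr M S X \<Otimes>\<^sub>M distr M T Y"
    using XY by (simp add: independent_def)
  have dXYZ: "distr M ((S \<Otimes>\<^sub>M T) \<Otimes>\<^sub>M N) (\<lambda>\<omega>. ((X \<omega>, Y \<omega>), Z \<omega>))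
      = (distr M S X \<Otimes>\<^sub>M distr M T Y) \<Otimes>\<^sub>M distr M N Z"
    using XYZ by (simp add: independent_def dXY)
  have "distr M S X \<Otimes>\<^sub>M (distr M T Y \<Otimes>\<^sub>M distr M N Z)
      = distr ((distr M S X \<Otimes>\<^sub>M distr M T Y) \<Otimes>\<^sub>M distr M N Z) (S \<Otimes>\<^sub>M (T \<Otimes>\<^sub>M N)) (\<lambda>((x, y), z). (x, y, z))"
    (is "_ = ?D")
  proof (rule pair_measure_eqI)
    show "sigma_finite_measure (distr M S X)" ..
    show "sigma_finite_measure (distr M T Y \<Otimes>\<^sub>M distr M N Z)" ..
    show "sets (distr M S X \<Otimes>\<^sub>M (distr M T Y \<Otimes>\<^sub>M distr M N Z)) = sets ?D"
      by (simp cong: sets_pair_measure_cong)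
    fix A B assume A: "A \<in> sets (distr M S X)" and B: "B \<in> sets (distr M T Y \<Otimes>\<^sub>M distr M N Z)"
    have [measurable]: "A \<in> sets S" using A by simp
    have [measurable]: "B \<in> sets (T \<Otimes>\<^sub>M N)"
      using B by (simp cong: sets_pair_measure_cong)
    have "emeasure ?D (A \<times> B) = (\<integral>\<^sup>+ w. indicator (A \<times> B) w \<partial>?D)"
      by (rule nn_integral_indicator[symmetric]) (simp add: pair_measureI)
    also have "\<dots> = (\<integral>\<^sup>+ q. indicator (A \<times> B) (fst (fst q), snd (fst q), snd q)
        \<partial>((distr M S X \<Otimes>\<^sub>M distr M T Y) \<Otimes>\<^sub>M distr M N Z))"
      unfolding case_prod_unfold
      by (rule nn_integral_distr) (simp_all add: pair_measureI cong: measurable_cong_sets sets_pair_measure_cong)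
    also have "\<dots> = (\<integral>\<^sup>+ z. \<integral>\<^sup>+ xy. indicator (A \<times> B) (fst xy, snd xy, z)
        \<partial>(distr M S X \<Otimes>\<^sub>M distr M T Y) \<partial>distr M N Z)"
      by (subst pair_sigma_finite.nn_integral_snd[symmetric])
         (auto intro!: pair_sigma_finite.intro Z.sigma_finite_measure XY.sigma_finite_measure cong: measurable_cong_sets sets_pair_measure_cong)
    also have "\<dots> = (\<integral>\<^sup>+ z. \<integral>\<^sup>+ y. \<integral>\<^sup>+ x. indicator A x * indicator B (y, z)
        \<partial>distr M S X \<partial>distr M T Y \<partial>distr M N Z)"
    proof (rule nn_integral_cong)
      fix z assume "z \<in> space (distr M N Z)"
      then have [measurable]: "z \<in> space N" by simp
      show "(\<integral>\<^sup>+ xy. indicator (A \<times> B) (fst xy, snd xy, z) \<partial>(distr M S X \<Otimes>\<^sub>M distr M T Y))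
          = (\<integral>\<^sup>+ y. \<integral>\<^sup>+ x. indicator A x * indicator B (y, z) \<partial>distr M S X \<partial>distr M T Y)"
        by (subst XY.nn_integral_snd[symmetric])
           (auto simp: indicator_times split_beta' cong: measurable_cong_sets sets_pair_measure_cong)
    qed
    also have "\<dots> = (\<integral>\<^sup>+ z. \<integral>\<^sup>+ y. emeasure (distr M S X) A * indicator B (y, z) \<partial>distr M T Y \<partial>distr M N Z)"
      by (simp add: nn_integral_multc)
    also have "\<dots> = (\<integral>\<^sup>+ q. emeasure (distr M S X) A * indicator B q \<partial>(distr M T Y \<Otimes>\<^sub>M distr M N Z))"
      by (rule YZ.nn_integral_snd) (use B in auto)
    also have "\<dots> = emeasure (distr M S X) A * emeasure (distr M T Y \<Otimes>\<^sub>M distr M N Z) B"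
      using B by (simp add: nn_integral_cmult)
    finally show "emeasure (distr M S X) A * emeasure (distr M T Y \<Otimes>\<^sub>M distr M N Z) B = emeasure ?D (A \<times> B)" ..
  qed
  also have "\<dots> = distr M (S \<Otimes>\<^sub>M (T \<Otimes>\<^sub>M N)) (\<lambda>\<omega>. (X \<omega>, Y \<omega>, Z \<omega>))"
    unfolding dXYZ[symmetric] by (subst distr_distr) (auto simp: comp_def case_prod_unfold)
  finally show ?thesis
    by (simp add: independent_def YZ)
qed

section \<open>Sums of centred indicators\<close>

lemma (in prob_space) expectation_independent_iterated:
  fixes f :: "'b \<times> 'c \<Rightarrow> real"
  assumes XY: "independent S X T Y" and f[measurable]: "f \<in> borel_measurable (S \<Otimes>\<^sub>M T)"
    and bnd: "\<And>q. \<bar>f q\<bar> \<le> c"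
  shows "expectation (\<lambda>\<omega>. f (X \<omega>, Y \<omega>)) = expectation (\<lambda>\<omega>. \<integral>a. f (a, Y \<omega>) \<partial>distr M S X)"
proof -
  note [measurable] = independent_rv[OF XY]
  interpret X: prob_space "distr M S X" by (rule prob_space_distr) simp
  interpret Y: prob_space "distr M T Y" by (rule prob_space_distr) simp
  interpret P: pair_prob_space "distr M S X" "distr M T Y" ..
  have mf[measurable]: "f \<in> borel_measurable (distr M S X \<Otimes>\<^sub>M distr M T Y)"
    by (simp cong: measurable_cong_sets sets_pair_measure_cong)
  have int: "integrable (distr M S X \<Otimes>\<^sub>M distr M T Y) (case_prod (\<lambda>a y. f (a, y)))"
    by (rule P.integrable_const_bound[of _ c]) (use bnd in auto)
  have "expectation (\<lambda>\<omega>. f (X \<omega>, Y \<omega>)) = (\<integral>q. f q \<partial>distr M (S \<Otimes>\<^sub>M T) (\<lambda>\<omega>. (X \<omega>, Y \<omega>)))"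
    by (simp add: integral_distr)
  also have "distr M (S \<Otimes>\<^sub>M T) (\<lambda>\<omega>. (X \<omega>, Y \<omega>)) = distr M S X \<Otimes>\<^sub>M distr M T Y"
    using XY by (simp add: independent_def)
  also have "(\<integral>q. f q \<partial>(distr M S X \<Otimes>\<^sub>M distr M T Y)) = (\<integral>y. \<integral>a. f (a, y) \<partial>distr M S X \<partial>distr M T Y)"
    using P.integral_snd[OF int] by simp
  also have "\<dots> = expectation (\<lambda>\<omega>. \<integral>a. f (a, Y \<omega>) \<partial>distr M S X)"
    by (rule integral_distr) measurable
  finally show ?thesis .
qed

text \<open>
  The effect on one indicator of moving the threshold from \<open>x\<close> to \<open>x + d\<close>, minus its mean.
\<close>
definition centred_indicator :: "(real \<Rightarrow> real) \<Rightarrow> real \<Rightarrow> real \<Rightarrow> real \<Rightarrow> real" where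
  "centred_indicator F x d a =
     indicator {..x + d} a - indicator {..x} a - (F (x + d) - F x)"

lemma borel_measurable_centred_indicator[measurable (raw)]:
  assumes [measurable]: "F \<in> borel_measurable borel" "f \<in> borel_measurable N" "g \<in> borel_measurable N"
  shows "(\<lambda>w. centred_indicator F x (f w) (g w)) \<in> borel_measurable N"
proof -
  have "(\<lambda>w. centred_indicator F x (f w) (g w)) = (\<lambda>w. (if g w \<le> x + f w then 1 else 0)
      - (if g w \<le> x then 1 else 0) - (F (x + f w) - F x))"
    by (auto simp: centred_indicator_def fun_eq_iff indicator_def)
  then show ?thesis by simp
qed

context real_distribution
begin

lemma abs_centred_indicator_le: "\<bar>centred_indicator (cdf M) x d a\<bar> \<le> 1"
  using cdf_nonneg[of x] cdf_nonneg[of "x + d"] cdf_bounded_prob[of x] cdf_bounded_prob[of "x + d"]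
    cdf_nondecreasing[of x "x + d"] cdf_nondecreasing[of "x + d" x]
  by (auto simp: centred_indicator_def indicator_def abs_if)

lemma
  shows integral_centred_indicator: "(\<integral>a. centred_indicator (cdf M) x d a \<partial>M) = 0"
    and integral_centred_indicator_square_le:
      "(\<integral>a. (centred_indicator (cdf M) x d a)\<^sup>2 \<partial>M) \<le> \<bar>cdf M (x + d) - cdf M x\<bar>"
proof -
  define m where "m = cdf M (x + d) - cdf M x"
  define k where "k a = (indicator {..x + d} a - indicator {..x} a :: real)" for a
  have ii: "integrable M (indicator {..u} :: real \<Rightarrow> real)" for u
    by (rule integrable_const_bound[of _ 1]) auto
  have ki: "integrable M k" unfolding k_def using ii by auto
  have km: "(\<integral>a. k a \<partial>M) = m"
    unfolding k_def m_def using ii by (simp add: cdf_def)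
  have ck: "centred_indicator (cdf M) x d a = k a - m" for a
    by (simp add: centred_indicator_def k_def m_def)
  have p1: "measure M UNIV = 1" using prob_space by simp
  show "(\<integral>a. centred_indicator (cdf M) x d a \<partial>M) = 0"
    unfolding ck using ki km by (simp add: p1)
  have k2: "(k a)\<^sup>2 = (if d \<ge> 0 then 1 else -1) * k a" for a
    by (auto simp: k_def indicator_def)
  have "(k a - m)\<^sup>2 = (if d \<ge> 0 then 1 else -1) * k a - 2 * m * k a + m\<^sup>2" for a
    unfolding k2[symmetric] by (simp add: power2_eq_square algebra_simps)
  then have "(\<integral>a. (k a - m)\<^sup>2 \<partial>M) = (if d \<ge> 0 then 1 else -1) * m - 2 * m * m + m\<^sup>2"
    using ki km by (simp add: p1)
  also have "\<dots> \<le> \<bar>m\<bar>"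
  proof -
    have "(if d \<ge> 0 then 1 else -1) * m \<le> \<bar>m\<bar>" by (simp add: abs_ge_self abs_ge_minus_self)
    then show ?thesis using zero_le_square[of m] unfolding power2_eq_square by linarith
  qed
  finally show "(\<integral>a. (centred_indicator (cdf M) x d a)\<^sup>2 \<partial>M) \<le> \<bar>cdf M (x + d) - cdf M x\<bar>"
    unfolding ck by (simp add: m_def)
qed

end

text \<open>
  Given the past, each summand has mean zero, so that distinct summands are orthogonal. A
  difference of two nested indicators has values in \<open>{0, 1}\<close> or in \<open>{-1, 0}\<close>; its second moment is
  therefore an increment of the distribution function, and the normalized sum is small as soon
  as the mean increments are.
\<close>
lemma (in prob_space) centred_indicator_sum_variance:
  fixes e D :: "int \<Rightarrow> 'a \<Rightarrow> real" and F :: "real \<Rightarrow> real" and x :: real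
  assumes F: "real_distribution L" "F = cdf L" and law: "\<And>t. t \<in> T \<Longrightarrow> distr M borel (e t) = L"
    and ind1: "\<And>t. t \<in> T \<Longrightarrow> independent borel (e t) borel (D t)"
    and ind: "\<And>s t. s \<in> T \<Longrightarrow> t \<in> T \<Longrightarrow> s < t \<Longrightarrow>
      independent borel (e t) (borel \<Otimes>\<^sub>M (borel \<Otimes>\<^sub>M borel)) (\<lambda>\<omega>. (e s \<omega>, D s \<omega>, D t \<omega>))"
    and "finite T"
  defines "X \<equiv> \<lambda>t \<omega>. centred_indicator F x (D t \<omega>) (e t \<omega>)"
  shows "integrable M (\<lambda>\<omega>. (\<Sum>t\<in>T. X t \<omega>)\<^sup>2)"
    and "expectation (\<lambda>\<omega>. (\<Sum>t\<in>T. X t \<omega>)\<^sup>2) \<le> (\<Sum>t\<in>T. expectation (\<lambda>\<omega>. \<bar>F (x + D t \<omega>) - F x\<bar>))"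
proof -
  interpret L: real_distribution L by fact
  let ?h = "centred_indicator F x"
  have rv[measurable]: "random_variable borel (e t)" "random_variable borel (D t)" if "t \<in> T" for t
    using independent_rv[OF ind1[OF that]] by auto
  have "mono F" unfolding F(2) by (intro monoI L.cdf_nondecreasing)
  then have Fm[measurable]: "F \<in> borel_measurable borel" by (rule borel_measurable_mono)
  have F01: "0 \<le> F u" "F u \<le> 1" for u
    unfolding F(2) by (simp_all add: L.cdf_nonneg L.cdf_bounded_prob)
  have habs: "\<bar>?h d a\<bar> \<le> 1" for d a
    unfolding F(2) by (rule L.abs_centred_indicator_le)
  have int: "integrable M (\<lambda>\<omega>. X s \<omega> * X t \<omega>)" if "s \<in> T" "t \<in> T" for s t
  proof (rule integrable_const_bound[of _ 1])
    show "AE \<omega> in M. norm (X s \<omega> * X t \<omega>) \<le> 1"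
      using habs by (auto simp: X_def abs_mult intro!: mult_le_one)
  qed (use that in \<open>simp add: X_def\<close>)
  have lt: "expectation (\<lambda>\<omega>. X s \<omega> * X t \<omega>) = 0" if "s \<in> T" "t \<in> T" "s < t" for s t
  proof -
    define f where "f = (\<lambda>(a, b, d, d'). ?h d b * ?h d' a)"
    have f1: "\<bar>f q\<bar> \<le> 1" for q
      using habs by (auto simp: f_def abs_mult split_beta intro!: mult_le_one)
    have [measurable]: "f \<in> borel_measurable (borel \<Otimes>\<^sub>M borel \<Otimes>\<^sub>M borel \<Otimes>\<^sub>M borel)"
      unfolding f_def by measurable
    have "expectation (\<lambda>\<omega>. X s \<omega> * X t \<omega>) = expectation (\<lambda>\<omega>. f (e t \<omega>, e s \<omega>, D s \<omega>, D t \<omega>))"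
      by (simp add: X_def f_def)
    also have "\<dots> = expectation (\<lambda>\<omega>. \<integral>a. f (a, e s \<omega>, D s \<omega>, D t \<omega>) \<partial>distr M borel (e t))"
      by (rule expectation_independent_iterated[OF ind[OF that] _ f1]) measurable
    also have "\<dots> = 0"
      unfolding law[OF that(2)] by (simp add: f_def F(2) L.integral_centred_indicator)
    finally show ?thesis .
  qed
  have orth: "expectation (\<lambda>\<omega>. X s \<omega> * X t \<omega>) = 0" if "s \<in> T" "t \<in> T" "s \<noteq> t" for s t
  proof (cases "s < t")
    case False
    have "expectation (\<lambda>\<omega>. X s \<omega> * X t \<omega>) = expectation (\<lambda>\<omega>. X t \<omega> * X s \<omega>)"
      by (simp only: mult.commute)
    then show ?thesis using lt[of t s] that False by simp
  qed (use lt that in blast)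
  have sq: "expectation (\<lambda>\<omega>. (X t \<omega>)\<^sup>2) \<le> expectation (\<lambda>\<omega>. \<bar>F (x + D t \<omega>) - F x\<bar>)" if t: "t \<in> T" for t
  proof -
    define f where "f = (\<lambda>(a, d). (?h d a)\<^sup>2)"
    have f1: "\<bar>f q\<bar> \<le> 1" for q
      using habs by (auto simp: f_def abs_square_le_1 split_beta)
    have fm[measurable]: "f \<in> borel_measurable (borel \<Otimes>\<^sub>M borel)"
      unfolding f_def by measurable
    have fl: "(\<integral>a. f (a, d) \<partial>L) \<le> \<bar>F (x + d) - F x\<bar>" for d
      using L.integral_centred_indicator_square_le[of x d] by (simp add: f_def F(2))
    have f0: "0 \<le> (\<integral>a. f (a, d) \<partial>L)" for d
      by (rule integral_nonneg_AE) (simp add: f_def)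
    have F1: "\<bar>F (x + d) - F x\<bar> \<le> 1" for d
      using F01[of x] F01[of "x + d"] by linarith
    have "expectation (\<lambda>\<omega>. (X t \<omega>)\<^sup>2) = expectation (\<lambda>\<omega>. f (e t \<omega>, D t \<omega>))"
      by (simp add: X_def f_def)
    also have "\<dots> = expectation (\<lambda>\<omega>. \<integral>a. f (a, D t \<omega>) \<partial>distr M borel (e t))"
      by (rule expectation_independent_iterated[OF ind1[OF t] fm f1])
    also have "\<dots> = expectation (\<lambda>\<omega>. \<integral>a. f (a, D t \<omega>) \<partial>L)"
      by (simp add: law[OF t])
    also have "\<dots> \<le> expectation (\<lambda>\<omega>. \<bar>F (x + D t \<omega>) - F x\<bar>)"
    proof (rule integral_mono)
      show "integrable M (\<lambda>\<omega>. \<bar>F (x + D t \<omega>) - F x\<bar>)"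
        by (rule integrable_const_bound[of _ 1]) (use t F1 in auto)
      show "integrable M (\<lambda>\<omega>. \<integral>a. f (a, D t \<omega>) \<partial>L)"
        by (rule integrable_const_bound[of _ 1])
           (use t in \<open>auto intro!: AE_I2 order_trans[OF fl F1] simp: f0\<close>)
    qed (rule fl)
    finally show ?thesis .
  qed
  show "integrable M (\<lambda>\<omega>. (\<Sum>t\<in>T. X t \<omega>)\<^sup>2)"
    by (rule expectation_square_orthogonal_sum(1)[OF \<open>finite T\<close> int orth])
  have "expectation (\<lambda>\<omega>. (\<Sum>t\<in>T. X t \<omega>)\<^sup>2) = (\<Sum>t\<in>T. expectation (\<lambda>\<omega>. (X t \<omega>)\<^sup>2))"
    by (rule expectation_square_orthogonal_sum(2)[OF \<open>finite T\<close> int orth])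
  then show "expectation (\<lambda>\<omega>. (\<Sum>t\<in>T. X t \<omega>)\<^sup>2) \<le> (\<Sum>t\<in>T. expectation (\<lambda>\<omega>. \<bar>F (x + D t \<omega>) - F x\<bar>))"
    using sq by (simp add: sum_mono)
qed

section \<open>Distribution functions with a Lipschitz density\<close>

definition has_lipschitz_density :: "(real \<Rightarrow> real) \<Rightarrow> (real \<Rightarrow> real) \<Rightarrow> real \<Rightarrow> bool" where
  "has_lipschitz_density F f C \<longleftrightarrow>
     (\<forall>u. (F has_real_derivative f u) (at u)) \<and> (\<forall>u v. \<bar>f u - f v\<bar> \<le> C * \<bar>u - v\<bar>)"

lemma mean_value_between:
  assumes "\<And>u. (F has_real_derivative f u) (at u)"
  obtains w where "\<bar>w - x\<bar> \<le> \<bar>y - x\<bar>" "F y - F x = (y - x) * f w"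
proof (cases x y rule: linorder_cases)
  case less
  with MVT2[of x y F f] assms obtain w where "x < w" "w < y" "F y - F x = (y - x) * f w" by blast
  then show ?thesis by (intro that[of w]) auto
next
  case greater
  with MVT2[of y x F f] assms obtain w where w: "y < w" "w < x" "F x - F y = (x - y) * f w" by blast
  then have "F y - F x = (y - x) * f w" by (simp add: algebra_simps)
  with w show ?thesis by (intro that[of w]) auto
qed (use that[of x] in auto)

lemma lipschitz_density_const_nonneg: "0 \<le> C" if "has_lipschitz_density F f C"
proof -
  have "\<bar>f 1 - f 0\<bar> \<le> C * \<bar>1 - 0\<bar>" using that unfolding has_lipschitz_density_def by blast
  then show ?thesis using abs_ge_zero[of "f 1 - f 0"] by simp
qed

lemma taylor_lipschitz_density:
  assumes F: "has_lipschitz_density F f C"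
  shows "\<bar>F (x + d) - F x - f x * d\<bar> \<le> C * d\<^sup>2"
proof -
  obtain w where w: "\<bar>w - x\<bar> \<le> \<bar>d\<bar>" "F (x + d) - F x = d * f w"
    using mean_value_between[of F f x "x + d"] F by (auto simp: has_lipschitz_density_def)
  have C: "\<bar>f w - f x\<bar> \<le> C * \<bar>w - x\<bar>"
    using F by (simp add: has_lipschitz_density_def)
  have C0: "0 \<le> C" by (rule lipschitz_density_const_nonneg[OF F])
  have "F (x + d) - F x - f x * d = (f w - f x) * d" using w by (simp add: algebra_simps)
  then have "\<bar>F (x + d) - F x - f x * d\<bar> = \<bar>f w - f x\<bar> * \<bar>d\<bar>" by (simp add: abs_mult)
  also have "\<dots> \<le> (C * \<bar>d\<bar>) * \<bar>d\<bar>"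
    using C0 w by (intro mult_right_mono order_trans[OF C] mult_left_mono) auto
  finally show ?thesis by (simp add: power2_eq_square abs_mult[symmetric] mult.assoc)
qed

text \<open>
  The increment of \<open>F\<close> over a unit interval is at most one and is attained by \<open>f\<close> somewhere in it.
\<close>
lemma lipschitz_density_bounded:
  assumes F: "has_lipschitz_density F f C" and range: "\<And>u. 0 \<le> F u \<and> F u \<le> 1"
  shows "\<bar>f u\<bar> \<le> 1 + C"
proof -
  have C0: "0 \<le> C" by (rule lipschitz_density_const_nonneg[OF F])
  obtain w where w: "\<bar>w - u\<bar> \<le> 1" "F (u + 1) - F u = f w"
    using mean_value_between[of F f u "u + 1"] F by (auto simp: has_lipschitz_density_def)
  have "\<bar>f u - f w\<bar> \<le> C * \<bar>u - w\<bar>" using F by (simp add: has_lipschitz_density_def)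
  also have "\<dots> \<le> C * 1" using w C0 by (intro mult_left_mono) (auto simp: abs_minus_commute)
  finally show ?thesis using w(2) range[of u] range[of "u + 1"] by linarith
qed

lemma lipschitz_density_lipschitz:
  assumes F: "has_lipschitz_density F f C" and range: "\<And>u. 0 \<le> F u \<and> F u \<le> 1"
  shows "\<bar>F u - F v\<bar> \<le> (1 + C) * \<bar>u - v\<bar>"
proof -
  have D: "(F has_real_derivative f u) (at u)" for u
    using F by (simp add: has_lipschitz_density_def)
  obtain w where w: "F u - F v = (u - v) * f w"
    using mean_value_between[OF D, of v u] by metis
  have "\<bar>F u - F v\<bar> = \<bar>f w\<bar> * \<bar>u - v\<bar>" using w by (simp add: abs_mult)
  then show ?thesis
    using lipschitz_density_bounded[OF F range, of w] by (simp add: mult_right_mono)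
qed

lemma has_lipschitz_density_mixture:
  assumes F: "has_lipschitz_density F f C" and K: "has_lipschitz_density K k C"
    and r: "0 \<le> r" "r \<le> 1"
  shows "has_lipschitz_density (\<lambda>u. (1 - r) * F u + r * K u) (\<lambda>u. (1 - r) * f u + r * k u) C"
  unfolding has_lipschitz_density_def
proof (intro conjI allI)
  show "((\<lambda>u. (1 - r) * F u + r * K u) has_real_derivative (1 - r) * f u + r * k u) (at u)" for u
    using F K unfolding has_lipschitz_density_def
    by (auto intro!: derivative_eq_intros)
  fix u v
  have "\<bar>((1 - r) * f u + r * k u) - ((1 - r) * f v + r * k v)\<bar> = \<bar>(1 - r) * (f u - f v) + r * (k u - k v)\<bar>"
    by (simp add: algebra_simps)
  also have "\<dots> \<le> \<bar>(1 - r) * (f u - f v)\<bar> + \<bar>r * (k u - k v)\<bar>" by (rule abs_triangle_ineq)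
  also have "\<dots> = (1 - r) * \<bar>f u - f v\<bar> + r * \<bar>k u - k v\<bar>" using r by (simp add: abs_mult)
  also have "\<dots> \<le> (1 - r) * (C * \<bar>u - v\<bar>) + r * (C * \<bar>u - v\<bar>)"
    using F K r unfolding has_lipschitz_density_def by (intro add_mono mult_left_mono) auto
  finally show "\<bar>((1 - r) * f u + r * k u) - ((1 - r) * f v + r * k v)\<bar> \<le> C * \<bar>u - v\<bar>"
    by (simp add: algebra_simps)
qed

lemma has_lipschitz_density_mono:
  "has_lipschitz_density F f C \<Longrightarrow> C \<le> C' \<Longrightarrow> has_lipschitz_density F f C'"
  unfolding has_lipschitz_density_def by (meson abs_ge_zero mult_right_mono order_trans)

lemma has_lipschitz_density_deriv:
  assumes "\<And>u. F differentiable (at u)" "\<And>u. deriv F differentiable (at u)"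
    and "\<And>u. \<bar>deriv (deriv F) u\<bar> \<le> C"
  shows "has_lipschitz_density F (deriv F) C"
  unfolding has_lipschitz_density_def
proof (intro conjI allI)
  have D: "(K has_real_derivative deriv K u) (at u)" if "K differentiable (at u)" for K :: "real \<Rightarrow> real" and u
    using that by (simp add: DERIV_deriv_iff_real_differentiable)
  show "(F has_real_derivative deriv F u) (at u)" for u by (rule D) fact
  fix u v
  obtain w where "deriv F u - deriv F v = (u - v) * deriv (deriv F) w"
    using mean_value_between[of "deriv F" "deriv (deriv F)" v u] D assms(2) by metis
  then have "\<bar>deriv F u - deriv F v\<bar> = \<bar>deriv (deriv F) w\<bar> * \<bar>u - v\<bar>" by (simp add: abs_mult)
  then show "\<bar>deriv F u - deriv F v\<bar> \<le> C * \<bar>u - v\<bar>"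
    using assms(3)[of w] by (simp add: mult_right_mono)
qed

lemma std_normal_cdf_range: "0 \<le> std_normal_cdf u" "std_normal_cdf u \<le> 1"
  using real_distribution.cdf_bounded_prob[OF real_dist_normal_dist]
    finite_borel_measure.cdf_nonneg[OF real_distribution.finite_borel_measure_M[OF real_dist_normal_dist]]
  by (auto simp: std_normal_cdf_def)

lemma DERIV_std_normal_cdf: "(std_normal_cdf has_real_derivative std_normal_density u) (at u)"
proof -
  interpret N: real_distribution std_normal_distribution by (rule real_dist_normal_dist)
  define a where "a = u - 1"
  have cont: "continuous_on S std_normal_density" for S
    unfolding std_normal_density_def by (intro continuous_intros) auto
  have eq: "std_normal_cdf w = std_normal_cdf a + (LBINT y=a..w. std_normal_density y)" if "a \<le> w" for w
  proof -
    have "std_normal_cdf w - std_normal_cdf a = measure std_normal_distribution {a<..w}"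
      using that N.cdf_diff_eq[of a w] by (cases "a = w") (auto simp: std_normal_cdf_def)
    also have "\<dots> = (\<integral>y. indicator {a<..w} y \<partial>std_normal_distribution)" by simp
    also have "\<dots> = (\<integral>y. std_normal_density y *\<^sub>R indicator {a<..w} y \<partial>lborel)"
      by (rule integral_density) auto
    also have "\<dots> = (LBINT y:{a<..w}. std_normal_density y)"
      by (simp add: set_lebesgue_integral_def mult.commute)
    also have "\<dots> = (LBINT y=a..w. std_normal_density y)"
      using that by (simp add: interval_integral_Ioc)
    finally show ?thesis by simp
  qed
  have "((\<lambda>w. LBINT y=a..w. std_normal_density y) has_vector_derivative std_normal_density u) (at u within {a..u+1})"
    by (rule interval_integral_FTC2) (auto simp: a_def cont)
  then have "((\<lambda>w. std_normal_cdf a + (LBINT y=a..w. std_normal_density y)) has_real_derivative std_normal_density u) (at u within {a..u+1})"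
    by (auto simp: has_real_derivative_iff_has_vector_derivative intro!: derivative_eq_intros)
  then have "(std_normal_cdf has_real_derivative std_normal_density u) (at u within {a..u+1})"
    by (rule has_field_derivative_transform_within[of _ _ _ _ 1]) (auto simp: a_def eq[unfolded a_def, symmetric])
  then show ?thesis
    by (subst (asm) at_within_Icc_at) (auto simp: a_def)
qed

lemma std_normal_density_lipschitz: "\<bar>std_normal_density u - std_normal_density v\<bar> \<le> \<bar>u - v\<bar>"
proof -
  have D: "(std_normal_density has_real_derivative - w * std_normal_density w) (at w)" for w
  proof -
    have "((\<lambda>w. 1 / sqrt (2 * pi) * exp (- w\<^sup>2 / 2)) has_real_derivative
        1 / sqrt (2 * pi) * (exp (- w\<^sup>2 / 2) * (- w))) (at w)"
      by (rule DERIV_cmult) (auto intro!: derivative_eq_intros)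
    then show ?thesis unfolding std_normal_density_def by (simp only: mult_ac)
  qed
  obtain w where w: "std_normal_density u - std_normal_density v = (u - v) * (- w * std_normal_density w)"
    using mean_value_between[OF D, of v u] by metis
  have "\<bar>w\<bar> * std_normal_density w \<le> 1"
  proof -
    have "2 * \<bar>w\<bar> \<le> 1 + w\<^sup>2"
      using sum_squares_bound[of 1 "\<bar>w\<bar>"] by simp
    then have "\<bar>w\<bar> \<le> 1 + w\<^sup>2 / 2" by simp
    also have "\<dots> \<le> exp (w\<^sup>2 / 2)" by (rule exp_ge_add_one_self)
    finally have "\<bar>w\<bar> * exp (- w\<^sup>2 / 2) \<le> 1" by (simp add: exp_minus field_simps)
    moreover have "1 / sqrt (2 * pi) \<le> 1" using pi_ge_two by simp
    ultimately have "1 / sqrt (2 * pi) * (\<bar>w\<bar> * exp (- w\<^sup>2 / 2)) \<le> 1 * 1"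
      by (intro mult_mono) auto
    then show ?thesis by (simp add: std_normal_density_def mult_ac)
  qed
  then have "\<bar>u - v\<bar> * (\<bar>w\<bar> * std_normal_density w) \<le> \<bar>u - v\<bar> * 1"
    by (intro mult_left_mono) auto
  then show ?thesis unfolding w by (simp add: abs_mult)
qed

lemma has_lipschitz_density_normal:
  assumes "\<theta> > 0"
  shows "has_lipschitz_density (\<lambda>u. std_normal_cdf (u / \<theta>)) (\<lambda>u. 1 / \<theta> * std_normal_density (u / \<theta>)) (1 / \<theta>\<^sup>2)"
  unfolding has_lipschitz_density_def
proof (intro conjI allI)
  show "((\<lambda>u. std_normal_cdf (u / \<theta>)) has_real_derivative 1 / \<theta> * std_normal_density (u / \<theta>)) (at u)" for u
    using DERIV_chain2[OF DERIV_std_normal_cdf DERIV_cdivide[OF DERIV_ident], of \<theta> u]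
    by (simp add: mult.commute)
  fix u v
  have "\<bar>1 / \<theta> * std_normal_density (u / \<theta>) - 1 / \<theta> * std_normal_density (v / \<theta>)\<bar>
      = 1 / \<theta> * \<bar>std_normal_density (u / \<theta>) - std_normal_density (v / \<theta>)\<bar>"
    using assms by (simp flip: diff_divide_distrib)
  also have "\<dots> \<le> 1 / \<theta> * \<bar>u / \<theta> - v / \<theta>\<bar>"
    using assms by (intro mult_left_mono std_normal_density_lipschitz) auto
  also have "\<dots> = 1 / \<theta>\<^sup>2 * \<bar>u - v\<bar>"
    using assms by (simp add: power2_eq_square flip: diff_divide_distrib)
  finally show "\<bar>1 / \<theta> * std_normal_density (u / \<theta>) - 1 / \<theta> * std_normal_density (v / \<theta>)\<bar> \<le> 1 / \<theta>\<^sup>2 * \<bar>u - v\<bar>" .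
qed

text \<open>
  The law \<open>L\<close> is determined by its distribution function, hence is the law obtained by choosing
  between \<open>N\<close> and \<open>K\<close> with a coin; its integrals are then computed by conditioning on the coin.
\<close>
lemma second_moment_mixture:
  assumes L: "real_distribution L" and N: "real_distribution N" and K: "real_distribution K"
    and r: "0 \<le> r" "r \<le> 1" and cdf: "\<And>u. cdf L u = (1 - r) * cdf N u + r * cdf K u"
    and intN: "integrable N (\<lambda>u. u\<^sup>2)" and intK: "integrable K (\<lambda>u. u\<^sup>2)"
  shows "(\<integral>u. u\<^sup>2 \<partial>L) = (1 - r) * (\<integral>u. u\<^sup>2 \<partial>N) + r * (\<integral>u. u\<^sup>2 \<partial>K)"
proof -
  interpret L: real_distribution L by fact
  interpret N: real_distribution N by fact
  interpret K: real_distribution K by fact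
  let ?N = "\<lambda>b. if b then K else N"
  have meas[measurable]: "?N \<in> measure_pmf (bernoulli_pmf r) \<rightarrow>\<^sub>M subprob_algebra borel"
    by (auto simp: space_subprob_algebra intro!: prob_space_imp_subprob_space N.prob_space_axioms K.prob_space_axioms split: if_splits)
  define B where "B = measure_pmf (bernoulli_pmf r) \<bind> ?N"
  have sets_B: "sets B = sets borel"
    unfolding B_def
  proof (rule sets_bind)
    show "sets (?N b) = sets borel" for b by (cases b) simp_all
  qed simp
  have "prob_space B"
    unfolding B_def by (rule prob_space.prob_space_bind[OF prob_space_measure_pmf _ meas]) (auto simp: N.prob_space_axioms K.prob_space_axioms)
  then have B: "real_distribution B"
    using sets_B by (auto simp: real_distribution_def real_distribution_axioms_def)
  interpret B: real_distribution B by fact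
  have "cdf B u = cdf L u" for u
  proof -
    have "emeasure B {..u} = ennreal ((1 - r) * cdf N u + r * cdf K u)"
    proof -
      have "emeasure B {..u} = (\<integral>\<^sup>+b. emeasure (?N b) {..u} \<partial>measure_pmf (bernoulli_pmf r))"
        unfolding B_def by (rule emeasure_bind[OF _ meas]) auto
      also have "\<dots> = emeasure K {..u} * ennreal r + emeasure N {..u} * ennreal (1 - r)"
        by (subst nn_integral_bernoulli_pmf) (use r in simp_all)
      also have "\<dots> = ennreal (cdf K u) * ennreal r + ennreal (cdf N u) * ennreal (1 - r)"
        by (simp only: cdf_def N.emeasure_eq_measure K.emeasure_eq_measure)
      also have "\<dots> = ennreal (cdf K u * r + cdf N u * (1 - r))"
        using r N.cdf_nonneg[of u] K.cdf_nonneg[of u] by (simp add: ennreal_mult ennreal_plus)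
      finally show ?thesis by (simp add: mult.commute add.commute)
    qed
    moreover have "cdf B u = enn2real (emeasure B {..u})"
      unfolding cdf_def measure_def ..
    moreover have "0 \<le> (1 - r) * cdf N u + r * cdf K u"
      using N.cdf_nonneg[of u] K.cdf_nonneg[of u] r by (intro add_nonneg_nonneg mult_nonneg_nonneg) auto
    ultimately show ?thesis by (simp only: cdf enn2real_ennreal)
  qed
  then have LB: "L = B" by (intro cdf_unique[OF L B] ext) simp
  have pos: "0 \<le> (\<integral>u. u\<^sup>2 \<partial>N)" "0 \<le> (\<integral>u. u\<^sup>2 \<partial>K)"
    by (rule integral_nonneg_AE, simp)+
  have "(\<integral>\<^sup>+u. ennreal (u\<^sup>2) \<partial>B) = ennreal ((1 - r) * (\<integral>u. u\<^sup>2 \<partial>N) + r * (\<integral>u. u\<^sup>2 \<partial>K))"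
  proof -
    have "(\<integral>\<^sup>+u. ennreal (u\<^sup>2) \<partial>B)
        = (\<integral>\<^sup>+b. \<integral>\<^sup>+u. ennreal (u\<^sup>2) \<partial>(?N b) \<partial>measure_pmf (bernoulli_pmf r))"
      unfolding B_def by (rule nn_integral_bind[OF _ meas]) simp
    also have "\<dots> = (\<integral>\<^sup>+u. ennreal (u\<^sup>2) \<partial>K) * ennreal r + (\<integral>\<^sup>+u. ennreal (u\<^sup>2) \<partial>N) * ennreal (1 - r)"
      by (subst nn_integral_bernoulli_pmf) (use r in simp_all)
    also have "\<dots> = ennreal (\<integral>u. u\<^sup>2 \<partial>K) * ennreal r + ennreal (\<integral>u. u\<^sup>2 \<partial>N) * ennreal (1 - r)"
      using intN intK by (simp only: nn_integral_eq_integral zero_le_power2 AE_I2)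
    also have "\<dots> = ennreal ((\<integral>u. u\<^sup>2 \<partial>K) * r + (\<integral>u. u\<^sup>2 \<partial>N) * (1 - r))"
      using r pos by (simp add: ennreal_mult ennreal_plus)
    also have "(\<integral>u. u\<^sup>2 \<partial>K) * r + (\<integral>u. u\<^sup>2 \<partial>N) * (1 - r) = (1 - r) * (\<integral>u. u\<^sup>2 \<partial>N) + r * (\<integral>u. u\<^sup>2 \<partial>K)"
      by (simp add: mult.commute add.commute)
    finally show ?thesis .
  qed
  moreover have "(\<integral>u. u\<^sup>2 \<partial>B) = enn2real (\<integral>\<^sup>+u. ennreal (u\<^sup>2) \<partial>B)"
    by (rule integral_eq_nn_integral) auto
  moreover have "0 \<le> (1 - r) * (\<integral>u. u\<^sup>2 \<partial>N) + r * (\<integral>u. u\<^sup>2 \<partial>K)"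
    using pos r by (intro add_nonneg_nonneg mult_nonneg_nonneg) auto
  ultimately show ?thesis unfolding LB by (simp only: enn2real_ennreal)
qed

lemma second_moment_normal_mixture:
  assumes L: "real_distribution L" and K: "real_distribution K" and "\<theta> > 0" and r: "0 \<le> r" "r \<le> 1"
    and cdf: "\<And>u. cdf L u = (1 - r) * std_normal_cdf (u / \<theta>) + r * cdf K u"
    and intK: "integrable K (\<lambda>u. u\<^sup>2)"
  shows "(\<integral>u. u\<^sup>2 \<partial>L) \<le> \<theta>\<^sup>2 + (\<integral>u. u\<^sup>2 \<partial>K)"
proof -
  interpret S: real_distribution std_normal_distribution by (rule real_dist_normal_dist)
  define N where "N = distr std_normal_distribution borel (\<lambda>u. \<theta> * u)"
  have N: "real_distribution N" unfolding N_def by (rule S.real_distribution_distr) simp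
  have "cdf N u = std_normal_cdf (u / \<theta>)" for u
  proof -
    have "(\<lambda>u. \<theta> * u) -` {..u} = {..u / \<theta>}" using \<open>\<theta> > 0\<close> by (auto simp: field_simps)
    then show ?thesis by (simp add: N_def cdf_def std_normal_cdf_def measure_distr)
  qed
  moreover have s: "integrable std_normal_distribution (\<lambda>u. u\<^sup>2)" "(\<integral>u. u\<^sup>2 \<partial>std_normal_distribution) = 1"
    using std_normal_distribution_even_moments[of 1] by simp_all
  then have "integrable N (\<lambda>u. u\<^sup>2)" "(\<integral>u. u\<^sup>2 \<partial>N) = \<theta>\<^sup>2"
    by (simp_all add: N_def integrable_distr_eq integral_distr power_mult_distrib)
  ultimately have "(\<integral>u. u\<^sup>2 \<partial>L) = (1 - r) * \<theta>\<^sup>2 + r * (\<integral>u. u\<^sup>2 \<partial>K)"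
    using second_moment_mixture[OF L N K r _ _ intK] cdf by simp
  also have "\<dots> \<le> 1 * \<theta>\<^sup>2 + 1 * (\<integral>u. u\<^sup>2 \<partial>K)"
    using r by (intro add_mono mult_right_mono) auto
  finally show ?thesis by simp
qed

section \<open>Series of random variables\<close>

text \<open>
  Cauchy-Schwarz with respect to the weights \<open>\<bar>w k\<bar>\<close> bounds the squared series by the total weight
  times \<open>\<Sum>k. \<bar>w k\<bar> * (X k \<omega>)\<^sup>2\<close>. The terms \<open>X k\<close> may be arbitrarily dependent, so that the lemma applies both
  to innovations and to their averages over a window.
\<close>
lemma (in prob_space) weighted_series_second_moment:
  fixes w :: "nat \<Rightarrow> real" and X :: "nat \<Rightarrow> 'a \<Rightarrow> real"
  assumes w: "summable (\<lambda>k. \<bar>w k\<bar>)"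
    and [measurable]: "\<And>k. random_variable borel (X k)"
    and int: "\<And>k. integrable M (\<lambda>\<omega>. (X k \<omega>)\<^sup>2)" and c: "\<And>k. expectation (\<lambda>\<omega>. (X k \<omega>)\<^sup>2) \<le> c"
  shows "AE \<omega> in M. summable (\<lambda>k. \<bar>w k * X k \<omega>\<bar>)"
    and "integrable M (\<lambda>\<omega>. (\<Sum>k. w k * X k \<omega>)\<^sup>2)"
    and "expectation (\<lambda>\<omega>. (\<Sum>k. w k * X k \<omega>)\<^sup>2) \<le> (\<Sum>k. \<bar>w k\<bar>)\<^sup>2 * c"
proof -
  define W where "W = (\<Sum>k. \<bar>w k\<bar>)"
  have W0: "0 \<le> W" unfolding W_def by (intro suminf_nonneg w) auto
  have c0: "0 \<le> c" using c[of 0] by (rule order_trans[rotated]) simp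
  have nn: "(\<integral>\<^sup>+\<omega>. ennreal ((X k \<omega>)\<^sup>2) \<partial>M) \<le> ennreal c" for k
    by (subst nn_integral_eq_integral[OF int]) (use c[of k] in \<open>auto intro: ennreal_leI\<close>)
  have total: "(\<integral>\<^sup>+\<omega>. (\<Sum>k. ennreal (\<bar>w k\<bar> * (X k \<omega>)\<^sup>2)) \<partial>M) \<le> ennreal (W * c)"
  proof -
    have "(\<integral>\<^sup>+\<omega>. (\<Sum>k. ennreal (\<bar>w k\<bar> * (X k \<omega>)\<^sup>2)) \<partial>M) = (\<Sum>k. ennreal \<bar>w k\<bar> * (\<integral>\<^sup>+\<omega>. ennreal ((X k \<omega>)\<^sup>2) \<partial>M))"
      by (simp add: nn_integral_suminf ennreal_mult nn_integral_cmult)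
    also have "\<dots> \<le> (\<Sum>k. ennreal \<bar>w k\<bar> * ennreal c)"
      by (intro suminf_le mult_left_mono nn) auto
    also have "\<dots> = (\<Sum>k. ennreal (\<bar>w k\<bar> * c))"
      using c0 by (simp add: ennreal_mult)
    also have "\<dots> = ennreal (\<Sum>k. \<bar>w k\<bar> * c)"
      using c0 w by (intro suminf_ennreal2 summable_mult2) auto
    also have "(\<Sum>k. \<bar>w k\<bar> * c) = W * c"
      unfolding W_def by (rule suminf_mult2[symmetric]) (rule w)
    finally show ?thesis .
  qed
  have "AE \<omega> in M. (\<Sum>k. ennreal (\<bar>w k\<bar> * (X k \<omega>)\<^sup>2)) \<noteq> \<infinity>"
    by (rule nn_integral_noteq_infinite) (use total in \<open>auto simp: top_unique\<close>)
  then have ae2: "AE \<omega> in M. summable (\<lambda>k. \<bar>w k\<bar> * (X k \<omega>)\<^sup>2)"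
    by eventually_elim (auto intro!: summable_suminf_not_top)
  have young: "summable (\<lambda>k. \<bar>w k * X k \<omega>\<bar>)" if "summable (\<lambda>k. \<bar>w k\<bar> * (X k \<omega>)\<^sup>2)" for \<omega>
  proof (rule summable_comparison_test'[OF summable_add[OF w that]])
    fix k
    have "\<bar>X k \<omega>\<bar> \<le> 1 + (X k \<omega>)\<^sup>2"
      using sum_squares_bound[of 1 "\<bar>X k \<omega>\<bar>"] by simp
    then have "\<bar>w k\<bar> * \<bar>X k \<omega>\<bar> \<le> \<bar>w k\<bar> * (1 + (X k \<omega>)\<^sup>2)" by (rule mult_left_mono) simp
    then show "norm \<bar>w k * X k \<omega>\<bar> \<le> \<bar>w k\<bar> + \<bar>w k\<bar> * (X k \<omega>)\<^sup>2"
      by (simp add: abs_mult algebra_simps)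
  qed
  show "AE \<omega> in M. summable (\<lambda>k. \<bar>w k * X k \<omega>\<bar>)"
    using ae2 by eventually_elim (rule young)
  have cs: "(\<Sum>k. w k * X k \<omega>)\<^sup>2 \<le> W * (\<Sum>k. \<bar>w k\<bar> * (X k \<omega>)\<^sup>2)" if s: "summable (\<lambda>k. \<bar>w k\<bar> * (X k \<omega>)\<^sup>2)" for \<omega>
  proof (rule LIMSEQ_le)
    have "summable (\<lambda>k. w k * X k \<omega>)" using young[OF s] by (rule summable_rabs_cancel)
    then show "(\<lambda>K. (\<Sum>k<K. w k * X k \<omega>)\<^sup>2) \<longlonglongrightarrow> (\<Sum>k. w k * X k \<omega>)\<^sup>2"
      by (intro tendsto_power summable_LIMSEQ)
    show "(\<lambda>K. (\<Sum>k<K. \<bar>w k\<bar>) * (\<Sum>k<K. \<bar>w k\<bar> * (X k \<omega>)\<^sup>2)) \<longlonglongrightarrow> W * (\<Sum>k. \<bar>w k\<bar> * (X k \<omega>)\<^sup>2)"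
      unfolding W_def by (intro tendsto_mult summable_LIMSEQ w s)
    have "(\<Sum>k<K. w k * X k \<omega>)\<^sup>2 \<le> (\<Sum>k<K. \<bar>w k\<bar>) * (\<Sum>k<K. \<bar>w k\<bar> * (X k \<omega>)\<^sup>2)" for K
    proof -
      have "(\<Sum>k<K. w k * X k \<omega>)\<^sup>2 = (\<Sum>k<K. sqrt \<bar>w k\<bar> * (sgn (w k) * sqrt \<bar>w k\<bar> * X k \<omega>))\<^sup>2"
        by (intro arg_cong[where f = "\<lambda>s. s\<^sup>2"] sum.cong refl)
           (metis abs_ge_zero mult.assoc mult.commute mult_sgn_abs real_sqrt_mult_self abs_of_nonneg)
      also have "\<dots> \<le> (\<Sum>k<K. (sqrt \<bar>w k\<bar>)\<^sup>2) * (\<Sum>k<K. (sgn (w k) * sqrt \<bar>w k\<bar> * X k \<omega>)\<^sup>2)"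
        by (rule Cauchy_Schwarz_ineq_sum)
      also have "(\<Sum>k<K. (sgn (w k) * sqrt \<bar>w k\<bar> * X k \<omega>)\<^sup>2) = (\<Sum>k<K. \<bar>w k\<bar> * (X k \<omega>)\<^sup>2)"
        by (intro sum.cong refl) (auto simp: power_mult_distrib sgn_if)
      finally show ?thesis by simp
    qed
    then show "\<exists>N. \<forall>K\<ge>N. (\<Sum>k<K. w k * X k \<omega>)\<^sup>2 \<le> (\<Sum>k<K. \<bar>w k\<bar>) * (\<Sum>k<K. \<bar>w k\<bar> * (X k \<omega>)\<^sup>2)"
      by blast
  qed
  have bound: "(\<integral>\<^sup>+\<omega>. ennreal ((\<Sum>k. w k * X k \<omega>)\<^sup>2) \<partial>M) \<le> ennreal (W\<^sup>2 * c)"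
  proof -
    have "(\<integral>\<^sup>+\<omega>. ennreal ((\<Sum>k. w k * X k \<omega>)\<^sup>2) \<partial>M)
        \<le> (\<integral>\<^sup>+\<omega>. ennreal W * (\<Sum>k. ennreal (\<bar>w k\<bar> * (X k \<omega>)\<^sup>2)) \<partial>M)"
    proof (rule nn_integral_mono_AE)
      show "AE \<omega> in M. ennreal ((\<Sum>k. w k * X k \<omega>)\<^sup>2) \<le> ennreal W * (\<Sum>k. ennreal (\<bar>w k\<bar> * (X k \<omega>)\<^sup>2))"
        using ae2
      proof eventually_elim
        case (elim \<omega>)
        have "ennreal ((\<Sum>k. w k * X k \<omega>)\<^sup>2) \<le> ennreal (W * (\<Sum>k. \<bar>w k\<bar> * (X k \<omega>)\<^sup>2))"
          by (rule ennreal_leI) (rule cs[OF elim])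
        also have "\<dots> = ennreal W * ennreal (\<Sum>k. \<bar>w k\<bar> * (X k \<omega>)\<^sup>2)"
          using W0 by (intro ennreal_mult suminf_nonneg elim) auto
        also have "ennreal (\<Sum>k. \<bar>w k\<bar> * (X k \<omega>)\<^sup>2) = (\<Sum>k. ennreal (\<bar>w k\<bar> * (X k \<omega>)\<^sup>2))"
          by (rule suminf_ennreal2[symmetric]) (use elim in auto)
        finally show ?case .
      qed
    qed
    also have "\<dots> = ennreal W * (\<integral>\<^sup>+\<omega>. (\<Sum>k. ennreal (\<bar>w k\<bar> * (X k \<omega>)\<^sup>2)) \<partial>M)"
      by (rule nn_integral_cmult) measurable
    also have "\<dots> \<le> ennreal W * ennreal (W * c)" by (intro mult_left_mono total) auto
    also have "\<dots> = ennreal (W\<^sup>2 * c)"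
      using W0 c0 by (simp add: ennreal_mult[symmetric] power2_eq_square mult.assoc)
    finally show ?thesis .
  qed
  show I: "integrable M (\<lambda>\<omega>. (\<Sum>k. w k * X k \<omega>)\<^sup>2)"
    by (rule integrableI_bounded) (use bound in \<open>auto intro: le_less_trans\<close>)
  have "ennreal (expectation (\<lambda>\<omega>. (\<Sum>k. w k * X k \<omega>)\<^sup>2)) \<le> ennreal (W\<^sup>2 * c)"
    using bound by (subst nn_integral_eq_integral[OF I, symmetric]) auto
  then show "expectation (\<lambda>\<omega>. (\<Sum>k. w k * X k \<omega>)\<^sup>2) \<le> (\<Sum>k. \<bar>w k\<bar>)\<^sup>2 * c"
    using W0 c0 unfolding W_def[symmetric] by (subst (asm) ennreal_le_iff) auto
qed

text \<open>
  Truncation at one measures convergence in probability, and makes the statement hold for laws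
  without moments.
\<close>
lemma integral_min_one_scaled_tendsto_0:
  fixes L :: "real measure"
  assumes L: "real_distribution L" and c: "c \<longlonglongrightarrow> 0"
  shows "(\<lambda>n. \<integral>u. min 1 \<bar>c n * u\<bar> \<partial>L) \<longlonglongrightarrow> 0"
proof -
  interpret L: real_distribution L by fact
  have "(\<lambda>n. \<integral>u. min 1 \<bar>c n * u\<bar> \<partial>L) \<longlonglongrightarrow> (\<integral>u. 0 \<partial>L)"
  proof (rule integral_dominated_convergence[where w = "\<lambda>_. 1"])
    show "AE u in L. (\<lambda>n. min 1 \<bar>c n * u\<bar>) \<longlonglongrightarrow> 0"
    proof (rule AE_I2)
      fix u
      have "(\<lambda>n. min 1 \<bar>c n * u\<bar>) \<longlonglongrightarrow> min 1 \<bar>0 * u\<bar>" by (intro tendsto_intros c)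
      then show "(\<lambda>n. min 1 \<bar>c n * u\<bar>) \<longlonglongrightarrow> 0" by simp
    qed
  qed auto
  then show ?thesis by simp
qed

section \<open>Independence and moments of the noise\<close>

context contaminated_ar
begin

lemma noise_measurable[measurable]:
  "random_variable borel (\<epsilon> t)" "random_variable borel (z t)" "random_variable borel (\<xi> t)"
  using eps_indep z_indep xi_indep by (auto simp: indep_vars_def)

lemma measurable_path[measurable (raw)]:
  assumes "\<And>t. f t \<in> borel_measurable N"
  shows "(\<lambda>\<omega> t. f t \<omega> :: real) \<in> N \<rightarrow>\<^sub>M (\<Pi>\<^sub>M (t::int)\<in>UNIV. borel)"
  by (rule measurable_PiM_single') (use assms in auto)

text \<open>
  Innovations from time \<open>t\<close> on are set to zero, so that the past is again a path indexed by all times.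
\<close>
definition past :: "int \<Rightarrow> 'a \<Rightarrow> int \<Rightarrow> real" where
  "past t \<omega> s = (if s < t then \<epsilon> s \<omega> else 0)"

abbreviation path_space :: "(int \<Rightarrow> real) measure" where
  "path_space \<equiv> \<Pi>\<^sub>M t\<in>UNIV. borel"

lemma innovation_independent_of_past:
  "independent borel (\<epsilon> t) (path_space \<Otimes>\<^sub>M (path_space \<Otimes>\<^sub>M path_space))
     (\<lambda>\<omega>. (past t \<omega>, (\<lambda>s. z s \<omega>), (\<lambda>s. \<xi> s \<omega>)))"
proof (rule independent_assoc)
  have "indep_var (Pi\<^sub>M {t} (\<lambda>_. borel)) (\<lambda>\<omega>. restrict (\<lambda>i. \<epsilon> i \<omega>) {t})
      (Pi\<^sub>M {..<t} (\<lambda>_. borel)) (\<lambda>\<omega>. restrict (\<lambda>i. \<epsilon> i \<omega>) {..<t})"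
    by (rule indep_var_restrict[OF eps_indep]) auto
  then have ind: "independent (Pi\<^sub>M {t} (\<lambda>_. borel)) (\<lambda>\<omega>. restrict (\<lambda>i. \<epsilon> i \<omega>) {t})
      (Pi\<^sub>M {..<t} (\<lambda>_. borel)) (\<lambda>\<omega>. restrict (\<lambda>i. \<epsilon> i \<omega>) {..<t})"
    by (simp add: independent_iff_indep_var)
  have m: "(\<lambda>h s. if s < t then h s else 0) \<in> (Pi\<^sub>M {..<t} (\<lambda>_. borel)) \<rightarrow>\<^sub>M path_space"
  proof (rule measurable_path)
    show "(\<lambda>h. if s < t then h s else 0) \<in> borel_measurable (Pi\<^sub>M {..<t} (\<lambda>_. borel :: real measure))" for s
      by (cases "s < t") auto
  qed
  have "independent borel (\<lambda>\<omega>. (restrict (\<lambda>i. \<epsilon> i \<omega>) {t}) t) path_space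
      (\<lambda>\<omega>. (\<lambda>h s. if s < t then h s else 0) (restrict (\<lambda>i. \<epsilon> i \<omega>) {..<t}))"
    by (rule independent_compose[OF ind _ m]) simp
  then show "independent borel (\<epsilon> t) path_space (past t)"
    by (simp add: past_def[abs_def] cong: if_cong)
next
  let ?X = "\<lambda>\<omega> (i::nat) t. ([\<epsilon>, z, \<xi>] ! i) t \<omega>"
  have "indep_var (Pi\<^sub>M {0} (\<lambda>_. path_space)) (\<lambda>\<omega>. restrict (?X \<omega>) {0::nat})
      (Pi\<^sub>M {1,2} (\<lambda>_. path_space)) (\<lambda>\<omega>. restrict (?X \<omega>) {1,2})"
    by (rule indep_var_restrict[OF sequences_indep]) auto
  then have ind: "independent (Pi\<^sub>M {0} (\<lambda>_. path_space)) (\<lambda>\<omega>. restrict (?X \<omega>) {0::nat})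
      (Pi\<^sub>M {1,2} (\<lambda>_. path_space)) (\<lambda>\<omega>. restrict (?X \<omega>) {1,2})"
    by (simp add: independent_iff_indep_var)
  have comp: "(\<lambda>h. h i s) \<in> borel_measurable (Pi\<^sub>M I (\<lambda>_. path_space))" if "i \<in> I" for i :: nat and I s
    by (rule measurable_compose[OF measurable_component_singleton[OF that]]) simp
  have m0: "(\<lambda>h. (h 0 t, \<lambda>s. if s < t then h 0 s else 0)) \<in> Pi\<^sub>M {0::nat} (\<lambda>_. path_space) \<rightarrow>\<^sub>M borel \<Otimes>\<^sub>M path_space"
  proof (rule measurable_Pair)
    show "(\<lambda>h. h 0 t) \<in> borel_measurable (Pi\<^sub>M {0::nat} (\<lambda>_. path_space))" by (rule comp) simp
    show "(\<lambda>h s. if s < t then h 0 s else 0) \<in> Pi\<^sub>M {0::nat} (\<lambda>_. path_space) \<rightarrow>\<^sub>M path_space"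
    proof (rule measurable_path)
      show "(\<lambda>h. if s < t then h 0 s else 0) \<in> borel_measurable (Pi\<^sub>M {0::nat} (\<lambda>_. path_space))" for s
        by (cases "s < t") (auto intro: comp)
    qed
  qed
  have m1: "(\<lambda>h. (h 1, h 2)) \<in> Pi\<^sub>M {1,2::nat} (\<lambda>_. path_space) \<rightarrow>\<^sub>M path_space \<Otimes>\<^sub>M path_space"
    by (intro measurable_Pair measurable_component_singleton) auto
  show "independent (borel \<Otimes>\<^sub>M path_space) (\<lambda>\<omega>. (\<epsilon> t \<omega>, past t \<omega>)) (path_space \<Otimes>\<^sub>M path_space)
      (\<lambda>\<omega>. ((\<lambda>s. z s \<omega>), (\<lambda>s. \<xi> s \<omega>)))"
    using independent_compose[OF ind m0 m1] by (simp add: past_def[abs_def] cong: if_cong)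
qed

lemma contamination_independent:
  "independent path_space (\<lambda>\<omega> s. z s \<omega>) (path_space \<Otimes>\<^sub>M path_space) (\<lambda>\<omega>. ((\<lambda>s. \<epsilon> s \<omega>), (\<lambda>s. \<xi> s \<omega>)))"
proof -
  let ?X = "\<lambda>\<omega> (i::nat) t. ([\<epsilon>, z, \<xi>] ! i) t \<omega>"
  have "indep_var (Pi\<^sub>M {1} (\<lambda>_. path_space)) (\<lambda>\<omega>. restrict (?X \<omega>) {1::nat})
      (Pi\<^sub>M {0,2} (\<lambda>_. path_space)) (\<lambda>\<omega>. restrict (?X \<omega>) {0,2})"
    by (rule indep_var_restrict[OF sequences_indep]) auto
  then have ind: "independent (Pi\<^sub>M {1} (\<lambda>_. path_space)) (\<lambda>\<omega>. restrict (?X \<omega>) {1::nat})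
      (Pi\<^sub>M {0,2} (\<lambda>_. path_space)) (\<lambda>\<omega>. restrict (?X \<omega>) {0,2})"
    by (simp add: independent_iff_indep_var)
  have m0: "(\<lambda>h. h 1) \<in> Pi\<^sub>M {1::nat} (\<lambda>_. path_space) \<rightarrow>\<^sub>M path_space"
    by (intro measurable_component_singleton) auto
  have m1: "(\<lambda>h. (h 0, h 2)) \<in> Pi\<^sub>M {0,2::nat} (\<lambda>_. path_space) \<rightarrow>\<^sub>M path_space \<Otimes>\<^sub>M path_space"
    by (intro measurable_Pair measurable_component_singleton) auto
  show ?thesis
    using independent_compose[OF ind m0 m1] by simp
qed

lemma expectation_contamination_times:
  assumes f: "f \<in> borel_measurable path_space" and h: "h \<in> borel_measurable (path_space \<Otimes>\<^sub>M path_space)"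
    and int: "integrable M (\<lambda>\<omega>. f (\<lambda>s. z s \<omega>))" "integrable M (\<lambda>\<omega>. h ((\<lambda>s. \<epsilon> s \<omega>), (\<lambda>s. \<xi> s \<omega>)))"
  shows "integrable M (\<lambda>\<omega>. f (\<lambda>s. z s \<omega>) * h ((\<lambda>s. \<epsilon> s \<omega>), (\<lambda>s. \<xi> s \<omega>)) :: real)"
    and "expectation (\<lambda>\<omega>. f (\<lambda>s. z s \<omega>) * h ((\<lambda>s. \<epsilon> s \<omega>), (\<lambda>s. \<xi> s \<omega>)))
      = expectation (\<lambda>\<omega>. f (\<lambda>s. z s \<omega>)) * expectation (\<lambda>\<omega>. h ((\<lambda>s. \<epsilon> s \<omega>), (\<lambda>s. \<xi> s \<omega>)))"
proof -
  have "indep_var borel (\<lambda>\<omega>. f (\<lambda>s. z s \<omega>)) borel (\<lambda>\<omega>. h ((\<lambda>s. \<epsilon> s \<omega>), (\<lambda>s. \<xi> s \<omega>)))"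
    using independent_compose[OF contamination_independent f h] by (simp add: independent_iff_indep_var)
  then show "integrable M (\<lambda>\<omega>. f (\<lambda>s. z s \<omega>) * h ((\<lambda>s. \<epsilon> s \<omega>), (\<lambda>s. \<xi> s \<omega>)))"
    and "expectation (\<lambda>\<omega>. f (\<lambda>s. z s \<omega>) * h ((\<lambda>s. \<epsilon> s \<omega>), (\<lambda>s. \<xi> s \<omega>)))
      = expectation (\<lambda>\<omega>. f (\<lambda>s. z s \<omega>)) * expectation (\<lambda>\<omega>. h ((\<lambda>s. \<epsilon> s \<omega>), (\<lambda>s. \<xi> s \<omega>)))"
    using int by (rule indep_var_integrable indep_var_lebesgue_integral)+
qed

lemma innovation_law: "distr M borel (\<epsilon> t) = distr M borel (\<epsilon> 1)"
  by (rule cdf_unique) (simp_all add: eps_cdf)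

lemma innovation_moments:
  "integrable M (\<epsilon> t)" "expectation (\<epsilon> t) = 0"
  "integrable M (\<lambda>\<omega>. (\<epsilon> t \<omega>)\<^sup>2)" "expectation (\<lambda>\<omega>. (\<epsilon> t \<omega>)\<^sup>2) = expectation (\<lambda>\<omega>. (\<epsilon> 1 \<omega>)\<^sup>2)"
proof -
  have i: "integrable M (\<lambda>\<omega>. f (\<epsilon> t \<omega>)) \<longleftrightarrow> integrable M (\<lambda>\<omega>. f (\<epsilon> 1 \<omega>))"
    and e: "expectation (\<lambda>\<omega>. f (\<epsilon> t \<omega>)) = expectation (\<lambda>\<omega>. f (\<epsilon> 1 \<omega>))"
    if [measurable]: "f \<in> borel_measurable borel" for f :: "real \<Rightarrow> real"
    using innovation_law[of t] integrable_distr_eq[of "\<epsilon> t" M borel f] integrable_distr_eq[of "\<epsilon> 1" M borel f]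
      integral_distr[of "\<epsilon> t" M borel f] integral_distr[of "\<epsilon> 1" M borel f] by simp_all
  show "integrable M (\<epsilon> t)" "expectation (\<epsilon> t) = 0"
    using i[of "\<lambda>x. x"] e[of "\<lambda>x. x"] eps_integrable eps_mean by simp_all
  show "integrable M (\<lambda>\<omega>. (\<epsilon> t \<omega>)\<^sup>2)" "expectation (\<lambda>\<omega>. (\<epsilon> t \<omega>)\<^sup>2) = expectation (\<lambda>\<omega>. (\<epsilon> 1 \<omega>)\<^sup>2)"
    using i[of "\<lambda>x. x\<^sup>2"] e[of "\<lambda>x. x\<^sup>2"] eps_sq_integrable by simp_all
qed

lemma indep_var_of_family:
  assumes "indep_vars (\<lambda>_. borel) X UNIV" "s \<noteq> t"
  shows "indep_var borel (X s) borel (X t :: 'a \<Rightarrow> real)"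
proof -
  have "indep_var (Pi\<^sub>M {s} (\<lambda>_. borel)) (\<lambda>\<omega>. restrict (\<lambda>i. X i \<omega>) {s})
      (Pi\<^sub>M {t} (\<lambda>_. borel)) (\<lambda>\<omega>. restrict (\<lambda>i. X i \<omega>) {t})"
    by (rule indep_var_restrict[OF assms(1)]) (use assms in auto)
  then have "independent borel (\<lambda>\<omega>. (\<lambda>h. h s) (restrict (\<lambda>i. X i \<omega>) {s})) borel (\<lambda>\<omega>. (\<lambda>h. h t) (restrict (\<lambda>i. X i \<omega>) {t}))"
    unfolding independent_iff_indep_var[symmetric] by (rule independent_compose) auto
  then show ?thesis by (simp add: independent_iff_indep_var)
qed

lemma innovations_uncorrelated:
  assumes "s \<noteq> t"
  shows "integrable M (\<lambda>\<omega>. \<epsilon> s \<omega> * \<epsilon> t \<omega>)" "expectation (\<lambda>\<omega>. \<epsilon> s \<omega> * \<epsilon> t \<omega>) = 0"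
  using indep_var_integrable[OF indep_var_of_family[OF eps_indep assms]]
    indep_var_lebesgue_integral[OF indep_var_of_family[OF eps_indep assms]] innovation_moments by auto

lemma contamination_moments:
  shows contamination_integrable: "integrable M (z t)"
    and contamination_mean: "expectation (z t) = g"
    and contamination_product_integrable: "integrable M (\<lambda>\<omega>. z s \<omega> * z t \<omega>)"
    and contamination_product_mean: "s \<noteq> t \<Longrightarrow> expectation (\<lambda>\<omega>. z s \<omega> * z t \<omega>) = g\<^sup>2"
proof -
  have b: "AE \<omega> in M. \<bar>z t \<omega>\<bar> \<le> 1" for t
    using z_values[of t] by eventually_elim auto
  show i: "integrable M (z t)" for t
    by (rule integrable_const_bound[of _ 1]) (use b[of t] in auto)
  show e: "expectation (z t) = g" for t
  proof -
    have "expectation (z t) = expectation (indicator {\<omega> \<in> space M. z t \<omega> = 1})"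
      by (rule integral_cong_AE) (use z_values[of t] AE_space in \<open>auto elim!: eventually_mono simp: indicator_def\<close>)
    then show ?thesis using z_prob[of t] by simp
  qed
  show "integrable M (\<lambda>\<omega>. z s \<omega> * z t \<omega>)"
  proof (rule integrable_const_bound[of _ 1])
    show "AE \<omega> in M. norm (z s \<omega> * z t \<omega>) \<le> 1"
      using b[of s] b[of t] by eventually_elim (auto simp: abs_mult intro: mult_le_one)
  qed simp
  show "expectation (\<lambda>\<omega>. z s \<omega> * z t \<omega>) = g\<^sup>2" if "s \<noteq> t"
    using indep_var_lebesgue_integral[OF indep_var_of_family[OF z_indep that] i i] e
    by (simp add: power2_eq_square)
qed

lemma contamination_prob_range: "0 \<le> g" "g \<le> 1"
  using z_prob[of 0] by auto

end

section \<open>The stationary solution as a causal linear process\<close>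

lemma min_one_sum_le:
  fixes a :: "'i \<Rightarrow> real"
  assumes "finite S"
  shows "min 1 \<bar>\<Sum>i\<in>S. a i\<bar> \<le> (\<Sum>i\<in>S. min 1 \<bar>a i\<bar>)"
  using assms
proof induction
  case (insert i S)
  have "min 1 \<bar>a i + (\<Sum>i\<in>S. a i)\<bar> \<le> min 1 \<bar>a i\<bar> + min 1 \<bar>\<Sum>i\<in>S. a i\<bar>" by linarith
  with insert show ?case by simp
qed simp

text \<open>
  Applying the truncated inverse of the operator to \<open>e\<close> gives a double sum over \<open>k\<close> (weight) and \<open>j\<close> (lag).
  On the triangle \<open>k + j < K\<close> the weights and the operator cancel up to \<open>u t\<close>. Outside the triangle, lags of at most \<open>p\<close> force
  \<open>k\<close> to be one of the last \<open>p\<close> indices, which leaves a number of terms that does not grow with \<open>N\<close>.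
\<close>
lemma truncated_inversion_error:
  fixes u e :: "int \<Rightarrow> real"
  assumes ar: "\<And>s. (\<Sum>j\<le>p. fps_nth (ar_operator p \<beta>) j * u (s - int j)) = e s"
  shows "min 1 \<bar>(\<Sum>k<N + Suc p. ma_weight p \<beta> k * e (t - int k)) - u t\<bar>
    \<le> (\<Sum>i<p. \<Sum>j\<le>p. min 1 \<bar>ma_weight p \<beta> (i + Suc N) * fps_nth (ar_operator p \<beta>) j * u (t - int (i + Suc N) - int j)\<bar>)"
proof -
  define K where "K = N + Suc p"
  let ?b = "fps_nth (ar_operator p \<beta>)" and ?\<psi> = "ma_weight p \<beta>"
  define a where "a k j = ?\<psi> k * ?b j * u (t - int k - int j)" for k j
  have b0: "?b j = 0" if "j > p" for j using that by (simp add: ar_operator_def)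
  have "(\<Sum>k<K. ?\<psi> k * e (t - int k)) = (\<Sum>k<K. \<Sum>j<K. a k j)"
  proof (intro sum.cong refl)
    fix k
    have "?\<psi> k * e (t - int k) = (\<Sum>j\<le>p. a k j)"
      unfolding ar[symmetric] sum_distrib_left by (simp add: a_def mult.assoc)
    also have "\<dots> = (\<Sum>j<K. a k j)"
      by (rule sum.mono_neutral_left) (auto simp: K_def a_def b0)
    finally show "?\<psi> k * e (t - int k) = (\<Sum>j<K. a k j)" .
  qed
  also have "\<dots> = (\<Sum>(k, j)\<in>{..<K} \<times> {..<K}. a k j)"
    by (simp add: sum.cartesian_product)
  also have "\<dots> = (\<Sum>(k, j)\<in>{(k, j). k + j < K}. a k j) + (\<Sum>(k, j)\<in>{..<K} \<times> {..<K} - {(k, j). k + j < K}. a k j)"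
    by (subst sum.subset_diff[of "{(k, j). k + j < K}"]) auto
  also have "(\<Sum>(k, j)\<in>{(k, j). k + j < K}. a k j) = (\<Sum>m<K. \<Sum>k\<le>m. a k (m - k))"
    by (rule sum.triangle_reindex)
  also have "\<dots> = (\<Sum>m<K. if m = 0 then u t else 0)"
  proof (intro sum.cong refl)
    fix m
    have "(\<Sum>k\<le>m. a k (m - k)) = (\<Sum>k\<le>m. ?\<psi> k * ?b (m - k) * u (t - int m))"
      by (intro sum.cong refl) (auto simp: a_def of_nat_diff)
    also have "\<dots> = fps_nth (Abs_fps ?\<psi> * ar_operator p \<beta>) m * u (t - int m)"
      by (simp add: fps_mult_nth sum_distrib_right atMost_atLeast0)
    also have "Abs_fps ?\<psi> * ar_operator p \<beta> = 1"
      using ar_operator_times_ma[of p \<beta>] by (simp add: mult.commute)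
    finally show "(\<Sum>k\<le>m. a k (m - k)) = (if m = 0 then u t else 0)" by simp
  qed
  also have "\<dots> = u t" by (simp add: K_def)
  finally have R: "(\<Sum>k<K. ?\<psi> k * e (t - int k)) - u t
      = (\<Sum>(k, j)\<in>{..<K} \<times> {..<K} - {(k, j). k + j < K}. a k j)" by simp
  also have "\<dots> = (\<Sum>(k, j)\<in>{Suc N..<K} \<times> {..p} - {(k, j). k + j < K}. a k j)"
  proof (rule sum.mono_neutral_right)
    have bp: "j \<le> p" if "?b j \<noteq> 0" for j using b0[of j] that by (cases "j \<le> p") auto
    show "\<forall>q\<in>{..<K} \<times> {..<K} - {(k, j). k + j < K} - ({Suc N..<K} \<times> {..p} - {(k, j). k + j < K}).
        (case q of (k, j) \<Rightarrow> a k j) = 0"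
      by (auto simp: K_def a_def dest!: bp)
  qed (auto simp: K_def)
  finally have "min 1 \<bar>(\<Sum>k<K. ?\<psi> k * e (t - int k)) - u t\<bar>
      \<le> (\<Sum>q\<in>{Suc N..<K} \<times> {..p} - {(k, j). k + j < K}. min 1 \<bar>a (fst q) (snd q)\<bar>)"
    using min_one_sum_le[of "{Suc N..<K} \<times> {..p} - {(k, j). k + j < K}" "\<lambda>q. a (fst q) (snd q)"]
    by (simp add: split_beta)
  also have "\<dots> \<le> (\<Sum>q\<in>{Suc N..<K} \<times> {..p}. min 1 \<bar>a (fst q) (snd q)\<bar>)"
    by (rule sum_mono2) auto
  also have "\<dots> = (\<Sum>k\<in>{0 + Suc N..<p + Suc N}. \<Sum>j\<le>p. min 1 \<bar>a k j\<bar>)"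
    by (simp add: sum.cartesian_product split_beta K_def add.commute)
  also have "\<dots> = (\<Sum>i<p. \<Sum>j\<le>p. min 1 \<bar>a (i + Suc N) j\<bar>)"
    by (subst sum.shift_bounds_nat_ivl) (simp add: lessThan_atLeast0)
  finally show ?thesis by (simp only: K_def a_def)
qed

context contaminated_ar
begin

abbreviation "\<psi> \<equiv> ma_weight p \<beta>"

definition linear_process :: "int \<Rightarrow> 'a \<Rightarrow> real" where
  "linear_process t \<omega> = (\<Sum>k. \<psi> k * \<epsilon> (t - int k) \<omega>)"

text \<open>
  An upper bound for the variance of the linear process.
\<close>
definition lp_var :: real where
  "lp_var = (\<Sum>k. \<bar>\<psi> k\<bar>)\<^sup>2 * expectation (\<lambda>\<omega>. (\<epsilon> 1 \<omega>)\<^sup>2)"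

lemma measurable_linear_process[measurable]: "random_variable borel (linear_process t)"
  unfolding linear_process_def[abs_def] by measurable

lemma lp_var_nonneg: "0 \<le> lp_var"
  unfolding lp_var_def using eps_sq_pos by (intro mult_nonneg_nonneg) auto

lemma AE_linear_process_summable: "AE \<omega> in M. \<forall>t. summable (\<lambda>k. \<bar>\<psi> k * \<epsilon> (t - int k) \<omega>\<bar>)"
  unfolding AE_all_countable
proof
  fix t
  show "AE \<omega> in M. summable (\<lambda>k. \<bar>\<psi> k * \<epsilon> (t - int k) \<omega>\<bar>)"
    by (rule weighted_series_second_moment(1)[OF summable_abs_ma_weight[OF roots] noise_measurable(1)
        innovation_moments(3) eq_refl[OF innovation_moments(4)]])
qed

lemma linear_process_second_moment:
  "integrable M (\<lambda>\<omega>. (linear_process t \<omega>)\<^sup>2)" "expectation (\<lambda>\<omega>. (linear_process t \<omega>)\<^sup>2) \<le> lp_var"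
  unfolding linear_process_def lp_var_def
  by (rule weighted_series_second_moment(2,3)[OF summable_abs_ma_weight[OF roots] noise_measurable(1)
        innovation_moments(3) eq_refl[OF innovation_moments(4)]])+

text \<open>
  The average of the process is the series with the same weights of the averaged innovations,
  whose second moments are of order \<open>1 / n\<close>.
\<close>
lemma linear_process_mean_small:
  assumes n: "n \<ge> 1"
  shows "integrable M (\<lambda>\<omega>. (\<Sum>t=1..int n. linear_process (t - h) \<omega>) / real n)"
    and "expectation (\<lambda>\<omega>. \<bar>(\<Sum>t=1..int n. linear_process (t - h) \<omega>) / real n\<bar>) \<le> sqrt (lp_var / real n)"
proof -
  let ?s = "expectation (\<lambda>\<omega>. (\<epsilon> 1 \<omega>)\<^sup>2)"
  define A where "A k \<omega> = (\<Sum>t=1..int n. \<epsilon> (t - h - int k) \<omega>) / real n" for k \<omega>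
  have [measurable]: "random_variable borel (A k)" for k unfolding A_def[abs_def] by measurable
  have A2: "integrable M (\<lambda>\<omega>. (A k \<omega>)\<^sup>2)" "expectation (\<lambda>\<omega>. (A k \<omega>)\<^sup>2) = ?s / real n" for k
  proof -
    let ?X = "\<lambda>t. \<epsilon> (t - h - int k)"
    have int: "integrable M (\<lambda>\<omega>. ?X s \<omega> * ?X t \<omega>)" for s t
    proof (cases "s = t")
      case True
      then show ?thesis
        using innovation_moments(3)[of "t - h - int k"] unfolding power2_eq_square by blast
    next
      case False
      then have "s - h - int k \<noteq> t - h - int k" by simp
      then show ?thesis by (rule innovations_uncorrelated)
    qed
    have orth: "expectation (\<lambda>\<omega>. ?X s \<omega> * ?X t \<omega>) = 0" if "s \<noteq> t" for s t
      by (rule innovations_uncorrelated) (use that in simp)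
    have "integrable M (\<lambda>\<omega>. (\<Sum>t=1..int n. ?X t \<omega>)\<^sup>2)"
      by (rule expectation_square_orthogonal_sum(1)) (auto intro: int orth)
    then show "integrable M (\<lambda>\<omega>. (A k \<omega>)\<^sup>2)"
      unfolding A_def power_divide by (rule integrable_divide_zero[rotated])
    have "expectation (\<lambda>\<omega>. (\<Sum>t=1..int n. ?X t \<omega>)\<^sup>2) = (\<Sum>t=1..int n. expectation (\<lambda>\<omega>. (?X t \<omega>)\<^sup>2))"
      by (rule expectation_square_orthogonal_sum(2)) (auto intro: int orth)
    also have "\<dots> = (\<Sum>t=1..int n. ?s)"
      by (intro sum.cong refl innovation_moments)
    finally have "expectation (\<lambda>\<omega>. (\<Sum>t=1..int n. ?X t \<omega>)\<^sup>2) = real n * ?s" by simp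
    then show "expectation (\<lambda>\<omega>. (A k \<omega>)\<^sup>2) = ?s / real n"
      unfolding A_def power_divide using n by (simp add: power2_eq_square)
  qed
  have S: "integrable M (\<lambda>\<omega>. (\<Sum>k. \<psi> k * A k \<omega>)\<^sup>2)"
    "expectation (\<lambda>\<omega>. (\<Sum>k. \<psi> k * A k \<omega>)\<^sup>2) \<le> lp_var / real n"
    using weighted_series_second_moment(2,3)[OF summable_abs_ma_weight[OF roots], of A "?s / real n"] A2
    by (simp_all add: lp_var_def)
  have eq: "AE \<omega> in M. (\<Sum>k. \<psi> k * A k \<omega>) = (\<Sum>t=1..int n. linear_process (t - h) \<omega>) / real n"
    using AE_linear_process_summable
  proof eventually_elim
    case (elim \<omega>)
    then have s: "summable (\<lambda>k. \<psi> k * \<epsilon> (t - int k) \<omega>)" for t by (auto intro: summable_rabs_cancel)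
    have "(\<Sum>t=1..int n. linear_process (t - h) \<omega>) / real n
        = (\<Sum>k. \<Sum>t=1..int n. \<psi> k * \<epsilon> (t - h - int k) \<omega>) / real n"
      unfolding linear_process_def by (subst suminf_sum) (use s in auto)
    also have "\<dots> = (\<Sum>k. (\<Sum>t=1..int n. \<psi> k * \<epsilon> (t - h - int k) \<omega>) / real n)"
      by (rule suminf_divide[symmetric]) (intro summable_sum s)
    also have "\<dots> = (\<Sum>k. \<psi> k * A k \<omega>)"
      by (simp add: A_def sum_distrib_left)
    finally show ?case ..
  qed
  note E = expectation_abs_le_sqrt[OF _ S]
  have m: "random_variable borel (\<lambda>\<omega>. \<Sum>k. \<psi> k * A k \<omega>)" by measurable
  show "integrable M (\<lambda>\<omega>. (\<Sum>t=1..int n. linear_process (t - h) \<omega>) / real n)"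
    by (rule Bochner_Integration.integrable_cong_AE_imp[OF E(1)[OF m]]) (use eq in \<open>auto elim: eventually_mono\<close>)
  have "expectation (\<lambda>\<omega>. \<bar>(\<Sum>t=1..int n. linear_process (t - h) \<omega>) / real n\<bar>) = expectation (\<lambda>\<omega>. \<bar>\<Sum>k. \<psi> k * A k \<omega>\<bar>)"
    by (rule integral_cong_AE) (use eq in \<open>auto elim: eventually_mono\<close>)
  then show "expectation (\<lambda>\<omega>. \<bar>(\<Sum>t=1..int n. linear_process (t - h) \<omega>) / real n\<bar>) \<le> sqrt (lp_var / real n)"
    using E(2)[OF m] by simp
qed

lemma stationary_law: "distr M borel (v t) = distr M borel (v 0)"
proof -
  have "distr M path_space (\<lambda>\<omega> s. v (s + t) \<omega>) = distr M path_space (\<lambda>\<omega> s. v s \<omega>)"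
    using v_stationary by (simp add: strictly_stationary_def)
  then have "distr (distr M path_space (\<lambda>\<omega> s. v (s + t) \<omega>)) borel (\<lambda>h. h 0)
      = distr (distr M path_space (\<lambda>\<omega> s. v s \<omega>)) borel (\<lambda>h. h 0)" by simp
  then show ?thesis
    using v_measurable by (subst (asm) (1 2) distr_distr) (auto simp: comp_def)
qed

text \<open>
  The truncated inversion error tends to zero in probability because all \<open>v t\<close> have one law
  and the weights tend to zero. The truncated series also converges to the causal series almost
  surely, and the two limits agree.
\<close>
lemma stationary_solution_is_linear_process:
  assumes mu: "\<nu> = (1 - (\<Sum>j=1..p. \<beta> j)) * \<mu>"
  shows "AE \<omega> in M. v t \<omega> - \<mu> = linear_process t \<omega>"
proof -
  note [measurable] = v_measurable
  let ?b = "fps_nth (ar_operator p \<beta>)"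
  define u where "u s \<omega> = v s \<omega> - \<mu>" for s \<omega>
  have [measurable]: "random_variable borel (u s)" for s unfolding u_def[abs_def] by measurable
  define L where "L = distr M borel (u 0)"
  have L: "real_distribution L" unfolding L_def by (rule real_distribution_distr) simp
  have law: "distr M borel (u s) = L" for s
  proof -
    have "distr M borel (u s) = distr (distr M borel (v s)) borel (\<lambda>x. x - \<mu>)"
      by (simp add: distr_distr comp_def u_def[abs_def])
    also have "\<dots> = L" unfolding stationary_law[of s] L_def by (simp add: distr_distr comp_def u_def[abs_def])
    finally show ?thesis .
  qed
  have ar: "AE \<omega> in M. \<forall>s. (\<Sum>j\<le>p. ?b j * u (s - int j) \<omega>) = \<epsilon> s \<omega>"
    unfolding AE_all_countable
  proof
    fix s
    show "AE \<omega> in M. (\<Sum>j\<le>p. ?b j * u (s - int j) \<omega>) = \<epsilon> s \<omega>"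
      using v_ar[of s]
    proof eventually_elim
      case (elim \<omega>)
      have "(\<Sum>j\<le>p. ?b j * u (s - int j) \<omega>) = u s \<omega> + (\<Sum>j=1..p. ?b j * u (s - int j) \<omega>)"
        by (simp add: atMost_atLeast0 sum.atLeast_Suc_atMost ar_operator_def)
      also have "(\<Sum>j=1..p. ?b j * u (s - int j) \<omega>) = (\<Sum>j=1..p. \<beta> j * \<mu> - \<beta> j * v (s - int j) \<omega>)"
        by (intro sum.cong) (auto simp: ar_operator_def u_def algebra_simps)
      also have "\<dots> = (\<Sum>j=1..p. \<beta> j) * \<mu> - (\<Sum>j=1..p. \<beta> j * v (s - int j) \<omega>)"
        by (simp add: sum_subtractf sum_distrib_right)
      finally show ?case using elim mu by (simp add: u_def algebra_simps)
    qed
  qed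
  define part where "part N \<omega> = (\<Sum>k<N + Suc p. \<psi> k * \<epsilon> (t - int k) \<omega>)" for N \<omega>
  have [measurable]: "random_variable borel (part N)" for N unfolding part_def[abs_def] by measurable
  let ?d = "\<lambda>N. expectation (\<lambda>\<omega>. min 1 \<bar>part N \<omega> - u t \<omega>\<bar>)" and ?d' = "\<lambda>N. expectation (\<lambda>\<omega>. min 1 \<bar>part N \<omega> - linear_process t \<omega>\<bar>)"
    and ?D = "expectation (\<lambda>\<omega>. min 1 \<bar>u t \<omega> - linear_process t \<omega>\<bar>)"
  have bounded_int: "integrable M (\<lambda>\<omega>. min 1 \<bar>X \<omega>\<bar>)" if [measurable]: "random_variable borel X" for X :: "'a \<Rightarrow> real"
    by (rule integrable_const_bound[of _ 1]) auto
  have rem: "(\<lambda>N. ?d N) \<longlonglongrightarrow> 0"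
  proof (rule tendsto_sandwich[OF _ _ tendsto_const])
    let ?q = "\<lambda>k j. \<integral>x. min 1 \<bar>(\<psi> k * ?b j) * x\<bar> \<partial>L"
    have "?d N \<le> (\<Sum>i<p. \<Sum>j\<le>p. ?q (i + Suc N) j)" for N
    proof -
      have "?d N
          \<le> expectation (\<lambda>\<omega>. \<Sum>i<p. \<Sum>j\<le>p. min 1 \<bar>\<psi> (i + Suc N) * ?b j * u (t - int (i + Suc N) - int j) \<omega>\<bar>)"
      proof (rule integral_mono_AE)
        show "AE \<omega> in M. min 1 \<bar>part N \<omega> - u t \<omega>\<bar>
            \<le> (\<Sum>i<p. \<Sum>j\<le>p. min 1 \<bar>\<psi> (i + Suc N) * ?b j * u (t - int (i + Suc N) - int j) \<omega>\<bar>)"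
          using ar
        proof eventually_elim
          case (elim \<omega>)
          then show ?case unfolding part_def by (intro truncated_inversion_error) auto
        qed
      qed (intro bounded_int Bochner_Integration.integrable_sum; measurable)+
      also have "\<dots> = (\<Sum>i<p. \<Sum>j\<le>p. expectation (\<lambda>\<omega>. min 1 \<bar>\<psi> (i + Suc N) * ?b j * u (t - int (i + Suc N) - int j) \<omega>\<bar>))"
        by (subst Bochner_Integration.integral_sum,
            (intro bounded_int Bochner_Integration.integrable_sum; measurable),
            intro sum.cong refl Bochner_Integration.integral_sum bounded_int, measurable)
      also have "\<dots> = (\<Sum>i<p. \<Sum>j\<le>p. ?q (i + Suc N) j)"
      proof (intro sum.cong refl)
        fix i j
        show "expectation (\<lambda>\<omega>. min 1 \<bar>\<psi> (i + Suc N) * ?b j * u (t - int (i + Suc N) - int j) \<omega>\<bar>) = ?q (i + Suc N) j"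
          unfolding law[of "t - int (i + Suc N) - int j", symmetric] by (subst integral_distr) auto
      qed
      finally show ?thesis .
    qed
    then show "\<forall>\<^sub>F N in sequentially. ?d N \<le> (\<Sum>i<p. \<Sum>j\<le>p. ?q (i + Suc N) j)"
      by simp
    have \<psi>0: "\<psi> \<longlonglongrightarrow> 0"
      using summable_LIMSEQ_zero[OF summable_abs_ma_weight[OF roots]] by (simp add: tendsto_rabs_zero_iff)
    have "(\<lambda>N. ?q (i + Suc N) j) \<longlonglongrightarrow> 0" for i j
    proof (rule integral_min_one_scaled_tendsto_0[OF L])
      have "(\<lambda>N. \<psi> (N + (i + 1)) * ?b j) \<longlonglongrightarrow> 0 * ?b j"
        by (intro tendsto_mult tendsto_const LIMSEQ_ignore_initial_segment \<psi>0)
      then show "(\<lambda>N. \<psi> (i + Suc N) * ?b j) \<longlonglongrightarrow> 0" by (simp add: add.commute)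
    qed
    then show "(\<lambda>N. \<Sum>i<p. \<Sum>j\<le>p. ?q (i + Suc N) j) \<longlonglongrightarrow> 0"
      by (intro tendsto_null_sum) auto
    show "\<forall>\<^sub>F N in sequentially. 0 \<le> ?d N"
      by (intro always_eventually allI integral_nonneg_AE) auto
  qed
  have conv: "(\<lambda>N. ?d' N) \<longlonglongrightarrow> 0"
  proof -
    have "(\<lambda>N. ?d' N) \<longlonglongrightarrow> expectation (\<lambda>\<omega>. 0)"
    proof (rule integral_dominated_convergence[where w = "\<lambda>_. 1"])
      show "AE \<omega> in M. (\<lambda>N. min 1 \<bar>part N \<omega> - linear_process t \<omega>\<bar>) \<longlonglongrightarrow> 0"
        using AE_linear_process_summable
      proof eventually_elim
        case (elim \<omega>)
        then have "summable (\<lambda>k. \<psi> k * \<epsilon> (t - int k) \<omega>)" by (auto intro: summable_rabs_cancel)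
        then have "(\<lambda>K. \<Sum>k<K. \<psi> k * \<epsilon> (t - int k) \<omega>) \<longlonglongrightarrow> linear_process t \<omega>"
          unfolding linear_process_def by (rule summable_LIMSEQ)
        then have "(\<lambda>N. part N \<omega>) \<longlonglongrightarrow> linear_process t \<omega>"
          unfolding part_def by (rule LIMSEQ_ignore_initial_segment)
        then have "(\<lambda>N. min 1 \<bar>part N \<omega> - linear_process t \<omega>\<bar>) \<longlonglongrightarrow> min 1 \<bar>linear_process t \<omega> - linear_process t \<omega>\<bar>"
          by (intro tendsto_intros)
        then show ?case by simp
      qed
    qed auto
    then show ?thesis by simp
  qed
  have le: "?D
      \<le> ?d N + ?d' N" for N
  proof -
    have "?D
        \<le> expectation (\<lambda>\<omega>. min 1 \<bar>part N \<omega> - u t \<omega>\<bar> + min 1 \<bar>part N \<omega> - linear_process t \<omega>\<bar>)"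
    proof (rule integral_mono)
      show "min 1 \<bar>u t \<omega> - linear_process t \<omega>\<bar> \<le> min 1 \<bar>part N \<omega> - u t \<omega>\<bar> + min 1 \<bar>part N \<omega> - linear_process t \<omega>\<bar>" for \<omega>
        by linarith
    qed (intro bounded_int Bochner_Integration.integrable_add; measurable)+
    also have "\<dots> = ?d N + ?d' N"
      by (rule Bochner_Integration.integral_add) (intro bounded_int; measurable)+
    finally show ?thesis .
  qed
  have "?D \<le> 0"
    by (rule LIMSEQ_le_const[OF tendsto_add_zero[OF rem conv]]) (use le in auto)
  then have "?D = 0"
    by (intro antisym integral_nonneg_AE) auto
  then have "AE \<omega> in M. min 1 \<bar>u t \<omega> - linear_process t \<omega>\<bar> = 0"
    by (subst (asm) integral_nonneg_eq_0_iff_AE) (auto intro: bounded_int)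
  then show ?thesis
    by eventually_elim (auto simp: u_def min_def split: if_splits)
qed

end

section \<open>First-order expansion of one shifted threshold\<close>

lemma zero_one_pair_sum:
  fixes z :: "nat \<Rightarrow> real"
  assumes z: "\<And>j. j \<le> p \<Longrightarrow> z j \<in> {0, 1}"
  shows "(\<Sum>i\<le>p. \<Sum>j\<in>{..p} - {i}. z i * z j) = (\<Sum>j\<le>p. z j) * ((\<Sum>j\<le>p. z j) - 1)"
proof -
  have "(\<Sum>i\<le>p. \<Sum>j\<in>{..p} - {i}. z i * z j) = (\<Sum>i\<le>p. z i * (\<Sum>j\<le>p. z j) - z i)"
  proof (rule sum.cong)
    fix i assume i: "i \<in> {..p}"
    have "(\<Sum>j\<in>{..p} - {i}. z i * z j) = z i * (\<Sum>j\<le>p. z j) - z i * z i"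
      using i by (simp add: sum_diff1 sum_distrib_left)
    also have "z i * z i = z i" using z[of i] i by auto
    finally show "(\<Sum>j\<in>{..p} - {i}. z i * z j) = z i * (\<Sum>j\<le>p. z j) - z i" .
  qed simp
  then show ?thesis by (simp add: sum_subtractf sum_distrib_right algebra_simps)
qed

lemma abs_linear_form_le:
  fixes \<tau> Y :: "'i \<Rightarrow> real"
  assumes B: "\<And>j. j \<in> J \<Longrightarrow> \<bar>\<tau> j\<bar> + \<bar>\<kappa>\<bar> \<le> B"
  shows "\<bar>(\<Sum>j\<in>J. \<tau> j * Y j) + \<kappa> * (\<Sum>j\<in>J. \<bar>Y j\<bar>)\<bar> \<le> B * (\<Sum>j\<in>J. \<bar>Y j\<bar>)"
proof -
  have "\<bar>(\<Sum>j\<in>J. \<tau> j * Y j) + \<kappa> * (\<Sum>j\<in>J. \<bar>Y j\<bar>)\<bar> = \<bar>\<Sum>j\<in>J. \<tau> j * Y j + \<kappa> * \<bar>Y j\<bar>\<bar>"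
    by (simp add: sum.distrib sum_distrib_left)
  also have "\<dots> \<le> (\<Sum>j\<in>J. \<bar>\<tau> j * Y j + \<kappa> * \<bar>Y j\<bar>\<bar>)" by (rule sum_abs)
  also have "\<dots> \<le> (\<Sum>j\<in>J. B * \<bar>Y j\<bar>)"
  proof (rule sum_mono)
    fix j assume "j \<in> J"
    have "\<bar>\<tau> j * Y j + \<kappa> * \<bar>Y j\<bar>\<bar> \<le> (\<bar>\<tau> j\<bar> + \<bar>\<kappa>\<bar>) * \<bar>Y j\<bar>"
      using abs_triangle_ineq[of "\<tau> j * Y j" "\<kappa> * \<bar>Y j\<bar>"] by (simp add: abs_mult algebra_simps)
    also have "\<dots> \<le> B * \<bar>Y j\<bar>" using B[OF \<open>j \<in> J\<close>] by (intro mult_right_mono) auto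
    finally show "\<bar>\<tau> j * Y j + \<kappa> * \<bar>Y j\<bar>\<bar> \<le> B * \<bar>Y j\<bar>" .
  qed
  finally show ?thesis by (simp add: sum_distrib_left)
qed

text \<open>
  The argument is by the number of outliers in the window. Without outliers, this is a Taylor
  expansion with remainder of order \<open>h\<^sup>2\<close>. With a single outlier, the shift is of order one; replacing \<open>G\<close>
  by \<open>G0\<close> costs \<open>2 * r\<close>, and dropping the part of order \<open>h\<close> costs a Lipschitz bound, truncated at one
  where it involves the outliers. With two or more outliers, only boundedness is used, and the number of
  ordered pairs of outliers pays for it.
\<close>
lemma threshold_expansion:
  fixes G G0 :: "real \<Rightarrow> real" and V z \<xi> b \<tau> :: "nat \<Rightarrow> real" and p :: nat and a B C L h r x \<kappa> :: real
  defines "W \<equiv> \<lambda>j. V j + (if j = 0 then 0 else z j * \<xi> j)"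
    and "S \<equiv> \<Sum>j\<le>p. \<bar>V j\<bar>" and "N \<equiv> \<Sum>j\<le>p. z j"
  assumes z: "\<And>j. j \<le> p \<Longrightarrow> z j \<in> {0, 1}" and h: "0 \<le> h"
    and B: "\<And>j. j \<le> p \<Longrightarrow> \<bar>\<tau> j\<bar> + \<bar>\<kappa>\<bar> \<le> B"
    and lip: "\<And>u w. \<bar>G u - G w\<bar> \<le> L * \<bar>u - w\<bar>" and range: "\<And>u w. \<bar>G u - G w\<bar> \<le> 1"
    and taylor: "\<And>d. \<bar>G (x + d) - G x - a * d\<bar> \<le> C * d\<^sup>2" and a: "\<bar>a\<bar> \<le> L" and C: "0 \<le> C"
    and near: "\<And>u. \<bar>G u - G0 u\<bar> \<le> r" and range0: "\<And>u w. \<bar>G0 u - G0 w\<bar> \<le> 1"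
  shows "\<bar>G (x + ((\<Sum>j\<le>p. b j * (z j * \<xi> j)) + h * ((\<Sum>j\<le>p. \<tau> j * W j) + \<kappa> * (\<Sum>j\<le>p. \<bar>W j\<bar>)))) - G x
      - a * (h * ((\<Sum>j\<le>p. \<tau> j * V j) + \<kappa> * S)) - (\<Sum>j\<le>p. z j * (G0 (x + b j * \<xi> j) - G0 x))\<bar>
    \<le> C * (h * B * S)\<^sup>2 + N * (2 * L * B * h * S + (\<Sum>j\<le>p. min 1 (L * B * h * \<bar>\<xi> j\<bar>)) + 2 * r)
      + 2 * (\<Sum>i\<le>p. \<Sum>j\<in>{..p} - {i}. z i * z j)"
    (is "\<bar>?G - G x - a * (h * ?e0) - ?J\<bar> \<le> ?Q + N * ?K + 2 * ?P")
proof -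
  define e where "e = (\<Sum>j\<le>p. \<tau> j * W j) + \<kappa> * (\<Sum>j\<le>p. \<bar>W j\<bar>)"
  have lin: "\<bar>(\<Sum>j\<le>p. \<tau> j * Y j) + \<kappa> * (\<Sum>j\<le>p. \<bar>Y j\<bar>)\<bar> \<le> B * (\<Sum>j\<le>p. \<bar>Y j\<bar>)" for Y
    by (rule abs_linear_form_le) (simp add: B)
  have B0: "0 \<le> B" using B[of 0] by linarith
  have L0: "0 \<le> L" using a by linarith
  have S0: "0 \<le> S" unfolding S_def by (intro sum_nonneg) auto
  have r0: "0 \<le> r" using near[of 0] by linarith
  have e0: "\<bar>?e0\<bar> \<le> B * S" using lin[of V] by (simp add: S_def)
  have ae0: "\<bar>a * (h * ?e0)\<bar> \<le> L * B * h * S"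
  proof -
    have "\<bar>a * (h * ?e0)\<bar> = \<bar>a\<bar> * (h * \<bar>?e0\<bar>)" using h by (simp add: abs_mult)
    also have "\<dots> \<le> L * (h * (B * S))" using a h e0 L0 by (intro mult_mono) auto
    finally show ?thesis by (simp add: mult_ac)
  qed
  have K0: "0 \<le> (\<Sum>j\<le>p. min 1 (L * B * h * \<bar>\<xi> j\<bar>))" "0 \<le> L * B * h * S"
    using L0 B0 h S0 by (auto intro!: sum_nonneg)
  have Q0: "0 \<le> ?Q" using C by simp
  have P: "?P = N * (N - 1)" unfolding N_def by (rule zero_one_pair_sum) (rule z)
  have z01: "0 \<le> z j" "z j \<le> 1" if "j \<le> p" for j using z[OF that] by auto
  have N_ge: "N \<ge> (\<Sum>j\<in>J. z j)" if "J \<subseteq> {..p}" for J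
    unfolding N_def by (rule sum_mono2) (use that z01 in auto)
  consider (none) "\<And>j. j \<le> p \<Longrightarrow> z j = 0"
    | (one) i where "i \<le> p" "z i = 1" "\<And>j. j \<le> p \<Longrightarrow> j \<noteq> i \<Longrightarrow> z j = 0"
    | (two) i k where "i \<le> p" "k \<le> p" "i \<noteq> k" "z i = 1" "z k = 1"
    using z by blast
  then show ?thesis
  proof cases
    case none
    have "(\<Sum>j\<le>p. b j * (z j * \<xi> j)) = 0" "?J = 0" "N = 0" "?P = 0"
      using none by (auto simp: N_def)
    moreover have "(\<Sum>j\<le>p. \<tau> j * W j) = (\<Sum>j\<le>p. \<tau> j * V j)" "(\<Sum>j\<le>p. \<bar>W j\<bar>) = S"
      unfolding S_def using none by (auto simp: W_def intro!: sum.cong)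
    ultimately have "\<bar>?G - G x - a * (h * ?e0) - ?J\<bar> = \<bar>G (x + h * ?e0) - G x - a * (h * ?e0)\<bar>"
      by simp
    also have "\<dots> \<le> C * (h * ?e0)\<^sup>2" by (rule taylor)
    also have "\<dots> \<le> C * (h * (B * S))\<^sup>2"
      using h e0 C B0 S0 by (intro mult_left_mono abs_le_square_iff[THEN iffD1]) (auto simp: abs_mult intro!: mult_left_mono)
    finally show ?thesis using \<open>N = 0\<close> \<open>?P = 0\<close> by (simp add: mult.assoc)
  next
    case one
    have single: "(\<Sum>j\<le>p. z j * c j) = c i" for c
    proof -
      have "(\<Sum>j\<le>p. z j * c j) = (\<Sum>j\<le>p. if j = i then c i else 0)"
        using one by (intro sum.cong) auto
      then show ?thesis using one(1) by simp
    qed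
    have s: "(\<Sum>j\<le>p. b j * (z j * \<xi> j)) = b i * \<xi> i"
      using single[of "\<lambda>j. b j * \<xi> j"] by (simp add: mult_ac)
    have J: "?J = G0 (x + b i * \<xi> i) - G0 x" by (rule single)
    have N1: "N = 1" using single[of "\<lambda>_. 1"] by (simp add: N_def)
    have "(\<Sum>j\<le>p. \<bar>W j\<bar>) \<le> (\<Sum>j\<le>p. \<bar>V j\<bar> + \<bar>\<xi> j\<bar>)"
    proof (rule sum_mono)
      fix j assume "j \<in> {..p}"
      then have "\<bar>z j * \<xi> j\<bar> \<le> \<bar>\<xi> j\<bar>" using z[of j] by auto
      then show "\<bar>W j\<bar> \<le> \<bar>V j\<bar> + \<bar>\<xi> j\<bar>" unfolding W_def by auto
    qed
    then have W: "(\<Sum>j\<le>p. \<bar>W j\<bar>) \<le> S + (\<Sum>j\<le>p. \<bar>\<xi> j\<bar>)" by (simp add: S_def sum.distrib)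
    have "\<bar>G (x + (b i * \<xi> i + h * e)) - G (x + b i * \<xi> i)\<bar> \<le> L * B * h * S + (\<Sum>j\<le>p. min 1 (L * B * h * \<bar>\<xi> j\<bar>))"
    proof -
      have "\<bar>G (x + (b i * \<xi> i + h * e)) - G (x + b i * \<xi> i)\<bar> \<le> L * \<bar>h * e\<bar>"
        using lip[of "x + (b i * \<xi> i + h * e)" "x + b i * \<xi> i"] by simp
      also have "\<dots> \<le> L * (h * (B * (S + (\<Sum>j\<le>p. \<bar>\<xi> j\<bar>))))"
        using lin[of W] W h B0 L0 unfolding e_def[symmetric]
        by (auto simp: abs_mult intro!: mult_left_mono elim: order_trans)
      also have "\<dots> = L * B * h * S + (\<Sum>j\<le>p. L * B * h * \<bar>\<xi> j\<bar>)"
        by (simp add: sum_distrib_left[symmetric] algebra_simps)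
      finally have le: "\<bar>G (x + (b i * \<xi> i + h * e)) - G (x + b i * \<xi> i)\<bar> \<le> \<dots>" .
      have nn: "0 \<le> (\<Sum>j\<le>p. L * B * h * \<bar>\<xi> j\<bar>)" using L0 B0 h by (intro sum_nonneg) auto
      have "min 1 (\<Sum>j\<le>p. L * B * h * \<bar>\<xi> j\<bar>) \<le> (\<Sum>j\<le>p. min 1 (L * B * h * \<bar>\<xi> j\<bar>))"
        using min_one_sum_le[of "{..p}" "\<lambda>j. L * B * h * \<bar>\<xi> j\<bar>"] nn L0 B0 h by (simp add: abs_mult)
      then show ?thesis using le range[of "x + (b i * \<xi> i + h * e)" "x + b i * \<xi> i"] K0 by linarith
    qed
    moreover have "?G = G (x + (b i * \<xi> i + h * e))" by (simp add: s e_def)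
    ultimately have "\<bar>?G - G (x + b i * \<xi> i)\<bar> \<le> L * B * h * S + (\<Sum>j\<le>p. min 1 (L * B * h * \<bar>\<xi> j\<bar>))"
      by simp
    then have "\<bar>?G - G x - a * (h * ?e0) - ?J\<bar> \<le> ?K"
      using near[of "x + b i * \<xi> i"] near[of x] ae0 unfolding J by linarith
    then show ?thesis using Q0 N1 P by simp
  next
    case two
    have N2: "2 \<le> N" using N_ge[of "{i, k}"] two by simp
    have "\<bar>?J\<bar> \<le> (\<Sum>j\<le>p. \<bar>z j * (G0 (x + b j * \<xi> j) - G0 x)\<bar>)" by (rule sum_abs)
    also have "\<dots> \<le> (\<Sum>j\<le>p. z j)"
    proof (rule sum_mono)
      fix j assume "j \<in> {..p}"
      then have "z j * \<bar>G0 (x + b j * \<xi> j) - G0 x\<bar> \<le> z j * 1"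
        using z01[of j] range0 by (intro mult_left_mono) auto
      then show "\<bar>z j * (G0 (x + b j * \<xi> j) - G0 x)\<bar> \<le> z j"
        using z01[of j] \<open>j \<in> {..p}\<close> by (simp add: abs_mult)
    qed
    finally have J: "\<bar>?J\<bar> \<le> N" by (simp add: N_def)
    have "N * 1 \<le> N * (N - 1)" using N2 by (intro mult_left_mono) auto
    then have "1 + N \<le> 2 * ?P" unfolding P using N2 by linarith
    moreover have "1 * (L * B * h * S) \<le> N * ?K"
    proof (rule mult_mono)
      show "L * B * h * S \<le> ?K" using K0 r0 by linarith
    qed (use N2 K0 in auto)
    ultimately show ?thesis using range[of "x + ((\<Sum>j\<le>p. b j * (z j * \<xi> j)) + h * ((\<Sum>j\<le>p. \<tau> j * W j) + \<kappa> * (\<Sum>j\<le>p. \<bar>W j\<bar>)))" x] ae0 J Q0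
      by linarith
  qed
qed

section \<open>Residual thresholds in the contaminated model\<close>

context contaminated_ar
begin

text \<open>
  An outlier at time \<open>t\<close> raises the residual at \<open>t\<close>, that is, lowers the threshold for the innovation;
  an outlier \<open>j\<close> steps earlier raises the threshold with the factor \<open>\<beta> j\<close>.
\<close>
definition outlier_coeff :: "nat \<Rightarrow> real" where
  "outlier_coeff = \<beta>(0 := -1)"

definition clean_regressor :: "int \<Rightarrow> nat \<Rightarrow> 'a \<Rightarrow> real" where
  "clean_regressor t j \<omega> = (if j = 0 then 1 else linear_process (t - int j) \<omega>)"

definition regressor :: "int \<Rightarrow> nat \<Rightarrow> 'a \<Rightarrow> real" where
  "regressor t j \<omega> = clean_regressor t j \<omega> + (if j = 0 then 0 else z (t - int j) \<omega> * \<xi> (t - int j) \<omega>)"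

text \<open>
  For \<open>\<kappa> = 0\<close> and \<open>\<tau>\<close> the normalized estimation errors this is the amount by which the threshold for
  the innovation differs from the threshold for the residual. The term with \<open>\<kappa>\<close> widens the shift so
  that it dominates the shifts of all parameters within \<open>\<bar>\<kappa>\<bar>\<close> of \<open>\<tau>\<close>.
\<close>
definition threshold_shift :: "nat \<Rightarrow> (nat \<Rightarrow> real) \<Rightarrow> real \<Rightarrow> int \<Rightarrow> 'a \<Rightarrow> real" where
  "threshold_shift n \<tau> \<kappa> t \<omega> =
     (\<Sum>j\<le>p. outlier_coeff j * (z (t - int j) \<omega> * \<xi> (t - int j) \<omega>))
     + 1 / sqrt (real n) * ((\<Sum>j\<le>p. \<tau> j * regressor t j \<omega>) + \<kappa> * (\<Sum>j\<le>p. \<bar>regressor t j \<omega>\<bar>))"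

definition indicator_sum :: "nat \<Rightarrow> real \<Rightarrow> (nat \<Rightarrow> real) \<Rightarrow> real \<Rightarrow> 'a \<Rightarrow> real" where
  "indicator_sum n x \<tau> \<kappa> \<omega> =
     (\<Sum>t=1..int n. indicator {..x + threshold_shift n \<tau> \<kappa> t \<omega>} (\<epsilon> t \<omega>) - indicator {..x} (\<epsilon> t \<omega>)) / sqrt (real n)"

definition compensator :: "nat \<Rightarrow> real \<Rightarrow> (nat \<Rightarrow> real) \<Rightarrow> real \<Rightarrow> 'a \<Rightarrow> real" where
  "compensator n x \<tau> \<kappa> \<omega> =
     (\<Sum>t=1..int n. G (x + threshold_shift n \<tau> \<kappa> t \<omega>) - G x) / sqrt (real n)"

definition window_outliers :: "int \<Rightarrow> 'a \<Rightarrow> real" where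
  "window_outliers t \<omega> = (\<Sum>j\<le>p. z (t - int j) \<omega>)"

definition window_pairs :: "int \<Rightarrow> 'a \<Rightarrow> real" where
  "window_pairs t \<omega> = (\<Sum>i\<le>p. \<Sum>j\<in>{..p} - {i}. z (t - int i) \<omega> * z (t - int j) \<omega>)"

definition clean_size :: "int \<Rightarrow> 'a \<Rightarrow> real" where
  "clean_size t \<omega> = (\<Sum>j\<le>p. \<bar>clean_regressor t j \<omega>\<bar>)"

definition size_bound :: real where
  "size_bound = real (p + 1) * (1 + real p * lp_var)"

lemma measurable_model[measurable]:
  "random_variable borel (clean_regressor t j)" "random_variable borel (regressor t j)"
  "random_variable borel (threshold_shift n \<tau> \<kappa> t)"
  "random_variable borel (window_outliers t)" "random_variable borel (window_pairs t)"
  "random_variable borel (clean_size t)"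
proof -
  show 1[measurable]: "random_variable borel (clean_regressor t j)" for t j
    unfolding clean_regressor_def[abs_def] by (cases "j = 0") auto
  show 2[measurable]: "random_variable borel (regressor t j)" for t j
    unfolding regressor_def[abs_def] by (cases "j = 0") auto
  show "random_variable borel (threshold_shift n \<tau> \<kappa> t)"
    unfolding threshold_shift_def[abs_def] by measurable
  show "random_variable borel (window_outliers t)" "random_variable borel (window_pairs t)"
    "random_variable borel (clean_size t)"
    unfolding window_outliers_def[abs_def] window_pairs_def[abs_def] clean_size_def[abs_def]
    by measurable
qed

lemma innovation_distribution: "real_distribution (distr M borel (\<epsilon> t))" "cdf (distr M borel (\<epsilon> t)) = G"
  using noise_measurable(1) by (auto intro: real_distribution_distr simp: eps_cdf)

lemma cdf_properties: "G \<in> borel_measurable borel" "0 \<le> G u" "G u \<le> 1"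
proof -
  interpret L: real_distribution "distr M borel (\<epsilon> 1)" by (rule innovation_distribution)
  have G: "G = cdf (distr M borel (\<epsilon> 1))" by (simp add: eps_cdf)
  show "G \<in> borel_measurable borel"
    unfolding G by (rule borel_measurable_mono) (intro monoI L.cdf_nondecreasing)
  show "0 \<le> G u" "G u \<le> 1" unfolding G by (simp_all add: L.cdf_nonneg L.cdf_bounded_prob)
qed

lemma coordinates_measurable:
  "(\<lambda>q. fst q s) \<in> borel_measurable (path_space \<Otimes>\<^sub>M (path_space \<Otimes>\<^sub>M path_space))"
  "(\<lambda>q. fst (snd q) s) \<in> borel_measurable (path_space \<Otimes>\<^sub>M (path_space \<Otimes>\<^sub>M path_space))"
  "(\<lambda>q. snd (snd q) s) \<in> borel_measurable (path_space \<Otimes>\<^sub>M (path_space \<Otimes>\<^sub>M path_space))"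
  by measurable

text \<open>
  All lags in the regressors are at least one, so that they involve innovations before \<open>s\<close> only. The
  contamination enters as a whole path, since it is independent of all innovations.
\<close>
lemma threshold_shift_predictable:
  obtains D where "D \<in> borel_measurable (path_space \<Otimes>\<^sub>M (path_space \<Otimes>\<^sub>M path_space))"
    and "\<And>t \<omega>. s \<le> t \<Longrightarrow> threshold_shift n \<tau> \<kappa> s \<omega> = D (past t \<omega>, (\<lambda>u. z u \<omega>), (\<lambda>u. \<xi> u \<omega>))"
proof -
  let ?P = "path_space \<Otimes>\<^sub>M (path_space \<Otimes>\<^sub>M path_space)"
  define W where "W j q = (if j = 0 then 1
      else (\<Sum>k. \<psi> k * fst q (s - int j - int k)) + fst (snd q) (s - int j) * snd (snd q) (s - int j))"
    for j :: nat and q :: "(int \<Rightarrow> real) \<times> (int \<Rightarrow> real) \<times> (int \<Rightarrow> real)"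
  define D where "D q = (\<Sum>j\<le>p. outlier_coeff j * (fst (snd q) (s - int j) * snd (snd q) (s - int j)))
     + 1 / sqrt (real n) * ((\<Sum>j\<le>p. \<tau> j * W j q) + \<kappa> * (\<Sum>j\<le>p. \<bar>W j q\<bar>))"
    for q :: "(int \<Rightarrow> real) \<times> (int \<Rightarrow> real) \<times> (int \<Rightarrow> real)"
  note [measurable] = coordinates_measurable
  have [measurable]: "W j \<in> borel_measurable ?P" for j
    unfolding W_def[abs_def] by (cases "j = 0") auto
  show thesis
  proof
    show "D \<in> borel_measurable ?P" unfolding D_def[abs_def] by measurable
    fix t \<omega> assume "s \<le> t"
    have "regressor s j \<omega> = W j (past t \<omega>, (\<lambda>u. z u \<omega>), (\<lambda>u. \<xi> u \<omega>))" for j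
      using \<open>s \<le> t\<close> by (cases "j = 0") (auto simp: regressor_def W_def clean_regressor_def linear_process_def past_def)
    then show "threshold_shift n \<tau> \<kappa> s \<omega> = D (past t \<omega>, (\<lambda>u. z u \<omega>), (\<lambda>u. \<xi> u \<omega>))"
      by (simp add: threshold_shift_def D_def)
  qed
qed

lemma innovation_independent_of_shift:
  "independent borel (\<epsilon> t) borel (threshold_shift n \<tau> \<kappa> t)"
  "s < t \<Longrightarrow> independent borel (\<epsilon> t) (borel \<Otimes>\<^sub>M (borel \<Otimes>\<^sub>M borel))
     (\<lambda>\<omega>. (\<epsilon> s \<omega>, threshold_shift n \<tau> \<kappa> s \<omega>, threshold_shift n \<tau> \<kappa> t \<omega>))"
proof -
  let ?P = "path_space \<Otimes>\<^sub>M (path_space \<Otimes>\<^sub>M path_space)"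
  let ?h = "\<lambda>\<omega>. (past t \<omega>, (\<lambda>u. z u \<omega>), (\<lambda>u. \<xi> u \<omega>))"
  obtain D where D: "D \<in> borel_measurable ?P" "\<And>\<omega>. threshold_shift n \<tau> \<kappa> t \<omega> = D (?h \<omega>)"
    using threshold_shift_predictable[of t n \<tau> \<kappa>] by (metis order_refl)
  show "independent borel (\<epsilon> t) borel (threshold_shift n \<tau> \<kappa> t)"
    using independent_compose[OF innovation_independent_of_past[of t] measurable_ident_sets[OF refl] D(1)]
    by (simp add: D(2)[symmetric])
  assume "s < t"
  obtain D' where D': "D' \<in> borel_measurable ?P" "\<And>\<omega>. threshold_shift n \<tau> \<kappa> s \<omega> = D' (?h \<omega>)"
    using threshold_shift_predictable[of s n \<tau> \<kappa>] \<open>s < t\<close> by (metis order_less_imp_le)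
  have m: "(\<lambda>q. (fst q s, D' q, D q)) \<in> ?P \<rightarrow>\<^sub>M borel \<Otimes>\<^sub>M (borel \<Otimes>\<^sub>M borel)"
    by (intro measurable_Pair D D' coordinates_measurable)
  show "independent borel (\<epsilon> t) (borel \<Otimes>\<^sub>M (borel \<Otimes>\<^sub>M borel))
     (\<lambda>\<omega>. (\<epsilon> s \<omega>, threshold_shift n \<tau> \<kappa> s \<omega>, threshold_shift n \<tau> \<kappa> t \<omega>))"
    using independent_compose[OF innovation_independent_of_past[of t] measurable_ident_sets[OF refl] m] \<open>s < t\<close>
    by (simp add: D(2)[symmetric] D'(2)[symmetric] past_def)
qed

lemma clean_size_ge_1: "1 \<le> clean_size t \<omega>"
  using member_le_sum[of 0 "{..p}" "\<lambda>j. \<bar>clean_regressor t j \<omega>\<bar>"]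
  by (simp add: clean_size_def clean_regressor_def)

lemma clean_size_moments:
  "integrable M (clean_size t)" "integrable M (\<lambda>\<omega>. (clean_size t \<omega>)\<^sup>2)"
  "expectation (clean_size t) \<le> size_bound" "expectation (\<lambda>\<omega>. (clean_size t \<omega>)\<^sup>2) \<le> size_bound"
proof -
  have i: "integrable M (\<lambda>\<omega>. (clean_regressor t j \<omega>)\<^sup>2)" for j
    unfolding clean_regressor_def using linear_process_second_moment(1) by (cases "j = 0") auto
  have e: "expectation (\<lambda>\<omega>. (clean_regressor t j \<omega>)\<^sup>2) \<le> (if j = 0 then 1 else lp_var)" for j
    unfolding clean_regressor_def using linear_process_second_moment(2) by (cases "j = 0") (auto simp: prob_space)
  have le: "(clean_size t \<omega>)\<^sup>2 \<le> (\<Sum>j\<le>p. (clean_regressor t j \<omega>)\<^sup>2) * real (p + 1)" for \<omega>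
    using sum_squared_le_sum_of_squares[of "\<lambda>j. \<bar>clean_regressor t j \<omega>\<bar>" "{..p}"]
    by (simp add: clean_size_def)
  have isum: "integrable M (\<lambda>\<omega>. (\<Sum>j\<le>p. (clean_regressor t j \<omega>)\<^sup>2) * real (p + 1))"
    by (intro integrable_mult_left Bochner_Integration.integrable_sum i)
  show i2: "integrable M (\<lambda>\<omega>. (clean_size t \<omega>)\<^sup>2)"
    by (rule Bochner_Integration.integrable_bound[OF isum]) (use le in \<open>auto intro!: AE_I2 order_trans[OF _ abs_ge_self]\<close>)
  have "expectation (\<lambda>\<omega>. (clean_size t \<omega>)\<^sup>2) \<le> expectation (\<lambda>\<omega>. (\<Sum>j\<le>p. (clean_regressor t j \<omega>)\<^sup>2) * real (p + 1))"
    by (rule integral_mono[OF i2 isum le])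
  also have "\<dots> = (\<Sum>j\<le>p. expectation (\<lambda>\<omega>. (clean_regressor t j \<omega>)\<^sup>2)) * real (p + 1)"
    by (simp add: i)
  also have "\<dots> \<le> (\<Sum>j\<le>p. if j = 0 then 1 else lp_var) * real (p + 1)"
    by (intro mult_right_mono sum_mono e) auto
  also have "\<dots> = size_bound"
    by (simp add: size_bound_def atMost_atLeast0 sum.atLeast_Suc_atMost mult.commute)
  finally show e2: "expectation (\<lambda>\<omega>. (clean_size t \<omega>)\<^sup>2) \<le> size_bound" .
  have le2: "clean_size t \<omega> \<le> (clean_size t \<omega>)\<^sup>2" for \<omega>
    using clean_size_ge_1[of t \<omega>] by (intro self_le_power) auto
  show i1: "integrable M (clean_size t)"
    by (rule Bochner_Integration.integrable_bound[OF i2])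
       (use le2 clean_size_ge_1 in \<open>auto intro!: AE_I2 simp: abs_of_nonneg order_trans[OF zero_le_one]\<close>)
  show "expectation (clean_size t) \<le> size_bound"
    using integral_mono[OF i1 i2 le2] e2 by linarith
qed

lemma window_moments:
  "integrable M (window_outliers t)" "expectation (window_outliers t) = real (p + 1) * g"
  "integrable M (window_pairs t)" "expectation (window_pairs t) = real (p + 1) * real p * g\<^sup>2"
proof -
  show "integrable M (window_outliers t)" "expectation (window_outliers t) = real (p + 1) * g"
    unfolding window_outliers_def[abs_def] by (simp_all add: contamination_integrable contamination_mean)
  show "integrable M (window_pairs t)"
    unfolding window_pairs_def[abs_def] by (simp add: contamination_product_integrable)
  have "expectation (window_pairs t) = (\<Sum>i\<le>p. \<Sum>j\<in>{..p} - {i}. expectation (\<lambda>\<omega>. z (t - int i) \<omega> * z (t - int j) \<omega>))"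
    unfolding window_pairs_def[abs_def] by (simp add: contamination_product_integrable)
  also have "\<dots> = (\<Sum>i\<le>p. \<Sum>j\<in>{..p} - {i}. g\<^sup>2)"
    by (intro sum.cong refl contamination_product_mean) auto
  also have "\<dots> = real (p + 1) * real p * g\<^sup>2"
    by simp
  finally show "expectation (window_pairs t) = real (p + 1) * real p * g\<^sup>2" .
qed

text \<open>
  The summands are martingale differences, so that the second moment of the normalized sum is at
  most the average of the mean increments of \<open>G\<close>.
\<close>
lemma indicator_sum_minus_compensator:
  assumes n: "1 \<le> n" and c: "\<And>t. expectation (\<lambda>\<omega>. \<bar>G (x + threshold_shift n \<tau> \<kappa> t \<omega>) - G x\<bar>) \<le> c"
  shows "integrable M (\<lambda>\<omega>. indicator_sum n x \<tau> \<kappa> \<omega> - compensator n x \<tau> \<kappa> \<omega>)"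
    and "expectation (\<lambda>\<omega>. \<bar>indicator_sum n x \<tau> \<kappa> \<omega> - compensator n x \<tau> \<kappa> \<omega>\<bar>) \<le> sqrt c"
proof -
  let ?X = "\<lambda>t \<omega>. centred_indicator G x (threshold_shift n \<tau> \<kappa> t \<omega>) (\<epsilon> t \<omega>)"
  note [measurable] = cdf_properties(1)
  have eq: "indicator_sum n x \<tau> \<kappa> \<omega> - compensator n x \<tau> \<kappa> \<omega> = (\<Sum>t=1..int n. ?X t \<omega>) / sqrt (real n)" for \<omega>
    by (simp add: indicator_sum_def compensator_def centred_indicator_def sum_subtractf diff_divide_distrib)
  have law: "distr M borel (\<epsilon> t) = distr M borel (\<epsilon> 1)" for t by (rule innovation_law)
  have V: "integrable M (\<lambda>\<omega>. (\<Sum>t=1..int n. ?X t \<omega>)\<^sup>2)"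
    "expectation (\<lambda>\<omega>. (\<Sum>t=1..int n. ?X t \<omega>)\<^sup>2) \<le> (\<Sum>t=1..int n. expectation (\<lambda>\<omega>. \<bar>G (x + threshold_shift n \<tau> \<kappa> t \<omega>) - G x\<bar>))"
    by (rule centred_indicator_sum_variance[OF innovation_distribution(1) innovation_distribution(2)[symmetric] law
          innovation_independent_of_shift]; simp)+
  have i: "integrable M (\<lambda>\<omega>. ((\<Sum>t=1..int n. ?X t \<omega>) / sqrt (real n))\<^sup>2)"
    unfolding power_divide using V(1) by (rule integrable_divide_zero[rotated])
  have "expectation (\<lambda>\<omega>. ((\<Sum>t=1..int n. ?X t \<omega>) / sqrt (real n))\<^sup>2) = expectation (\<lambda>\<omega>. (\<Sum>t=1..int n. ?X t \<omega>)\<^sup>2) / real n"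
    unfolding power_divide by simp
  also have "\<dots> \<le> (\<Sum>t=1..int n. c) / real n"
    by (intro divide_right_mono order_trans[OF V(2)] sum_mono c) auto
  also have "\<dots> = c" using n by simp
  finally have e: "expectation (\<lambda>\<omega>. ((\<Sum>t=1..int n. ?X t \<omega>) / sqrt (real n))\<^sup>2) \<le> c" .
  have m: "random_variable borel (\<lambda>\<omega>. (\<Sum>t=1..int n. ?X t \<omega>) / sqrt (real n))" by measurable
  show "integrable M (\<lambda>\<omega>. indicator_sum n x \<tau> \<kappa> \<omega> - compensator n x \<tau> \<kappa> \<omega>)"
    and "expectation (\<lambda>\<omega>. \<bar>indicator_sum n x \<tau> \<kappa> \<omega> - compensator n x \<tau> \<kappa> \<omega>\<bar>) \<le> sqrt c"
    unfolding eq using expectation_abs_le_sqrt[OF m i e] by auto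
qed

end

context contaminated_ar
begin

lemma AE_contamination_values: "AE \<omega> in M. \<forall>t. z t \<omega> \<in> {0, 1}"
  unfolding AE_all_countable using z_values by blast

lemma expectation_outlier_function:
  assumes [measurable]: "f \<in> borel_measurable borel"
  shows "expectation (\<lambda>\<omega>. f (\<xi> t \<omega>) :: real) = (\<integral>u. f u \<partial>Q)"
  using integral_distr[of "\<xi> t" M borel f] by (simp add: xi_law)

text \<open>
  The summands are uncorrelated, and each second moment is at most \<open>g\<close> because the summand before centring
  vanishes unless there is an outlier.
\<close>
lemma marked_contamination_mean:
  assumes n: "1 \<le> n" and f[measurable]: "f \<in> borel_measurable borel" and f1: "\<And>u. \<bar>f u\<bar> \<le> (1::real)"
  shows "integrable M (\<lambda>\<omega>. (\<Sum>t=1..int n. z (t - h) \<omega> * f (\<xi> (t - h) \<omega>) - g * (\<integral>u. f u \<partial>Q)) / sqrt (real n))"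
    and "expectation (\<lambda>\<omega>. \<bar>(\<Sum>t=1..int n. z (t - h) \<omega> * f (\<xi> (t - h) \<omega>) - g * (\<integral>u. f u \<partial>Q)) / sqrt (real n)\<bar>) \<le> sqrt g"
proof -
  define m where "m = (\<integral>u. f u \<partial>Q)"
  define Y where "Y t \<omega> = z (t - h) \<omega> * f (\<xi> (t - h) \<omega>)" for t \<omega>
  define X where "X t \<omega> = Y t \<omega> - g * m" for t \<omega>
  have [measurable]: "random_variable borel (Y t)" "random_variable borel (X t)" for t
    unfolding Y_def[abs_def] X_def[abs_def] by measurable
  have fint: "integrable M (\<lambda>\<omega>. f (\<xi> t \<omega>))" for t
    by (rule integrable_const_bound[of _ 1]) (use f1 in auto)
  have f2int: "integrable M (\<lambda>\<omega>. f (\<xi> s \<omega>) * f (\<xi> t \<omega>))" for s t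
    by (rule integrable_const_bound[of _ 1]) (use f1 in \<open>auto simp: abs_mult intro!: AE_I2 mult_le_one\<close>)
  have Eff: "expectation (\<lambda>\<omega>. f (\<xi> s \<omega>) * f (\<xi> t \<omega>)) = m\<^sup>2" if "s \<noteq> t" for s t
  proof -
    have "indep_var borel (\<lambda>\<omega>. f (\<xi> s \<omega>)) borel (\<lambda>\<omega>. f (\<xi> t \<omega>))"
      using independent_compose[OF _ f f] indep_var_of_family[OF xi_indep that]
      by (simp add: independent_iff_indep_var)
    from indep_var_lebesgue_integral[OF this fint fint] show ?thesis
      by (simp add: expectation_outlier_function m_def power2_eq_square)
  qed
  have Y1: "integrable M (Y t)" "expectation (Y t) = g * m" for t
    unfolding Y_def
    using expectation_contamination_times[of "\<lambda>h'. h' (t - h)" "\<lambda>q. f (snd q (t - h))"]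
    by (simp_all add: contamination_integrable contamination_mean fint expectation_outlier_function m_def)
  have YY: "integrable M (\<lambda>\<omega>. Y s \<omega> * Y t \<omega>)"
    "s \<noteq> t \<Longrightarrow> expectation (\<lambda>\<omega>. Y s \<omega> * Y t \<omega>) = (g * m)\<^sup>2" for s t
  proof -
    have eq: "Y s \<omega> * Y t \<omega> = (z (s - h) \<omega> * z (t - h) \<omega>) * (f (\<xi> (s - h) \<omega>) * f (\<xi> (t - h) \<omega>))" for \<omega>
      by (simp add: Y_def mult_ac)
    note * = expectation_contamination_times[of "\<lambda>h'. h' (s - h) * h' (t - h)" "\<lambda>q. f (snd q (s - h)) * f (snd q (t - h))"]
    show "integrable M (\<lambda>\<omega>. Y s \<omega> * Y t \<omega>)"
      unfolding eq using *(1) by (simp add: contamination_product_integrable f2int)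
    show "expectation (\<lambda>\<omega>. Y s \<omega> * Y t \<omega>) = (g * m)\<^sup>2" if "s \<noteq> t"
      unfolding eq using *(2) that
      by (simp add: contamination_product_integrable contamination_product_mean f2int Eff power_mult_distrib)
  qed
  have XX: "X s \<omega> * X t \<omega> = Y s \<omega> * Y t \<omega> - g * m * Y s \<omega> - g * m * Y t \<omega> + (g * m)\<^sup>2" for s t \<omega>
    by (simp add: X_def power2_eq_square algebra_simps)
  have Xint: "integrable M (\<lambda>\<omega>. X s \<omega> * X t \<omega>)" for s t
    unfolding XX using YY(1) Y1(1) by simp
  have Xorth: "expectation (\<lambda>\<omega>. X s \<omega> * X t \<omega>) = 0" if "s \<noteq> t" for s t
  proof -
    have "expectation (\<lambda>\<omega>. X s \<omega> * X t \<omega>) = expectation (\<lambda>\<omega>. Y s \<omega> * Y t \<omega>) - g * m * (g * m) - g * m * (g * m) + (g * m)\<^sup>2"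
      unfolding XX using YY(1) Y1 by (simp add: prob_space)
    then show ?thesis using YY(2)[OF that] by (simp add: power2_eq_square)
  qed
  have Xsq: "expectation (\<lambda>\<omega>. (X t \<omega>)\<^sup>2) \<le> g" for t
  proof -
    have "expectation (\<lambda>\<omega>. (X t \<omega>)\<^sup>2) = expectation (\<lambda>\<omega>. Y t \<omega> * Y t \<omega>) - g * m * (g * m) - g * m * (g * m) + (g * m)\<^sup>2"
      unfolding power2_eq_square[of "X t _"] XX using YY(1) Y1 by (simp add: prob_space)
    then have "expectation (\<lambda>\<omega>. (X t \<omega>)\<^sup>2) \<le> expectation (\<lambda>\<omega>. Y t \<omega> * Y t \<omega>)"
      using zero_le_power2[of "g * m"] unfolding power2_eq_square by linarith
    also have "\<dots> \<le> expectation (z (t - h))"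
    proof (rule integral_mono_AE[OF YY(1) contamination_integrable])
      show "AE \<omega> in M. Y t \<omega> * Y t \<omega> \<le> z (t - h) \<omega>"
        using z_values[of "t - h"]
      proof eventually_elim
        case (elim \<omega>)
        have "f (\<xi> (t - h) \<omega>) * f (\<xi> (t - h) \<omega>) \<le> 1"
          using f1[of "\<xi> (t - h) \<omega>"] abs_square_le_1[of "f (\<xi> (t - h) \<omega>)"] by (simp add: power2_eq_square)
        then show ?case using elim by (auto simp: Y_def)
      qed
    qed
    finally show ?thesis by (simp add: contamination_mean)
  qed
  have V1: "integrable M (\<lambda>\<omega>. (\<Sum>t=1..int n. X t \<omega>)\<^sup>2)"
    by (rule expectation_square_orthogonal_sum(1)) (auto intro: Xint Xorth)
  have V2: "expectation (\<lambda>\<omega>. (\<Sum>t=1..int n. X t \<omega>)\<^sup>2) = (\<Sum>t=1..int n. expectation (\<lambda>\<omega>. (X t \<omega>)\<^sup>2))"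
    by (rule expectation_square_orthogonal_sum(2)) (auto intro: Xint Xorth)
  have i: "integrable M (\<lambda>\<omega>. ((\<Sum>t=1..int n. X t \<omega>) / sqrt (real n))\<^sup>2)"
    unfolding power_divide using V1 by (rule integrable_divide_zero[rotated])
  have "expectation (\<lambda>\<omega>. ((\<Sum>t=1..int n. X t \<omega>) / sqrt (real n))\<^sup>2) = expectation (\<lambda>\<omega>. (\<Sum>t=1..int n. X t \<omega>)\<^sup>2) / real n"
    unfolding power_divide by simp
  also have "\<dots> \<le> (\<Sum>t=1..int n. g) / real n"
    unfolding V2 by (intro divide_right_mono sum_mono Xsq) auto
  also have "\<dots> = g" using n by simp
  finally have e: "expectation (\<lambda>\<omega>. ((\<Sum>t=1..int n. X t \<omega>) / sqrt (real n))\<^sup>2) \<le> g" .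
  have mm: "random_variable borel (\<lambda>\<omega>. (\<Sum>t=1..int n. X t \<omega>) / sqrt (real n))" by measurable
  show "integrable M (\<lambda>\<omega>. (\<Sum>t=1..int n. z (t - h) \<omega> * f (\<xi> (t - h) \<omega>) - g * (\<integral>u. f u \<partial>Q)) / sqrt (real n))"
    and "expectation (\<lambda>\<omega>. \<bar>(\<Sum>t=1..int n. z (t - h) \<omega> * f (\<xi> (t - h) \<omega>) - g * (\<integral>u. f u \<partial>Q)) / sqrt (real n)\<bar>) \<le> sqrt g"
    using expectation_abs_le_sqrt[OF mm i e] by (simp_all add: X_def Y_def m_def)
qed

end

text \<open>
  The innovation distribution function \<open>G\<close> is within \<open>r\<close> of the limiting one, \<open>G0\<close>, and is expanded
  at the fixed point \<open>x\<close>, where its slope is \<open>a\<close>.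
\<close>
locale threshold_model = contaminated_ar M p \<beta> \<nu> G g Q \<epsilon> z \<xi> v
  for M :: "'a measure" and p :: nat and \<beta> :: "nat \<Rightarrow> real" and \<nu> :: real
    and G :: "real \<Rightarrow> real" and g :: real and Q :: "real measure"
    and \<epsilon> z \<xi> v :: "int \<Rightarrow> 'a \<Rightarrow> real" +
  fixes n :: nat and x a L C r :: real and G0 :: "real \<Rightarrow> real"
  assumes n: "1 \<le> n"
    and lip: "\<And>u w. \<bar>G u - G w\<bar> \<le> L * \<bar>u - w\<bar>"
    and taylor: "\<And>d. \<bar>G (x + d) - G x - a * d\<bar> \<le> C * d\<^sup>2"
    and slope: "\<bar>a\<bar> \<le> L" and C_nonneg: "0 \<le> C"
    and near: "\<And>u. \<bar>G u - G0 u\<bar> \<le> r"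
    and G0_range: "\<And>u. 0 \<le> G0 u \<and> G0 u \<le> 1" and G0_measurable[measurable]: "G0 \<in> borel_measurable borel"
begin

lemma nonneg_constants: "0 \<le> L" "0 \<le> r"
  using slope near[of 0] by linarith+

definition jump :: "nat \<Rightarrow> real \<Rightarrow> real" where
  "jump j u = G0 (x + outlier_coeff j * u) - G0 x"

abbreviation process_mean :: "nat \<Rightarrow> 'a \<Rightarrow> real" where
  "process_mean j \<omega> \<equiv> (\<Sum>t=1..int n. linear_process (t - int j) \<omega>) / real n"

abbreviation outlier_fluctuation :: "nat \<Rightarrow> 'a \<Rightarrow> real" where
  "outlier_fluctuation j \<omega> \<equiv>
     (\<Sum>t=1..int n. z (t - int j) \<omega> * jump j (\<xi> (t - int j) \<omega>) - g * (\<integral>u. jump j u \<partial>Q)) / sqrt (real n)"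

definition outlier_drift :: real where
  "outlier_drift = (\<Sum>j\<le>p. \<integral>u. jump j u \<partial>Q)"

definition truncated_outlier_mean :: "real \<Rightarrow> real" where
  "truncated_outlier_mean B = (\<integral>u. min 1 \<bar>(L * B / sqrt (real n)) * u\<bar> \<partial>Q)"

text \<open>
  The right-hand side of \<open>threshold_expansion\<close> for the window ending at \<open>t\<close>.
\<close>
definition local_error :: "real \<Rightarrow> int \<Rightarrow> 'a \<Rightarrow> real" where
  "local_error B t \<omega> = C * (1 / sqrt (real n) * B * clean_size t \<omega>)\<^sup>2
     + window_outliers t \<omega> * (2 * L * B * (1 / sqrt (real n)) * clean_size t \<omega>
         + (\<Sum>j\<le>p. min 1 (L * B * (1 / sqrt (real n)) * \<bar>\<xi> (t - int j) \<omega>\<bar>)) + 2 * r)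
     + 2 * window_pairs t \<omega>"

text \<open>
  The four terms are the accumulated expansion errors, the deviation of the regressors from their
  mean zero, the widening of the shifts, and the fluctuation of the outlier contributions.
\<close>
definition remainder :: "real \<Rightarrow> real \<Rightarrow> 'a \<Rightarrow> real" where
  "remainder B k \<omega> = (\<Sum>t=1..int n. local_error B t \<omega>) / sqrt (real n)
     + L * B * (\<Sum>j=1..p. \<bar>process_mean j \<omega>\<bar>)
     + L * k * ((\<Sum>t=1..int n. clean_size t \<omega>) / real n)
     + (\<Sum>j\<le>p. \<bar>outlier_fluctuation j \<omega>\<bar>)"

lemma G_range: "\<bar>G u - G w\<bar> \<le> 1" "\<bar>G0 u - G0 w\<bar> \<le> 1"
  using cdf_properties(2,3)[of u] cdf_properties(2,3)[of w] G0_range[of u] G0_range[of w] by auto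

text \<open>
  This controls the variance of the martingale part: the increment is at most one in windows with
  outliers and of order \<open>1 / sqrt n\<close> in the others.
\<close>
lemma mean_threshold_increment:
  assumes B: "\<And>j. j \<le> p \<Longrightarrow> \<bar>\<tau> j\<bar> + \<bar>\<kappa>\<bar> \<le> B"
  shows "expectation (\<lambda>\<omega>. \<bar>G (x + threshold_shift n \<tau> \<kappa> t \<omega>) - G x\<bar>) \<le> real (p + 1) * g + L * B * size_bound / sqrt (real n)"
proof -
  note [measurable] = cdf_properties(1)
  have B0: "0 \<le> B" using B[of 0] by linarith
  have iB: "integrable M (\<lambda>\<omega>. window_outliers t \<omega> + L * B / sqrt (real n) * clean_size t \<omega>)"
    by (simp add: window_moments clean_size_moments)
  have i: "integrable M (\<lambda>\<omega>. \<bar>G (x + threshold_shift n \<tau> \<kappa> t \<omega>) - G x\<bar>)"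
    by (rule integrable_const_bound[of _ 1]) (use G_range in auto)
  have "expectation (\<lambda>\<omega>. \<bar>G (x + threshold_shift n \<tau> \<kappa> t \<omega>) - G x\<bar>)
      \<le> expectation (\<lambda>\<omega>. window_outliers t \<omega> + L * B / sqrt (real n) * clean_size t \<omega>)"
  proof (rule integral_mono_AE[OF i iB])
    show "AE \<omega> in M. \<bar>G (x + threshold_shift n \<tau> \<kappa> t \<omega>) - G x\<bar> \<le> window_outliers t \<omega> + L * B / sqrt (real n) * clean_size t \<omega>"
      using AE_contamination_values
    proof eventually_elim
      case (elim \<omega>)
      have S0: "0 \<le> L * B / sqrt (real n) * clean_size t \<omega>"
        using nonneg_constants B0 clean_size_ge_1[of t \<omega>] by (intro mult_nonneg_nonneg) auto
      show ?case
      proof (cases "\<exists>j\<le>p. z (t - int j) \<omega> = 1")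
        case True
        then obtain j where j: "j \<le> p" "z (t - int j) \<omega> = 1" by blast
        have z0: "0 \<le> z (t - int i) \<omega>" for i using elim[rule_format, of "t - int i"] by auto
        have "z (t - int j) \<omega> \<le> window_outliers t \<omega>"
          unfolding window_outliers_def using j z0 by (intro member_le_sum) auto
        then show ?thesis using j G_range(1)[of "x + threshold_shift n \<tau> \<kappa> t \<omega>" x] S0 by linarith
      next
        case False
        then have z0: "z (t - int j) \<omega> = 0" if "j \<le> p" for j using elim[rule_format, of "t - int j"] that by auto
        have shift: "threshold_shift n \<tau> \<kappa> t \<omega> = 1 / sqrt (real n) *
            ((\<Sum>j\<le>p. \<tau> j * clean_regressor t j \<omega>) + \<kappa> * (\<Sum>j\<le>p. \<bar>clean_regressor t j \<omega>\<bar>))"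
        proof -
          have "regressor t j \<omega> = clean_regressor t j \<omega>" if "j \<le> p" for j
            using z0[OF that] by (simp add: regressor_def)
          then show ?thesis by (simp add: threshold_shift_def z0)
        qed
        have "\<bar>threshold_shift n \<tau> \<kappa> t \<omega>\<bar> \<le> 1 / sqrt (real n) * (B * clean_size t \<omega>)"
          unfolding shift clean_size_def abs_mult
          using abs_linear_form_le[of "{..p}" \<tau> \<kappa> B "\<lambda>j. clean_regressor t j \<omega>"] B
          by (intro mult_mono) auto
        then have "L * \<bar>threshold_shift n \<tau> \<kappa> t \<omega>\<bar> \<le> L * (1 / sqrt (real n) * (B * clean_size t \<omega>))"
          using nonneg_constants by (intro mult_left_mono) auto
        moreover have "window_outliers t \<omega> = 0" by (simp add: window_outliers_def z0)
        moreover have "\<bar>G (x + threshold_shift n \<tau> \<kappa> t \<omega>) - G x\<bar> \<le> L * \<bar>threshold_shift n \<tau> \<kappa> t \<omega>\<bar>"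
          using lip[of "x + threshold_shift n \<tau> \<kappa> t \<omega>" x] by simp
        ultimately show ?thesis by (simp add: mult_ac)
      qed
    qed
  qed
  also have "\<dots> = real (p + 1) * g + L * B / sqrt (real n) * expectation (clean_size t)"
    by (simp add: window_moments clean_size_moments)
  also have "\<dots> \<le> real (p + 1) * g + L * B / sqrt (real n) * size_bound"
    using nonneg_constants B0 by (intro add_mono mult_left_mono clean_size_moments) auto
  finally show ?thesis by simp
qed

text \<open>
  Summing the expansion over \<open>t\<close> isolates \<open>\<tau> 0\<close>, the coefficient of the constant regressor. The
  remainder does not depend on \<open>\<tau>\<close>, so that it can be used at a random grid point.
\<close>
lemma compensator_expansion:
  assumes B: "\<And>j. j \<le> p \<Longrightarrow> \<bar>\<tau> j\<bar> + \<bar>\<kappa>\<bar> \<le> B" and k: "\<bar>\<kappa>\<bar> \<le> k"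
    and zv: "\<And>t. z t \<omega> \<in> {0, 1}"
  shows "\<bar>compensator n x \<tau> \<kappa> \<omega> - (a * \<tau> 0 + sqrt (real n) * g * outlier_drift)\<bar> \<le> remainder B k \<omega>"
proof -
  define h where "h = 1 / sqrt (real n)"
  have h: "0 \<le> h" and hh: "h * h = 1 / real n" by (simp_all add: h_def)
  have B0: "0 \<le> B" using B[of 0] by linarith
  define lin where "lin t = (\<Sum>j\<le>p. \<tau> j * clean_regressor t j \<omega>) + \<kappa> * clean_size t \<omega>" for t
  define J where "J t = (\<Sum>j\<le>p. z (t - int j) \<omega> * jump j (\<xi> (t - int j) \<omega>))" for t
  define D where "D t = G (x + threshold_shift n \<tau> \<kappa> t \<omega>) - G x" for t
  have err: "\<bar>D t - a * (h * lin t) - J t\<bar> \<le> local_error B t \<omega>" for t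
    unfolding D_def lin_def J_def local_error_def window_outliers_def window_pairs_def clean_size_def
      threshold_shift_def regressor_def jump_def h_def
    by (rule threshold_expansion) (use zv B lip G_range taylor slope C_nonneg near in auto)
  have comp: "compensator n x \<tau> \<kappa> \<omega> = h * (\<Sum>t=1..int n. D t)"
    by (simp add: compensator_def D_def h_def)
  have split: "h * (\<Sum>t=1..int n. D t) = h * (\<Sum>t=1..int n. D t - a * (h * lin t) - J t)
      + a * ((\<Sum>t=1..int n. lin t) / real n) + h * (\<Sum>t=1..int n. J t)"
  proof -
    have "h * (\<Sum>t=1..int n. a * (h * lin t)) = a * ((h * h) * (\<Sum>t=1..int n. lin t))"
      by (simp add: sum_distrib_left[symmetric] mult_ac)
    then show ?thesis unfolding hh sum_subtractf right_diff_distrib by simp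
  qed
  have lin_sum: "(\<Sum>t=1..int n. lin t) / real n
      = \<tau> 0 + (\<Sum>j=1..p. \<tau> j * process_mean j \<omega>) + \<kappa> * ((\<Sum>t=1..int n. clean_size t \<omega>) / real n)"
  proof -
    have "lin t = \<tau> 0 + (\<Sum>j=1..p. \<tau> j * linear_process (t - int j) \<omega>) + \<kappa> * clean_size t \<omega>" for t
      by (simp add: lin_def clean_regressor_def atMost_atLeast0 sum.atLeast_Suc_atMost)
    then have "(\<Sum>t=1..int n. lin t) = real n * \<tau> 0 + (\<Sum>t=1..int n. \<Sum>j=1..p. \<tau> j * linear_process (t - int j) \<omega>)
        + \<kappa> * (\<Sum>t=1..int n. clean_size t \<omega>)"
      by (simp add: sum.distrib sum_distrib_left)
    also have "(\<Sum>t=1..int n. \<Sum>j=1..p. \<tau> j * linear_process (t - int j) \<omega>)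
        = (\<Sum>j=1..p. \<tau> j * (\<Sum>t=1..int n. linear_process (t - int j) \<omega>))"
      by (subst sum.swap) (simp add: sum_distrib_left)
    finally have S: "(\<Sum>t=1..int n. lin t) = real n * \<tau> 0
        + (\<Sum>j=1..p. \<tau> j * (\<Sum>t=1..int n. linear_process (t - int j) \<omega>)) + \<kappa> * (\<Sum>t=1..int n. clean_size t \<omega>)" .
    have "(real n * u + w + y) / real n = u + w / real n + y / real n" for u w y
      using n by (simp add: add_divide_distrib)
    then have "(\<Sum>t=1..int n. lin t) / real n = \<tau> 0
        + (\<Sum>j=1..p. \<tau> j * (\<Sum>t=1..int n. linear_process (t - int j) \<omega>)) / real n
        + \<kappa> * ((\<Sum>t=1..int n. clean_size t \<omega>) / real n)"
      unfolding S by simp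
    also have "(\<Sum>j=1..p. \<tau> j * (\<Sum>t=1..int n. linear_process (t - int j) \<omega>)) / real n
        = (\<Sum>j=1..p. \<tau> j * process_mean j \<omega>)"
      by (subst sum_divide_distrib) simp
    finally show ?thesis .
  qed
  have J_sum: "h * (\<Sum>t=1..int n. J t) = sqrt (real n) * g * outlier_drift
      + (\<Sum>j\<le>p. outlier_fluctuation j \<omega>)"
  proof -
    have "(\<Sum>t=1..int n. J t) = (\<Sum>j\<le>p. \<Sum>t=1..int n. z (t - int j) \<omega> * jump j (\<xi> (t - int j) \<omega>))"
      unfolding J_def by (rule sum.swap)
    also have "\<dots> = (\<Sum>j\<le>p. (\<Sum>t=1..int n. z (t - int j) \<omega> * jump j (\<xi> (t - int j) \<omega>) - g * (\<integral>u. jump j u \<partial>Q)) + real n * (g * (\<integral>u. jump j u \<partial>Q)))"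
      by (simp add: sum_subtractf)
    also have "\<dots> = (\<Sum>j\<le>p. \<Sum>t=1..int n. z (t - int j) \<omega> * jump j (\<xi> (t - int j) \<omega>) - g * (\<integral>u. jump j u \<partial>Q))
        + real n * (g * outlier_drift)"
      by (simp add: sum.distrib outlier_drift_def sum_distrib_left)
    finally have "h * (\<Sum>t=1..int n. J t) = h * (\<Sum>j\<le>p. \<Sum>t=1..int n. z (t - int j) \<omega> * jump j (\<xi> (t - int j) \<omega>) - g * (\<integral>u. jump j u \<partial>Q))
        + (h * real n) * (g * outlier_drift)" by (simp add: algebra_simps)
    moreover have "h * real n = sqrt (real n)" using n by (simp add: h_def real_div_sqrt)
    moreover have "h * (\<Sum>j\<le>p. Y j) = (\<Sum>j\<le>p. Y j / sqrt (real n))" for Y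
      by (simp add: h_def sum_divide_distrib)
    ultimately show ?thesis by simp
  qed
  have dec: "compensator n x \<tau> \<kappa> \<omega> - (a * \<tau> 0 + sqrt (real n) * g * outlier_drift)
      = h * (\<Sum>t=1..int n. D t - a * (h * lin t) - J t)
      + a * (\<Sum>j=1..p. \<tau> j * process_mean j \<omega>)
      + a * (\<kappa> * ((\<Sum>t=1..int n. clean_size t \<omega>) / real n))
      + (\<Sum>j\<le>p. outlier_fluctuation j \<omega>)"
    (is "_ = ?t1 + ?t2 + ?t3 + ?t4")
    unfolding comp split lin_sum J_sum by (simp add: algebra_simps)
  have b1: "\<bar>?t1\<bar> \<le> (\<Sum>t=1..int n. local_error B t \<omega>) / sqrt (real n)"
  proof -
    have "\<bar>?t1\<bar> = h * \<bar>\<Sum>t=1..int n. D t - a * (h * lin t) - J t\<bar>" using h by (simp add: abs_mult)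
    also have "\<dots> \<le> h * (\<Sum>t=1..int n. local_error B t \<omega>)"
      using h err by (intro mult_left_mono order_trans[OF sum_abs] sum_mono) auto
    finally show ?thesis by (simp add: h_def)
  qed
  have b2: "\<bar>?t2\<bar> \<le> L * B * (\<Sum>j=1..p. \<bar>process_mean j \<omega>\<bar>)"
  proof -
    have "\<bar>\<Sum>j=1..p. \<tau> j * process_mean j \<omega>\<bar>
        \<le> (\<Sum>j=1..p. B * \<bar>process_mean j \<omega>\<bar>)"
    proof (rule order_trans[OF sum_abs sum_mono])
      fix j assume "j \<in> {1..p}"
      then have "\<bar>\<tau> j\<bar> \<le> B" using B[of j] by auto
      then show "\<bar>\<tau> j * process_mean j \<omega>\<bar> \<le> B * \<bar>process_mean j \<omega>\<bar>"
        unfolding abs_mult by (intro mult_right_mono) auto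
    qed
    then have "\<bar>?t2\<bar> \<le> L * (\<Sum>j=1..p. B * \<bar>process_mean j \<omega>\<bar>)"
      using slope nonneg_constants unfolding abs_mult by (intro mult_mono) auto
    then show ?thesis by (simp add: sum_distrib_left mult.assoc)
  qed
  have b3: "\<bar>?t3\<bar> \<le> L * k * ((\<Sum>t=1..int n. clean_size t \<omega>) / real n)"
  proof -
    have S0: "0 \<le> (\<Sum>t=1..int n. clean_size t \<omega>) / real n"
      using clean_size_ge_1[of _ \<omega>] by (intro divide_nonneg_nonneg sum_nonneg) (auto intro: order_trans[OF zero_le_one])
    have "\<bar>?t3\<bar> = \<bar>a\<bar> * (\<bar>\<kappa>\<bar> * ((\<Sum>t=1..int n. clean_size t \<omega>) / real n))"
      by (simp only: abs_mult abs_of_nonneg[OF S0])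
    also have "\<dots> \<le> L * (k * ((\<Sum>t=1..int n. clean_size t \<omega>) / real n))"
      by (intro mult_mono[OF slope] mult_right_mono[OF k] mult_nonneg_nonneg S0 abs_ge_zero nonneg_constants)
    finally show ?thesis by (simp add: mult.assoc)
  qed
  have b4: "\<bar>?t4\<bar> \<le> (\<Sum>j\<le>p. \<bar>outlier_fluctuation j \<omega>\<bar>)"
    by (rule sum_abs)
  have tri: "\<bar>t1 + t2 + t3 + t4\<bar> \<le> u1 + u2 + u3 + u4"
    if "\<bar>t1\<bar> \<le> u1" "\<bar>t2\<bar> \<le> u2" "\<bar>t3\<bar> \<le> u3" "\<bar>t4\<bar> \<le> u4" for t1 t2 t3 t4 u1 u2 u3 u4 :: real
    using that by linarith
  show ?thesis unfolding remainder_def dec by (intro tri b1 b2 b3 b4)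
qed

end

context threshold_model
begin

abbreviation local_error_bound :: "real \<Rightarrow> real" where
  "local_error_bound B \<equiv> C * B\<^sup>2 * size_bound / real n
       + real (p + 1) * g * (2 * L * B / sqrt (real n) * size_bound + real (p + 1) * truncated_outlier_mean B + 2 * r)
       + 2 * (real (p + 1) * real p * g\<^sup>2)"

definition error_bound :: "real \<Rightarrow> real \<Rightarrow> real" where
  "error_bound B k =
     sqrt (real n) * local_error_bound B
     + L * B * (real p * sqrt (lp_var / real n)) + L * k * size_bound + real (p + 1) * sqrt g"

text \<open>
  The contamination times are independent of innovations and outlier sizes, so that the mean of the
  middle term is a product.
\<close>
lemma local_error_mean:
  assumes "0 \<le> B"
  shows "integrable M (local_error B t)"
    and "expectation (local_error B t) \<le> local_error_bound B"
proof -
  define c where "c = L * B * (1 / sqrt (real n))"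
  have c0: "0 \<le> c" using nonneg_constants assms by (simp add: c_def)
  define Y where "Y \<omega> = 2 * c * clean_size t \<omega> + (\<Sum>j\<le>p. min 1 (c * \<bar>\<xi> (t - int j) \<omega>\<bar>)) + 2 * r" for \<omega>
  have min_int: "integrable M (\<lambda>\<omega>. min 1 (c * \<bar>\<xi> s \<omega>\<bar>))" for s
    by (rule integrable_const_bound[of _ 1]) (use c0 in auto)
  have min_exp: "expectation (\<lambda>\<omega>. min 1 (c * \<bar>\<xi> s \<omega>\<bar>)) = truncated_outlier_mean B" for s
  proof -
    have "L * B / sqrt (real n) = c" by (simp add: c_def)
    then show ?thesis
      using expectation_outlier_function[of "\<lambda>u. min 1 (c * \<bar>u\<bar>)" s] c0
      by (simp add: truncated_outlier_mean_def abs_mult)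
  qed
  have Yint: "integrable M Y"
    unfolding Y_def[abs_def] using min_int by (simp add: clean_size_moments)
  have EY: "expectation Y = 2 * c * expectation (clean_size t) + real (p + 1) * truncated_outlier_mean B + 2 * r"
    unfolding Y_def[abs_def] using min_int by (simp add: clean_size_moments min_exp prob_space)
  have NY: "integrable M (\<lambda>\<omega>. window_outliers t \<omega> * Y \<omega>)"
    "expectation (\<lambda>\<omega>. window_outliers t \<omega> * Y \<omega>) = expectation (window_outliers t) * expectation Y"
  proof -
    define y where "y q = 2 * c * (\<Sum>j\<le>p. \<bar>if j = 0 then 1 else \<Sum>k. \<psi> k * fst q (t - int j - int k)\<bar>)
        + (\<Sum>j\<le>p. min 1 (c * \<bar>snd q (t - int j)\<bar>)) + 2 * r" for q :: "(int \<Rightarrow> real) \<times> (int \<Rightarrow> real)"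
    have f: "(\<lambda>q. if j = 0 then 1 else \<Sum>k. \<psi> k * fst q (t - int j - int k))
        \<in> borel_measurable (path_space \<Otimes>\<^sub>M path_space)" for j :: nat
      by (cases "j = 0") auto
    note [measurable] = f
    have ym: "y \<in> borel_measurable (path_space \<Otimes>\<^sub>M path_space)"
      unfolding y_def[abs_def] by measurable
    have wm: "(\<lambda>h. \<Sum>j\<le>p. h (t - int j)) \<in> borel_measurable path_space" by measurable
    have eq: "y ((\<lambda>s. \<epsilon> s \<omega>), (\<lambda>s. \<xi> s \<omega>)) = Y \<omega>" for \<omega>
      by (simp add: y_def Y_def clean_size_def clean_regressor_def linear_process_def cong: if_cong)
    show "integrable M (\<lambda>\<omega>. window_outliers t \<omega> * Y \<omega>)"
      "expectation (\<lambda>\<omega>. window_outliers t \<omega> * Y \<omega>) = expectation (window_outliers t) * expectation Y"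
      using expectation_contamination_times[OF wm ym] window_moments(1)[of t] Yint
      by (simp_all add: eq window_outliers_def[abs_def])
  qed
  have le: "local_error B t \<omega> = C * B\<^sup>2 / real n * (clean_size t \<omega>)\<^sup>2 + window_outliers t \<omega> * Y \<omega> + 2 * window_pairs t \<omega>" for \<omega>
    unfolding local_error_def Y_def c_def
    by (simp add: power_mult_distrib power_divide mult_ac)
  show "integrable M (local_error B t)"
    unfolding le[abs_def] by (simp add: clean_size_moments NY window_moments)
  have "expectation (local_error B t) = C * B\<^sup>2 / real n * expectation (\<lambda>\<omega>. (clean_size t \<omega>)\<^sup>2)
      + real (p + 1) * g * expectation Y + 2 * (real (p + 1) * real p * g\<^sup>2)"
    unfolding le[abs_def] by (simp add: clean_size_moments NY window_moments)
  also have "\<dots> \<le> C * B\<^sup>2 / real n * size_bound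
      + real (p + 1) * g * (2 * c * size_bound + real (p + 1) * truncated_outlier_mean B + 2 * r) + 2 * (real (p + 1) * real p * g\<^sup>2)"
    unfolding EY using C_nonneg contamination_prob_range c0
    by (intro add_mono mult_left_mono clean_size_moments order_refl) auto
  finally show "expectation (local_error B t) \<le> local_error_bound B"
    by (simp add: c_def mult.assoc)
qed

lemma jump_measurable: "jump j \<in> borel_measurable borel"
  unfolding jump_def[abs_def] by measurable

lemma jump_bound: "\<bar>jump j u\<bar> \<le> 1"
  unfolding jump_def by (rule G_range)

lemma remainder_mean:
  assumes "0 \<le> B" "0 \<le> k"
  shows "integrable M (remainder B k)" and "expectation (remainder B k) \<le> error_bound B k"
proof -
  define e where "e = local_error_bound B"
  define R1 where "R1 \<omega> = (\<Sum>t=1..int n. local_error B t \<omega>) / sqrt (real n)" for \<omega>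
  define R2 where "R2 \<omega> = (\<Sum>j=1..p. \<bar>process_mean j \<omega>\<bar>)" for \<omega>
  define R3 where "R3 \<omega> = (\<Sum>t=1..int n. clean_size t \<omega>) / real n" for \<omega>
  define R4 where "R4 \<omega> = (\<Sum>j\<le>p. \<bar>outlier_fluctuation j \<omega>\<bar>)" for \<omega>
  have R: "remainder B k = (\<lambda>\<omega>. R1 \<omega> + L * B * R2 \<omega> + L * k * R3 \<omega> + R4 \<omega>)"
    by (simp add: remainder_def[abs_def] R1_def R2_def R3_def R4_def)
  have i1: "integrable M R1"
    unfolding R1_def[abs_def]
    by (intro integrable_divide_zero Bochner_Integration.integrable_sum local_error_mean assms)
  have i2: "integrable M R2"
    unfolding R2_def[abs_def]
    by (intro integrable_abs Bochner_Integration.integrable_sum linear_process_mean_small n)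
  have i3: "integrable M R3"
    unfolding R3_def[abs_def]
    by (intro integrable_divide_zero Bochner_Integration.integrable_sum clean_size_moments)
  have i4: "integrable M R4"
    unfolding R4_def[abs_def]
    by (intro integrable_abs Bochner_Integration.integrable_sum marked_contamination_mean n jump_measurable jump_bound)
  have e1: "expectation R1 \<le> sqrt (real n) * e"
  proof -
    have "expectation R1 = (\<Sum>t=1..int n. expectation (local_error B t)) / sqrt (real n)"
      unfolding R1_def[abs_def]
      by (subst integral_divide_zero, subst Bochner_Integration.integral_sum) (auto intro: local_error_mean assms)
    also have "\<dots> \<le> (\<Sum>t=1..int n. e) / sqrt (real n)"
      unfolding e_def using assms by (intro divide_right_mono sum_mono local_error_mean) auto
    also have "\<dots> = (real n / sqrt (real n)) * e" by simp
    also have "real n / sqrt (real n) = sqrt (real n)" using n by (simp add: real_div_sqrt)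
    finally show ?thesis .
  qed
  have e2: "expectation R2 \<le> real p * sqrt (lp_var / real n)"
  proof -
    have "expectation R2 = (\<Sum>j=1..p. expectation (\<lambda>\<omega>. \<bar>process_mean j \<omega>\<bar>))"
      unfolding R2_def[abs_def]
      by (rule Bochner_Integration.integral_sum) (intro integrable_abs linear_process_mean_small n)
    also have "\<dots> \<le> (\<Sum>j=1..p. sqrt (lp_var / real n))"
      by (intro sum_mono linear_process_mean_small n)
    finally show ?thesis by simp
  qed
  have e3: "expectation R3 \<le> size_bound"
  proof -
    have "expectation R3 = (\<Sum>t=1..int n. expectation (clean_size t)) / real n"
      unfolding R3_def[abs_def]
      by (subst integral_divide_zero, subst Bochner_Integration.integral_sum) (auto intro: clean_size_moments)
    also have "\<dots> \<le> (\<Sum>t=1..int n. size_bound) / real n"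
      by (intro divide_right_mono sum_mono clean_size_moments) auto
    finally show ?thesis using n by simp
  qed
  have e4: "expectation R4 \<le> real (p + 1) * sqrt g"
  proof -
    have "expectation R4 = (\<Sum>j\<le>p. expectation (\<lambda>\<omega>. \<bar>outlier_fluctuation j \<omega>\<bar>))"
      unfolding R4_def[abs_def]
      by (rule Bochner_Integration.integral_sum) (intro integrable_abs marked_contamination_mean n jump_measurable jump_bound)
    also have "\<dots> \<le> (\<Sum>j\<le>p. sqrt g)"
      by (intro sum_mono marked_contamination_mean n jump_measurable jump_bound)
    finally show ?thesis by simp
  qed
  show "integrable M (remainder B k)"
    unfolding R using i1 i2 i3 i4 by simp
  have "expectation (remainder B k) = expectation R1 + L * B * expectation R2 + L * k * expectation R3 + expectation R4"
    unfolding R using i1 i2 i3 i4 by simp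
  also have "\<dots> \<le> sqrt (real n) * e + L * B * (real p * sqrt (lp_var / real n)) + L * k * size_bound + real (p + 1) * sqrt g"
    using nonneg_constants assms by (intro add_mono mult_left_mono e1 e2 e3 e4) auto
  finally show "expectation (remainder B k) \<le> error_bound B k"
    by (simp add: error_bound_def e_def)
qed

text \<open>
  The linear forms of two parameters within \<open>\<eta>\<close> differ by at most \<open>\<eta>\<close> times the size of the regressors.
\<close>
lemma threshold_shift_bracket:
  assumes "\<And>j. j \<le> p \<Longrightarrow> \<bar>\<sigma> j - \<tau> j\<bar> \<le> \<eta>"
  shows "threshold_shift n \<tau> (- \<eta>) t \<omega> \<le> threshold_shift n \<sigma> 0 t \<omega>"
    and "threshold_shift n \<sigma> 0 t \<omega> \<le> threshold_shift n \<tau> \<eta> t \<omega>"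
proof -
  let ?W = "\<lambda>j. regressor t j \<omega>"
  have "\<bar>(\<Sum>j\<le>p. \<sigma> j * ?W j) - (\<Sum>j\<le>p. \<tau> j * ?W j)\<bar> = \<bar>\<Sum>j\<le>p. (\<sigma> j - \<tau> j) * ?W j\<bar>"
    by (simp add: left_diff_distrib sum_subtractf)
  also have "\<dots> \<le> (\<Sum>j\<le>p. \<eta> * \<bar>?W j\<bar>)"
    using assms by (intro order_trans[OF sum_abs sum_mono]) (auto simp: abs_mult intro: mult_right_mono)
  finally have "\<bar>(\<Sum>j\<le>p. \<sigma> j * ?W j) - (\<Sum>j\<le>p. \<tau> j * ?W j)\<bar> \<le> \<eta> * (\<Sum>j\<le>p. \<bar>?W j\<bar>)"
    by (simp add: sum_distrib_left)
  then have "(\<Sum>j\<le>p. \<tau> j * ?W j) + - \<eta> * (\<Sum>j\<le>p. \<bar>?W j\<bar>) \<le> (\<Sum>j\<le>p. \<sigma> j * ?W j) + 0 * (\<Sum>j\<le>p. \<bar>?W j\<bar>)"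
    "(\<Sum>j\<le>p. \<sigma> j * ?W j) + 0 * (\<Sum>j\<le>p. \<bar>?W j\<bar>) \<le> (\<Sum>j\<le>p. \<tau> j * ?W j) + \<eta> * (\<Sum>j\<le>p. \<bar>?W j\<bar>)"
    by linarith+
  then show "threshold_shift n \<tau> (- \<eta>) t \<omega> \<le> threshold_shift n \<sigma> 0 t \<omega>"
    and "threshold_shift n \<sigma> 0 t \<omega> \<le> threshold_shift n \<tau> \<eta> t \<omega>"
    unfolding threshold_shift_def by (intro add_left_mono mult_left_mono; simp)+
qed

lemma indicator_sum_mono:
  assumes "\<And>t. threshold_shift n \<tau> \<kappa> t \<omega> \<le> threshold_shift n \<tau>' \<kappa>' t \<omega>"
  shows "indicator_sum n x \<tau> \<kappa> \<omega> \<le> indicator_sum n x \<tau>' \<kappa>' \<omega>"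
  unfolding indicator_sum_def
proof (intro divide_right_mono sum_mono)
  fix t
  show "indicator {..x + threshold_shift n \<tau> \<kappa> t \<omega>} (\<epsilon> t \<omega>) - indicator {..x} (\<epsilon> t \<omega>)
      \<le> (indicator {..x + threshold_shift n \<tau>' \<kappa>' t \<omega>} (\<epsilon> t \<omega>) - indicator {..x} (\<epsilon> t \<omega>) :: real)"
    using assms[of t] by (auto simp: indicator_def)
qed simp

text \<open>
  Monotonicity in the threshold turns finitely many parameter values into control of the whole box:
  the martingale parts at all grid points, with both signs of the widening, are summed up, and one
  application of Markov's inequality suffices. The grid reaches up to \<open>b + 2\<close> and the widening is at most
  one, whence the bound \<open>b + 3\<close>.
\<close>
lemma plug_in_bound:
  fixes \<sigma> :: "nat \<Rightarrow> 'a \<Rightarrow> real" and S :: "(nat \<Rightarrow> real) set"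
  assumes "finite S" and S_bound: "\<And>\<tau> j. \<tau> \<in> S \<Longrightarrow> j \<le> p \<Longrightarrow> \<bar>\<tau> j\<bar> \<le> b + 2"
    and S_net: "\<And>s. (\<And>j. j \<le> p \<Longrightarrow> \<bar>s j\<bar> \<le> b) \<Longrightarrow> \<exists>\<tau>\<in>S. \<forall>j\<le>p. \<bar>s j - \<tau> j\<bar> \<le> \<eta>"
    and b: "0 \<le> b" and \<eta>: "0 < \<eta>" "\<eta> \<le> 1" and \<delta>: "0 < \<delta>"
    and \<sigma>[measurable]: "\<And>j. j \<le> p \<Longrightarrow> random_variable borel (\<sigma> j)"
    and A: "A \<subseteq> space M" "AE \<omega> in M. \<omega> \<in> A \<longrightarrow> (\<exists>j\<le>p. b < \<bar>\<sigma> j \<omega>\<bar>) \<or>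
      \<delta> < \<bar>indicator_sum n x (\<lambda>j. \<sigma> j \<omega>) 0 \<omega> - (a * \<sigma> 0 \<omega> + sqrt (real n) * g * outlier_drift)\<bar>"
  shows "measure M A
    \<le> (\<Sum>j\<le>p. measure M {\<omega> \<in> space M. \<bar>\<sigma> j \<omega>\<bar> > b})
      + (2 * real (card S) * sqrt (real (p + 1) * g + L * (b + 3) * size_bound / sqrt (real n))
         + error_bound (b + 3) \<eta> + L * \<eta>) / \<delta>"
proof -
  define c where "c = real (p + 1) * g + L * (b + 3) * size_bound / sqrt (real n)"
  define E where "E \<tau> \<kappa> \<omega> = \<bar>indicator_sum n x \<tau> \<kappa> \<omega> - compensator n x \<tau> \<kappa> \<omega>\<bar>" for \<tau> \<kappa> \<omega>
  define Z where "Z \<omega> = (\<Sum>\<tau>\<in>S. E \<tau> \<eta> \<omega> + E \<tau> (- \<eta>) \<omega>) + \<bar>remainder (b + 3) \<eta> \<omega>\<bar> + L * \<eta>" for \<omega>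
  define D where "D = sqrt (real n) * g * outlier_drift"
  have \<tau>\<kappa>: "\<bar>\<tau> j\<bar> + \<bar>\<kappa>\<bar> \<le> b + 3" if "\<tau> \<in> S" "j \<le> p" "\<bar>\<kappa>\<bar> \<le> \<eta>" for \<tau> j \<kappa>
    using S_bound[OF that(1,2)] that(3) \<eta> by linarith
  have E: "integrable M (E \<tau> \<kappa>)" "expectation (E \<tau> \<kappa>) \<le> sqrt c" if "\<tau> \<in> S" "\<bar>\<kappa>\<bar> \<le> \<eta>" for \<tau> \<kappa>
  proof -
    have m: "expectation (\<lambda>\<omega>. \<bar>G (x + threshold_shift n \<tau> \<kappa> t \<omega>) - G x\<bar>) \<le> c" for t
      unfolding c_def by (rule mean_threshold_increment) (use \<tau>\<kappa> that in auto)
    show "integrable M (E \<tau> \<kappa>)" "expectation (E \<tau> \<kappa>) \<le> sqrt c"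
      unfolding E_def[abs_def] using indicator_sum_minus_compensator[OF n m] by auto
  qed
  have R_nonneg: "AE \<omega> in M. 0 \<le> remainder (b + 3) \<eta> \<omega>"
    using AE_contamination_values
  proof eventually_elim
    case (elim \<omega>)
    have "\<bar>compensator n x (\<lambda>_. 0) 0 \<omega> - (a * 0 + sqrt (real n) * g * outlier_drift)\<bar> \<le> remainder (b + 3) \<eta> \<omega>"
      by (rule compensator_expansion) (use b \<eta> elim in auto)
    then show ?case using abs_ge_zero order_trans by blast
  qed
  have R: "integrable M (remainder (b + 3) \<eta>)" "expectation (\<lambda>\<omega>. \<bar>remainder (b + 3) \<eta> \<omega>\<bar>) \<le> error_bound (b + 3) \<eta>"
  proof -
    show i: "integrable M (remainder (b + 3) \<eta>)" by (rule remainder_mean) (use b \<eta> in auto)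
    have "expectation (\<lambda>\<omega>. \<bar>remainder (b + 3) \<eta> \<omega>\<bar>) = expectation (remainder (b + 3) \<eta>)"
      by (rule integral_cong_AE) (use i R_nonneg in auto)
    also have "\<dots> \<le> error_bound (b + 3) \<eta>" by (rule remainder_mean) (use b \<eta> in auto)
    finally show "expectation (\<lambda>\<omega>. \<bar>remainder (b + 3) \<eta> \<omega>\<bar>) \<le> error_bound (b + 3) \<eta>" .
  qed
  have Ei: "integrable M (E \<tau> \<eta>)" "integrable M (E \<tau> (- \<eta>))"
    and Ee: "expectation (E \<tau> \<eta>) \<le> sqrt c" "expectation (E \<tau> (- \<eta>)) \<le> sqrt c" if "\<tau> \<in> S" for \<tau>
    using E[OF that, of \<eta>] E[OF that, of "- \<eta>"] \<eta> by auto
  have Si: "integrable M (\<lambda>\<omega>. \<Sum>\<tau>\<in>S. E \<tau> \<eta> \<omega> + E \<tau> (- \<eta>) \<omega>)"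
    by (intro Bochner_Integration.integrable_sum Bochner_Integration.integrable_add Ei)
  have Z: "integrable M Z"
    unfolding Z_def[abs_def] using Si R(1) by simp
  have EZ: "expectation Z \<le> 2 * real (card S) * sqrt c + error_bound (b + 3) \<eta> + L * \<eta>"
  proof -
    have "expectation Z = expectation (\<lambda>\<omega>. \<Sum>\<tau>\<in>S. E \<tau> \<eta> \<omega> + E \<tau> (- \<eta>) \<omega>) + expectation (\<lambda>\<omega>. \<bar>remainder (b + 3) \<eta> \<omega>\<bar>) + L * \<eta>"
      unfolding Z_def[abs_def] using Si R(1) by (simp add: prob_space)
    also have "expectation (\<lambda>\<omega>. \<Sum>\<tau>\<in>S. E \<tau> \<eta> \<omega> + E \<tau> (- \<eta>) \<omega>) = (\<Sum>\<tau>\<in>S. expectation (E \<tau> \<eta>) + expectation (E \<tau> (- \<eta>)))"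
      using Ei by (subst Bochner_Integration.integral_sum) auto
    also have "\<dots> \<le> (\<Sum>\<tau>\<in>S. sqrt c + sqrt c)"
      by (intro sum_mono add_mono Ee)
    finally show ?thesis using R(2) by simp
  qed
  have [measurable]: "Z \<in> borel_measurable M" using Z by auto
  let ?F = "\<Union>j\<in>{..p}. {\<omega> \<in> space M. \<bar>\<sigma> j \<omega>\<bar> > b}"
  let ?B = "{\<omega> \<in> space M. Z \<omega> \<ge> \<delta>}"
  have [measurable]: "?F \<in> sets M" by (intro sets.finite_UN) auto
  have "AE \<omega> in M. \<omega> \<in> A \<longrightarrow> \<omega> \<in> ?F \<union> ?B"
    using AE_contamination_values A(2)
  proof eventually_elim
    case (elim \<omega>)
    have main: "\<bar>indicator_sum n x (\<lambda>j. \<sigma> j \<omega>) 0 \<omega> - (a * \<sigma> 0 \<omega> + D)\<bar> \<le> Z \<omega>" if small: "\<And>j. j \<le> p \<Longrightarrow> \<bar>\<sigma> j \<omega>\<bar> \<le> b"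
    proof -
      obtain \<tau> where \<tau>: "\<tau> \<in> S" "\<And>j. j \<le> p \<Longrightarrow> \<bar>\<sigma> j \<omega> - \<tau> j\<bar> \<le> \<eta>"
        using S_net[of "\<lambda>j. \<sigma> j \<omega>"] small by blast
      have up: "indicator_sum n x (\<lambda>j. \<sigma> j \<omega>) 0 \<omega> \<le> indicator_sum n x \<tau> \<eta> \<omega>"
        and low: "indicator_sum n x \<tau> (- \<eta>) \<omega> \<le> indicator_sum n x (\<lambda>j. \<sigma> j \<omega>) 0 \<omega>"
        by (rule indicator_sum_mono, rule threshold_shift_bracket, rule \<tau>(2), assumption)+
      have comp: "\<bar>compensator n x \<tau> \<kappa> \<omega> - (a * \<tau> 0 + D)\<bar> \<le> remainder (b + 3) \<eta> \<omega>" if "\<bar>\<kappa>\<bar> \<le> \<eta>" for \<kappa>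
        unfolding D_def by (rule compensator_expansion) (use \<tau>\<kappa>[OF \<tau>(1)] that elim(1) in auto)
      have a: "\<bar>a * \<sigma> 0 \<omega> - a * \<tau> 0\<bar> \<le> L * \<eta>"
      proof -
        have "\<bar>a * \<sigma> 0 \<omega> - a * \<tau> 0\<bar> = \<bar>a\<bar> * \<bar>\<sigma> 0 \<omega> - \<tau> 0\<bar>" by (simp add: abs_mult flip: right_diff_distrib)
        also have "\<dots> \<le> L * \<eta>" using slope \<tau>(2)[of 0] nonneg_constants by (intro mult_mono) auto
        finally show ?thesis .
      qed
      have E0: "0 \<le> E \<tau>' \<kappa> \<omega>" for \<tau>' \<kappa> by (simp add: E_def)
      have one: "E \<tau> \<eta> \<omega> + E \<tau> (- \<eta>) \<omega> \<le> (\<Sum>\<tau>\<in>S. E \<tau> \<eta> \<omega> + E \<tau> (- \<eta>) \<omega>)"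
        using \<open>finite S\<close> \<tau>(1) E0 by (intro member_le_sum[of \<tau> S "\<lambda>\<tau>. E \<tau> \<eta> \<omega> + E \<tau> (- \<eta>) \<omega>"]) auto
      have c1: "\<bar>compensator n x \<tau> \<eta> \<omega> - (a * \<tau> 0 + D)\<bar> \<le> remainder (b + 3) \<eta> \<omega>"
        and c2: "\<bar>compensator n x \<tau> (- \<eta>) \<omega> - (a * \<tau> 0 + D)\<bar> \<le> remainder (b + 3) \<eta> \<omega>"
        using comp[of \<eta>] comp[of "- \<eta>"] \<eta> by auto
      have e1: "indicator_sum n x \<tau> \<eta> \<omega> \<le> compensator n x \<tau> \<eta> \<omega> + E \<tau> \<eta> \<omega>"
        and e2: "compensator n x \<tau> (- \<eta>) \<omega> - E \<tau> (- \<eta>) \<omega> \<le> indicator_sum n x \<tau> (- \<eta>) \<omega>"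
        unfolding E_def by linarith+
      show ?thesis
        unfolding Z_def using up low c1 c2 a one e1 e2 E0[of \<tau> \<eta>] E0[of \<tau> "- \<eta>"] by linarith
    qed
    show ?case
    proof
      assume \<omega>A: "\<omega> \<in> A"
      then have \<omega>: "\<omega> \<in> space M" using A(1) by blast
      show "\<omega> \<in> ?F \<union> ?B"
      proof (cases "\<forall>j\<le>p. \<bar>\<sigma> j \<omega>\<bar> \<le> b")
        case True
        then have "\<not> (\<exists>j\<le>p. b < \<bar>\<sigma> j \<omega>\<bar>)" by (simp add: not_less)
        then have "\<delta> < \<bar>indicator_sum n x (\<lambda>j. \<sigma> j \<omega>) 0 \<omega> - (a * \<sigma> 0 \<omega> + D)\<bar>"
          using elim(2) \<omega>A unfolding D_def by blast
        also have "\<dots> \<le> Z \<omega>" by (rule main) (use True in blast)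
        finally show ?thesis using \<omega> by simp
      next
        case False
        then show ?thesis using \<omega> by (auto simp: not_le)
      qed
    qed
  qed
  then have "measure M A \<le> measure M (?F \<union> ?B)"
    by (rule finite_measure_mono_AE) measurable
  also have "\<dots> \<le> measure M ?F + measure M ?B"
    by (rule measure_Un_le) measurable
  also have "measure M ?F \<le> (\<Sum>j\<le>p. measure M {\<omega> \<in> space M. \<bar>\<sigma> j \<omega>\<bar> > b})"
    by (rule finite_measure_subadditive_finite) auto
  also have "measure M ?B \<le> expectation Z / \<delta>"
  proof (rule integral_Markov_inequality_measure[OF Z, of "{}"])
    show "AE \<omega> in M. 0 \<le> Z \<omega>"
      unfolding Z_def E_def using nonneg_constants \<eta>
      by (intro AE_I2 add_nonneg_nonneg sum_nonneg mult_nonneg_nonneg) auto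
  qed (use \<delta> in auto)
  also have "expectation Z / \<delta> \<le> (2 * real (card S) * sqrt c + error_bound (b + 3) \<eta> + L * \<eta>) / \<delta>"
    using EZ \<delta> by (intro divide_right_mono) auto
  finally show ?thesis by (simp add: D_def c_def)
qed

end

section \<open>Estimated parameters\<close>

context threshold_model
begin

text \<open>
  With both contamination rates of order \<open>1 / sqrt n\<close>, all contributions vanish as \<open>n\<close> grows, except the
  one of the mesh \<open>\<eta>\<close>. The bounds \<open>lv\<close> and \<open>sb\<close> serve all models of the neighbourhood at once.
\<close>
lemma error_bound_rate:
  fixes \<Gamma> R lv sb B \<eta> :: real
  assumes g: "g \<le> \<Gamma> / sqrt (real n)" and r: "r \<le> R / sqrt (real n)"
    and lv: "lp_var \<le> lv" and sb: "size_bound \<le> sb" and B: "0 \<le> B" and \<eta>: "0 \<le> \<eta>"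
  shows "error_bound B \<eta> \<le>
     (C * B\<^sup>2 * sb + real (p + 1) * \<Gamma> * (2 * L * B * sb + 2 * R) + 2 * (real (p + 1) * real p * \<Gamma>\<^sup>2)
        + L * B * (real p * sqrt lv)) * (1 / sqrt (real n))
     + real (p + 1) * \<Gamma> * (real (p + 1) * truncated_outlier_mean B)
     + real (p + 1) * sqrt (\<Gamma> * (1 / sqrt (real n))) + L * \<eta> * sb"
proof -
  define q where "q = 1 / sqrt (real n)"
  define P where "P = real (p + 1)"
  define w where "w = truncated_outlier_mean B"
  have q: "0 < q" using n by (simp add: q_def)
  have sq: "sqrt (real n) * q = 1" using n by (simp add: q_def)
  have qq: "1 / real n = q * q" using n by (simp add: q_def)
  have P: "0 \<le> P" by (simp add: P_def)
  have w: "0 \<le> w" unfolding w_def truncated_outlier_mean_def by (rule integral_nonneg_AE) simp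
  have g': "0 \<le> g" "g \<le> \<Gamma> * q" using g contamination_prob_range by (auto simp: q_def)
  have r': "0 \<le> r" "r \<le> R * q" using r nonneg_constants by (auto simp: q_def)
  have sb0: "0 \<le> size_bound" using lp_var_nonneg by (simp add: size_bound_def)
  have \<Gamma>: "0 \<le> \<Gamma>" using g' q by (smt (verit) mult_neg_pos)
  have L: "0 \<le> L" by (rule nonneg_constants)
  have g2: "g\<^sup>2 \<le> (\<Gamma> * q)\<^sup>2" using g' by (intro power_mono)
  have inner: "2 * L * B / sqrt (real n) * size_bound + P * w + 2 * r \<le> (2 * L * B * sb + 2 * R) * q + P * w"
  proof -
    have "2 * L * B / sqrt (real n) * size_bound \<le> 2 * L * B * q * sb"
      using L B q sb by (auto simp: q_def intro!: mult_left_mono divide_right_mono)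
    then show ?thesis using r' by (simp add: algebra_simps)
  qed
  have inner0: "0 \<le> 2 * L * B / sqrt (real n) * size_bound + P * w + 2 * r"
    using L B sb0 P w r' by (intro add_nonneg_nonneg mult_nonneg_nonneg divide_nonneg_nonneg) auto
  have t1: "sqrt (real n) * (C * B\<^sup>2 * size_bound / real n) \<le> C * B\<^sup>2 * sb * q"
  proof -
    have "sqrt (real n) * (C * B\<^sup>2 * size_bound / real n) = C * B\<^sup>2 * size_bound * (sqrt (real n) * (1 / real n))" by simp
    also have "sqrt (real n) * (1 / real n) = q" unfolding qq using sq by (simp flip: mult.assoc)
    also have "C * B\<^sup>2 * size_bound * q \<le> C * B\<^sup>2 * sb * q"
      using C_nonneg sb q by (intro mult_right_mono mult_left_mono) auto
    finally show ?thesis .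
  qed
  have t2: "sqrt (real n) * (P * g * (2 * L * B / sqrt (real n) * size_bound + P * w + 2 * r))
      \<le> P * \<Gamma> * ((2 * L * B * sb + 2 * R) * q + P * w)"
  proof -
    have "P * g * (2 * L * B / sqrt (real n) * size_bound + P * w + 2 * r)
        \<le> P * (\<Gamma> * q) * ((2 * L * B * sb + 2 * R) * q + P * w)"
      using g' P \<Gamma> q inner inner0 by (intro mult_mono mult_left_mono) auto
    then have "sqrt (real n) * (P * g * (2 * L * B / sqrt (real n) * size_bound + P * w + 2 * r))
        \<le> sqrt (real n) * (P * (\<Gamma> * q) * ((2 * L * B * sb + 2 * R) * q + P * w))"
      by (rule mult_left_mono) simp
    also have "\<dots> = (sqrt (real n) * q) * (P * \<Gamma> * ((2 * L * B * sb + 2 * R) * q + P * w))"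
      by (simp only: mult_ac)
    finally show ?thesis by (simp only: sq mult_1)
  qed
  have t3: "sqrt (real n) * (2 * (P * real p * g\<^sup>2)) \<le> 2 * (P * real p * \<Gamma>\<^sup>2) * q"
  proof -
    have "sqrt (real n) * (2 * (P * real p * g\<^sup>2)) \<le> sqrt (real n) * (2 * (P * real p * (\<Gamma> * q)\<^sup>2))"
      using g2 P by (intro mult_left_mono) auto
    also have "\<dots> = (sqrt (real n) * q) * (2 * (P * real p * \<Gamma>\<^sup>2) * q)"
      by (simp only: power2_eq_square mult_ac)
    finally show ?thesis by (simp only: sq mult_1)
  qed
  have t4: "L * B * (real p * sqrt (lp_var / real n)) \<le> L * B * (real p * sqrt lv) * q"
  proof -
    have "sqrt (lp_var / real n) \<le> sqrt lv * q"
      unfolding q_def real_sqrt_divide using lv by (simp add: divide_right_mono)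
    then have "L * B * (real p * sqrt (lp_var / real n)) \<le> L * B * (real p * (sqrt lv * q))"
      using L B by (intro mult_left_mono) auto
    then show ?thesis by (simp only: mult.assoc)
  qed
  have t5: "L * \<eta> * size_bound \<le> L * \<eta> * sb" using L \<eta> sb by (intro mult_left_mono) auto
  have t6: "P * sqrt g \<le> P * sqrt (\<Gamma> * q)" using g' P by (intro mult_left_mono) auto
  have "error_bound B \<eta> = sqrt (real n) * (C * B\<^sup>2 * size_bound / real n)
      + sqrt (real n) * (P * g * (2 * L * B / sqrt (real n) * size_bound + P * w + 2 * r))
      + sqrt (real n) * (2 * (P * real p * g\<^sup>2))
      + L * B * (real p * sqrt (lp_var / real n)) + L * \<eta> * size_bound + P * sqrt g"
    unfolding error_bound_def P_def w_def by (simp only: distrib_left)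
  also have "\<dots> \<le> C * B\<^sup>2 * sb * q + P * \<Gamma> * ((2 * L * B * sb + 2 * R) * q + P * w)
      + 2 * (P * real p * \<Gamma>\<^sup>2) * q + L * B * (real p * sqrt lv) * q + L * \<eta> * sb + P * sqrt (\<Gamma> * q)"
    by (intro add_mono t1 t2 t3 t4 t5 t6)
  also have "\<dots> = (C * B\<^sup>2 * sb + P * \<Gamma> * (2 * L * B * sb + 2 * R) + 2 * (P * real p * \<Gamma>\<^sup>2)
        + L * B * (real p * sqrt lv)) * q + P * \<Gamma> * (P * w) + P * sqrt (\<Gamma> * q) + L * \<eta> * sb"
    by (simp add: algebra_simps)
  finally show ?thesis unfolding q_def P_def w_def .
qed

end

context contaminated_ar
begin

text \<open>
  Index \<open>0\<close> belongs to the constant regressor: its coefficient combines the errors of \<open>m\<close> in the residual's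
  own observation and in the \<open>p\<close> lagged ones.
\<close>
definition local_parameter :: "nat \<Rightarrow> real \<Rightarrow> real \<Rightarrow> (nat \<Rightarrow> real) \<Rightarrow> nat \<Rightarrow> real" where
  "local_parameter n \<mu> m b j =
     (if j = 0 then (1 - (\<Sum>j=1..p. b j)) * (sqrt (real n) * (m - \<mu>)) else sqrt (real n) * (b j - \<beta> j))"

text \<open>
  In the residual, the autoregression cancels the part that belongs to the true parameters and
  leaves the innovation minus the threshold shift at the local parameter.
\<close>
lemma edf_difference_eq_indicator_sum:
  assumes mu: "\<nu> = (1 - (\<Sum>j=1..p. \<beta> j)) * \<mu>" and n: "1 \<le> n"
  shows "AE \<omega> in M. \<forall>m b. sqrt (real n) * (edf n (residual p m b (observations p n v z \<xi> \<omega>)) x - edf n (\<lambda>t. \<epsilon> t \<omega>) x)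
    = indicator_sum n x (local_parameter n \<mu> m b) 0 \<omega>"
proof -
  have lp: "AE \<omega> in M. \<forall>t. v t \<omega> - \<mu> = linear_process t \<omega>"
    unfolding AE_all_countable using stationary_solution_is_linear_process[OF mu] by blast
  have ar: "AE \<omega> in M. \<forall>t. v t \<omega> = (\<Sum>j=1..p. \<beta> j * v (t - int j) \<omega>) + \<nu> + \<epsilon> t \<omega>"
    unfolding AE_all_countable using v_ar by blast
  show ?thesis
    using lp ar
  proof eventually_elim
    case (elim \<omega>)
    show ?case
    proof (intro allI)
      fix m and b :: "nat \<Rightarrow> real"
      let ?y = "observations p n v z \<xi> \<omega>" and ?\<tau> = "local_parameter n \<mu> m b"
      have res: "residual p m b ?y t = \<epsilon> t \<omega> - threshold_shift n ?\<tau> 0 t \<omega>" if t: "t \<in> {1..int n}" for t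
      proof -
        have y: "?y (t - int j) = v (t - int j) \<omega> + z (t - int j) \<omega> * \<xi> (t - int j) \<omega>" if "j \<le> p" for j
          using t that by (simp add: observations_def obs_times_def)
        define X where "X j = z (t - int j) \<omega> * \<xi> (t - int j) \<omega>" for j
        define u where "u j = v (t - int j) \<omega> - \<mu>" for j
        have ar_u: "u 0 - (\<Sum>j=1..p. \<beta> j * u j) = \<epsilon> t \<omega>"
        proof -
          have "(\<Sum>j=1..p. \<beta> j * u j) = (\<Sum>j=1..p. \<beta> j * v (t - int j) \<omega>) - (\<Sum>j=1..p. \<beta> j) * \<mu>"
            by (simp add: u_def right_diff_distrib sum_subtractf sum_distrib_right)
          then show ?thesis using elim(2)[rule_format, of t] mu by (simp add: u_def algebra_simps)
        qed
        have "residual p m b ?y t = (u 0 + X 0 - (m - \<mu>)) - (\<Sum>j=1..p. b j * (u j + X j - (m - \<mu>)))"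
        proof -
          have "(\<Sum>j=1..p. b j * (?y (t - int j) - m)) = (\<Sum>j=1..p. b j * (u j + X j - (m - \<mu>)))"
            by (intro sum.cong refl) (simp add: y u_def X_def)
          then show ?thesis using y[of 0] by (simp add: residual_def u_def X_def)
        qed
        also have "(\<Sum>j=1..p. b j * (u j + X j - (m - \<mu>)))
            = (\<Sum>j=1..p. \<beta> j * u j) + (\<Sum>j=1..p. \<beta> j * X j) + (\<Sum>j=1..p. (b j - \<beta> j) * (u j + X j)) - (\<Sum>j=1..p. b j) * (m - \<mu>)"
          unfolding sum_distrib_right sum.distrib[symmetric] sum_subtractf[symmetric]
          by (rule sum.cong) (simp_all add: algebra_simps)
        finally have r: "residual p m b ?y t = \<epsilon> t \<omega> - (- X 0 + (\<Sum>j=1..p. \<beta> j * X j)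
            + (1 - (\<Sum>j=1..p. b j)) * (m - \<mu>) + (\<Sum>j=1..p. (b j - \<beta> j) * (u j + X j)))"
          using ar_u by (simp add: algebra_simps)
        have out: "(\<Sum>j\<le>p. outlier_coeff j * (z (t - int j) \<omega> * \<xi> (t - int j) \<omega>)) = - X 0 + (\<Sum>j=1..p. \<beta> j * X j)"
          by (simp add: atMost_atLeast0 sum.atLeast_Suc_atMost outlier_coeff_def X_def)
        have "(\<Sum>j\<le>p. ?\<tau> j * regressor t j \<omega>)
            = ?\<tau> 0 * regressor t 0 \<omega> + (\<Sum>j=1..p. ?\<tau> j * regressor t j \<omega>)"
          by (simp add: atMost_atLeast0 sum.atLeast_Suc_atMost)
        also have "(\<Sum>j=1..p. ?\<tau> j * regressor t j \<omega>) = (\<Sum>j=1..p. sqrt (real n) * ((b j - \<beta> j) * (u j + X j)))"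
          using elim(1) by (intro sum.cong refl) (auto simp: local_parameter_def regressor_def clean_regressor_def u_def X_def)
        also have "\<dots> = sqrt (real n) * (\<Sum>j=1..p. (b j - \<beta> j) * (u j + X j))"
          by (rule sum_distrib_left[symmetric])
        also have "?\<tau> 0 * regressor t 0 \<omega> = sqrt (real n) * ((1 - (\<Sum>j=1..p. b j)) * (m - \<mu>))"
          by (simp add: local_parameter_def regressor_def clean_regressor_def)
        finally have "(\<Sum>j\<le>p. ?\<tau> j * regressor t j \<omega>)
            = sqrt (real n) * ((1 - (\<Sum>j=1..p. b j)) * (m - \<mu>) + (\<Sum>j=1..p. (b j - \<beta> j) * (u j + X j)))"
          by (simp only: distrib_left)
        then have "1 / sqrt (real n) * (\<Sum>j\<le>p. ?\<tau> j * regressor t j \<omega>)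
            = (1 - (\<Sum>j=1..p. b j)) * (m - \<mu>) + (\<Sum>j=1..p. (b j - \<beta> j) * (u j + X j))"
          using n by simp
        then show ?thesis unfolding r threshold_shift_def out by simp
      qed
      have ind: "(indicator {..x} (residual p m b ?y t) :: real) = indicator {..x + threshold_shift n ?\<tau> 0 t \<omega>} (\<epsilon> t \<omega>)"
        if "t \<in> {1..int n}" for t
        unfolding res[OF that] by (auto simp: indicator_def)
      have "edf n (residual p m b ?y) x - edf n (\<lambda>t. \<epsilon> t \<omega>) x
          = (\<Sum>t=1..int n. indicator {..x + threshold_shift n ?\<tau> 0 t \<omega>} (\<epsilon> t \<omega>) - indicator {..x} (\<epsilon> t \<omega>)) / real n"
        unfolding edf_def by (simp add: ind sum_subtractf diff_divide_distrib)
      moreover have "sqrt (real n) * (y / real n) = y / sqrt (real n)" for y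
        by (metis of_nat_0_le_iff real_divide_square_eq real_sqrt_mult_self abs_of_nonneg times_divide_eq_right mult.commute)
      ultimately show "sqrt (real n) * (edf n (residual p m b ?y) x - edf n (\<lambda>t. \<epsilon> t \<omega>) x) = indicator_sum n x ?\<tau> 0 \<omega>"
        by (simp add: indicator_sum_def)
    qed
  qed
qed

lemma measurable_observations:
  "(\<lambda>\<omega>. observations p n v z \<xi> \<omega>) \<in> M \<rightarrow>\<^sub>M (\<Pi>\<^sub>M t\<in>obs_times p n. borel)"
  unfolding observations_def[abs_def] using v_measurable by (intro measurable_restrict) simp

end

lemma finite_parameter_grid:
  fixes b \<eta> :: real and p :: nat
  assumes b: "0 \<le> b" and \<eta>: "0 < \<eta>" "\<eta> \<le> 1"
  obtains S :: "(nat \<Rightarrow> real) set" where "finite S" "\<And>\<tau> j. \<tau> \<in> S \<Longrightarrow> j \<le> p \<Longrightarrow> \<bar>\<tau> j\<bar> \<le> b + 2"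
    "\<And>s. (\<And>j. j \<le> p \<Longrightarrow> \<bar>s j\<bar> \<le> b) \<Longrightarrow> \<exists>\<tau>\<in>S. \<forall>j\<le>p. \<bar>s j - \<tau> j\<bar> \<le> \<eta>"
proof
  define m where "m = \<lceil>b / \<eta>\<rceil>"
  define S where "S = PiE {..p} (\<lambda>_. (\<lambda>i. \<eta> * real_of_int i) ` {- m..m})"
  show "finite S" unfolding S_def by (intro finite_PiE) auto
  have m: "\<eta> * real_of_int m \<le> b + 1"
  proof -
    have "real_of_int m \<le> b / \<eta> + 1" unfolding m_def by (rule of_int_ceiling_le_add_one)
    then have "\<eta> * real_of_int m \<le> \<eta> * (b / \<eta> + 1)" using \<eta> by (intro mult_left_mono) auto
    also have "\<dots> = b + \<eta>" using \<eta> by (simp add: distrib_left)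
    finally show ?thesis using \<eta> by simp
  qed
  show "\<bar>\<tau> j\<bar> \<le> b + 2" if \<tau>: "\<tau> \<in> S" "j \<le> p" for \<tau> j
  proof -
    have "\<tau> j \<in> (\<lambda>i. \<eta> * real_of_int i) ` {- m..m}"
      using \<tau> unfolding S_def by (auto simp: PiE_def Pi_def)
    then obtain i where i: "- m \<le> i" "i \<le> m" "\<tau> j = \<eta> * real_of_int i" by auto
    have "\<bar>real_of_int i\<bar> \<le> real_of_int m" using i by linarith
    then have "\<eta> * \<bar>real_of_int i\<bar> \<le> \<eta> * real_of_int m" using \<eta> by (intro mult_left_mono) auto
    moreover have "\<bar>\<tau> j\<bar> = \<eta> * \<bar>real_of_int i\<bar>" using i \<eta> by (simp add: abs_mult)
    ultimately show ?thesis using m by linarith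
  qed
  fix s :: "nat \<Rightarrow> real" assume s: "\<And>j. j \<le> p \<Longrightarrow> \<bar>s j\<bar> \<le> b"
  define \<tau> where "\<tau> = (\<lambda>j\<in>{..p}. \<eta> * real_of_int \<lfloor>s j / \<eta>\<rfloor>)"
  have "- m \<le> \<lfloor>s j / \<eta>\<rfloor> \<and> \<lfloor>s j / \<eta>\<rfloor> \<le> m" if "j \<le> p" for j
  proof
    have "- (b / \<eta>) \<le> s j / \<eta>" "s j / \<eta> \<le> b / \<eta>"
      using s[OF that] \<eta> by (auto simp: field_simps abs_le_iff)
    then show "- m \<le> \<lfloor>s j / \<eta>\<rfloor>" "\<lfloor>s j / \<eta>\<rfloor> \<le> m"
      unfolding m_def ceiling_def by (auto intro: floor_mono) linarith+
  qed
  then have "\<tau> \<in> S" unfolding S_def \<tau>_def by auto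
  moreover have "\<bar>s j - \<tau> j\<bar> \<le> \<eta>" if "j \<le> p" for j
  proof -
    have "s j - \<eta> * real_of_int \<lfloor>s j / \<eta>\<rfloor> = \<eta> * (s j / \<eta> - real_of_int \<lfloor>s j / \<eta>\<rfloor>)"
      using \<eta> by (simp add: right_diff_distrib)
    moreover have "0 \<le> s j / \<eta> - real_of_int \<lfloor>s j / \<eta>\<rfloor>" "s j / \<eta> - real_of_int \<lfloor>s j / \<eta>\<rfloor> \<le> 1"
      by linarith+
    ultimately show ?thesis using that \<eta> by (simp add: \<tau>_def abs_mult)
  qed
  ultimately show "\<exists>\<tau>\<in>S. \<forall>j\<le>p. \<bar>s j - \<tau> j\<bar> \<le> \<eta>" by blast
qed

text \<open>
  If both normalized estimation errors are at most \<open>K\<close>, then every coordinate of the local parameter is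
  at most \<open>b\<close>; the quadratic term in \<open>K\<close> comes from coordinate \<open>0\<close>, where both errors are multiplied. Half of
  \<open>\<delta>\<close> is spent on replacing the slope \<open>a\<close> by \<open>s\<close>.
\<close>
lemma (in threshold_model) residual_edf_bound:
  fixes mh :: "'a \<Rightarrow> real" and bh :: "nat \<Rightarrow> 'a \<Rightarrow> real" and S :: "(nat \<Rightarrow> real) set" and K b \<mu> s \<eta> \<delta> :: real
  assumes b_def: "b = K + (\<bar>1 - (\<Sum>j=1..p. \<beta> j)\<bar> + real p * K) * K"
    and mu: "\<nu> = (1 - (\<Sum>j=1..p. \<beta> j)) * \<mu>"
    and mh[measurable]: "random_variable borel mh"
    and bh[measurable]: "\<And>j. j \<in> {1..p} \<Longrightarrow> random_variable borel (bh j)"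
    and K: "0 \<le> K"
    and S: "finite S" "\<And>\<tau> j. \<tau> \<in> S \<Longrightarrow> j \<le> p \<Longrightarrow> \<bar>\<tau> j\<bar> \<le> b + 2"
    "\<And>s. (\<And>j. j \<le> p \<Longrightarrow> \<bar>s j\<bar> \<le> b) \<Longrightarrow> \<exists>\<tau>\<in>S. \<forall>j\<le>p. \<bar>s j - \<tau> j\<bar> \<le> \<eta>"
    and \<eta>: "0 < \<eta>" "\<eta> \<le> 1" and \<delta>: "0 < \<delta>"
    and s: "\<bar>a - s\<bar> * b \<le> \<delta> / 2"
  shows "measure M {\<omega> \<in> space M.
      \<bar>sqrt (real n) * (edf n (residual p (mh \<omega>) (\<lambda>j. bh j \<omega>) (observations p n v z \<xi> \<omega>)) x - edf n (\<lambda>t. \<epsilon> t \<omega>) x)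
       - s * (1 - (\<Sum>j=1..p. bh j \<omega>)) * (sqrt (real n) * (mh \<omega> - \<mu>)) - sqrt (real n) * g * outlier_drift\<bar> > \<delta>}
    \<le> real (p + 1) * (measure M {\<omega> \<in> space M. \<bar>sqrt (real n) * (mh \<omega> - \<mu>)\<bar> > K}
        + measure M {\<omega> \<in> space M. \<bar>sqrt (real n) * L2_set (\<lambda>j. bh j \<omega> - \<beta> j) {1..p}\<bar> > K})
      + (2 * real (card S) * sqrt (real (p + 1) * g + L * (b + 3) * size_bound / sqrt (real n))
         + error_bound (b + 3) \<eta> + L * \<eta>) / (\<delta> / 2)"
proof -
  define \<sigma> where "\<sigma> j \<omega> = local_parameter n \<mu> (mh \<omega>) (\<lambda>j. bh j \<omega>) j" for j \<omega>
  let ?F1 = "{\<omega> \<in> space M. \<bar>sqrt (real n) * (mh \<omega> - \<mu>)\<bar> > K}"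
  let ?F2 = "{\<omega> \<in> space M. \<bar>sqrt (real n) * L2_set (\<lambda>j. bh j \<omega> - \<beta> j) {1..p}\<bar> > K}"
  let ?A = "{\<omega> \<in> space M.
      \<bar>sqrt (real n) * (edf n (residual p (mh \<omega>) (\<lambda>j. bh j \<omega>) (observations p n v z \<xi> \<omega>)) x - edf n (\<lambda>t. \<epsilon> t \<omega>) x)
       - s * (1 - (\<Sum>j=1..p. bh j \<omega>)) * (sqrt (real n) * (mh \<omega> - \<mu>)) - sqrt (real n) * g * outlier_drift\<bar> > \<delta>}"
  have b0: "0 \<le> b" using K by (simp add: b_def)
  have \<sigma>m[measurable]: "random_variable borel (\<sigma> j)" if "j \<le> p" for j
    using that unfolding \<sigma>_def local_parameter_def by (cases "j = 0") auto
  have F1[measurable]: "?F1 \<in> sets M" by measurable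
  have [measurable]: "random_variable borel (\<lambda>\<omega>. L2_set (\<lambda>j. bh j \<omega> - \<beta> j) {1..p})"
    unfolding L2_set_def by measurable
  have F2[measurable]: "?F2 \<in> sets M" by measurable
  have small: "\<bar>\<sigma> j \<omega>\<bar> \<le> b" if j: "j \<le> p" and k1: "\<bar>sqrt (real n) * (mh \<omega> - \<mu>)\<bar> \<le> K"
    and k2: "\<bar>sqrt (real n) * L2_set (\<lambda>j. bh j \<omega> - \<beta> j) {1..p}\<bar> \<le> K" for j \<omega>
  proof -
    have le: "sqrt (real n) * \<bar>bh i \<omega> - \<beta> i\<bar> \<le> K" if "i \<in> {1..p}" for i
    proof -
      have "\<bar>bh i \<omega> - \<beta> i\<bar> \<le> L2_set (\<lambda>j. bh j \<omega> - \<beta> j) {1..p}"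
        using member_le_L2_set[of "{1..p}" i "\<lambda>j. \<bar>bh j \<omega> - \<beta> j\<bar>"] that by (simp add: L2_set_def)
      then have "sqrt (real n) * \<bar>bh i \<omega> - \<beta> i\<bar> \<le> sqrt (real n) * L2_set (\<lambda>j. bh j \<omega> - \<beta> j) {1..p}"
        by (rule mult_left_mono) simp
      then show ?thesis using k2 by linarith
    qed
    have n1: "1 \<le> sqrt (real n)" using n by simp
    show ?thesis
    proof (cases "j = 0")
      case False
      then have "\<bar>\<sigma> j \<omega>\<bar> \<le> K" using le[of j] j by (simp add: \<sigma>_def local_parameter_def abs_mult)
      also have "K \<le> b" using K by (simp add: b_def)
      finally show ?thesis .
    next
      case True
      have "\<bar>bh i \<omega> - \<beta> i\<bar> \<le> K" if "i \<in> {1..p}" for i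
      proof -
        have "\<bar>bh i \<omega> - \<beta> i\<bar> \<le> sqrt (real n) * \<bar>bh i \<omega> - \<beta> i\<bar>"
          using mult_right_mono[OF n1, of "\<bar>bh i \<omega> - \<beta> i\<bar>"] by simp
        then show ?thesis using le[OF that] by (rule order_trans)
      qed
      then have "\<bar>\<Sum>i=1..p. bh i \<omega> - \<beta> i\<bar> \<le> (\<Sum>i=1..p. K)"
        by (intro order_trans[OF sum_abs sum_mono]) auto
      then have "\<bar>1 - (\<Sum>i=1..p. bh i \<omega>)\<bar> \<le> \<bar>1 - (\<Sum>i=1..p. \<beta> i)\<bar> + real p * K"
        by (simp add: sum_subtractf)
      then have "\<bar>1 - (\<Sum>i=1..p. bh i \<omega>)\<bar> * \<bar>sqrt (real n) * (mh \<omega> - \<mu>)\<bar> \<le> (\<bar>1 - (\<Sum>i=1..p. \<beta> i)\<bar> + real p * K) * K"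
        using k1 K by (intro mult_mono) auto
      then have "\<bar>\<sigma> j \<omega>\<bar> \<le> (\<bar>1 - (\<Sum>i=1..p. \<beta> i)\<bar> + real p * K) * K"
        using True by (simp add: \<sigma>_def local_parameter_def abs_mult)
      then show ?thesis using K by (simp add: b_def)
    qed
  qed
  have tail: "measure M {\<omega> \<in> space M. \<bar>\<sigma> j \<omega>\<bar> > b} \<le> measure M ?F1 + measure M ?F2" if "j \<le> p" for j
  proof -
    have "measure M {\<omega> \<in> space M. \<bar>\<sigma> j \<omega>\<bar> > b} \<le> measure M (?F1 \<union> ?F2)"
    proof (rule finite_measure_mono)
      show "{\<omega> \<in> space M. \<bar>\<sigma> j \<omega>\<bar> > b} \<subseteq> ?F1 \<union> ?F2"
        using small[OF that] by (auto simp: not_le[symmetric])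
    qed measurable
    also have "\<dots> \<le> measure M ?F1 + measure M ?F2" by (rule measure_Un_le[OF F1 F2])
    finally show ?thesis .
  qed
  have "measure M ?A \<le> (\<Sum>j\<le>p. measure M {\<omega> \<in> space M. \<bar>\<sigma> j \<omega>\<bar> > b})
      + (2 * real (card S) * sqrt (real (p + 1) * g + L * (b + 3) * size_bound / sqrt (real n))
         + error_bound (b + 3) \<eta> + L * \<eta>) / (\<delta> / 2)"
  proof (rule plug_in_bound)
    show "\<exists>\<tau>\<in>S. \<forall>j\<le>p. \<bar>s j - \<tau> j\<bar> \<le> \<eta>" if "\<And>j. j \<le> p \<Longrightarrow> \<bar>s j\<bar> \<le> b" for s
      using S(3) that by blast
    show "AE \<omega> in M. \<omega> \<in> ?A \<longrightarrow> (\<exists>j\<le>p. b < \<bar>\<sigma> j \<omega>\<bar>) \<or>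
      \<delta> / 2 < \<bar>indicator_sum n x (\<lambda>j. \<sigma> j \<omega>) 0 \<omega> - (a * \<sigma> 0 \<omega> + sqrt (real n) * g * outlier_drift)\<bar>"
      using edf_difference_eq_indicator_sum[OF mu n, of x]
    proof eventually_elim
      case (elim \<omega>)
      have I: "sqrt (real n) * (edf n (residual p (mh \<omega>) (\<lambda>j. bh j \<omega>) (observations p n v z \<xi> \<omega>)) x - edf n (\<lambda>t. \<epsilon> t \<omega>) x)
          = indicator_sum n x (\<lambda>j. \<sigma> j \<omega>) 0 \<omega>"
        using elim[rule_format, of "mh \<omega>" "\<lambda>j. bh j \<omega>"] by (simp add: \<sigma>_def)
      have s0: "s * (1 - (\<Sum>j=1..p. bh j \<omega>)) * (sqrt (real n) * (mh \<omega> - \<mu>)) = s * \<sigma> 0 \<omega>"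
        by (simp add: \<sigma>_def local_parameter_def)
      show ?case
      proof (intro impI disjCI)
        assume A: "\<omega> \<in> ?A"
        assume "\<not> \<delta> / 2 < \<bar>indicator_sum n x (\<lambda>j. \<sigma> j \<omega>) 0 \<omega> - (a * \<sigma> 0 \<omega> + sqrt (real n) * g * outlier_drift)\<bar>"
        then have "\<delta> / 2 < \<bar>a * \<sigma> 0 \<omega> - s * \<sigma> 0 \<omega>\<bar>"
          using A unfolding mem_Collect_eq I s0 by linarith
        also have "\<dots> = \<bar>a - s\<bar> * \<bar>\<sigma> 0 \<omega>\<bar>" by (simp add: abs_mult flip: left_diff_distrib)
        finally have "\<bar>a - s\<bar> * b < \<bar>a - s\<bar> * \<bar>\<sigma> 0 \<omega>\<bar>" using s by linarith
        then have "b < \<bar>\<sigma> 0 \<omega>\<bar>" by (simp add: mult_less_cancel_left)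
        then show "\<exists>j\<le>p. b < \<bar>\<sigma> j \<omega>\<bar>" by blast
      qed
    qed
  qed (use S(1,2) b0 \<eta> \<delta> in auto)
  also have "(\<Sum>j\<le>p. measure M {\<omega> \<in> space M. \<bar>\<sigma> j \<omega>\<bar> > b}) \<le> (\<Sum>j\<le>p. measure M ?F1 + measure M ?F2)"
    by (rule sum_mono, rule tail) simp
  finally show ?thesis by simp
qed

section \<open>Uniformity over the local parameters\<close>

lemma sup_prob_tendsto_0I:
  assumes R: "0 \<le> R" "0 \<le> \<Gamma>"
    and small: "\<And>e. 0 < e \<Longrightarrow> \<forall>\<^sub>F n in sequentially. \<forall>\<rho>\<in>{0..R}. \<forall>\<gamma>\<in>{0..\<Gamma>}.
      measure (M n \<rho> \<gamma>) {\<omega> \<in> space (M n \<rho> \<gamma>). \<bar>X n \<rho> \<gamma> \<omega>\<bar> > K} \<le> e"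
  shows "sup_prob R \<Gamma> M X K \<longlonglongrightarrow> 0"
proof (rule order_tendstoI)
  fix l :: ereal assume "l < 0"
  have "0 \<le> sup_prob R \<Gamma> M X K n" for n
    unfolding sup_prob_def using R by (intro SUP_upper2[of "(0, 0)"]) auto
  then show "\<forall>\<^sub>F n in sequentially. l < sup_prob R \<Gamma> M X K n"
    using \<open>l < 0\<close> by (intro always_eventually allI) (rule less_le_trans)
next
  fix u :: ereal assume "0 < u"
  then obtain e where e: "0 < ereal e" "ereal e < u" using ereal_dense2 by blast
  from small[of e] e show "\<forall>\<^sub>F n in sequentially. sup_prob R \<Gamma> M X K n < u"
  proof (simp, elim eventually_mono)
    fix n assume "\<forall>\<rho>\<in>{0..R}. \<forall>\<gamma>\<in>{0..\<Gamma>}. measure (M n \<rho> \<gamma>) {\<omega> \<in> space (M n \<rho> \<gamma>). \<bar>X n \<rho> \<gamma> \<omega>\<bar> > K} \<le> e"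
    then have "sup_prob R \<Gamma> M X K n \<le> ereal e"
      unfolding sup_prob_def by (intro SUP_least) auto
    then show "sup_prob R \<Gamma> M X K n < u" using e(2) by (rule le_less_trans)
  qed
qed

lemma unif_OP1D:
  assumes "unif_OP1 R \<Gamma> M X" and "0 < e"
  shows "\<forall>\<^sub>F K in at_top. \<forall>\<^sub>F n in sequentially. \<forall>\<rho>\<in>{0..R}. \<forall>\<gamma>\<in>{0..\<Gamma>}.
      measure (M n \<rho> \<gamma>) {\<omega> \<in> space (M n \<rho> \<gamma>). \<bar>X n \<rho> \<gamma> \<omega>\<bar> > K} \<le> e"
proof -
  have "\<forall>\<^sub>F K in at_top. limsup (sup_prob R \<Gamma> M X K) < ereal e"
    using assms unfolding unif_OP1_def by (intro order_tendstoD(2)) auto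
  then show ?thesis
  proof eventually_elim
    case (elim K)
    then have "\<forall>\<^sub>F n in sequentially. sup_prob R \<Gamma> M X K n < ereal e" by (rule Limsup_lessD)
    then show ?case
    proof eventually_elim
      case (elim n)
      show ?case
      proof (intro ballI)
        fix \<rho> \<gamma> assume "\<rho> \<in> {0..R}" "\<gamma> \<in> {0..\<Gamma>}"
        then have "ereal (measure (M n \<rho> \<gamma>) {\<omega> \<in> space (M n \<rho> \<gamma>). \<bar>X n \<rho> \<gamma> \<omega>\<bar> > K}) \<le> sup_prob R \<Gamma> M X K n"
          unfolding sup_prob_def by (intro SUP_upper2[of "(\<rho>, \<gamma>)"]) auto
        then have "ereal (measure (M n \<rho> \<gamma>) {\<omega> \<in> space (M n \<rho> \<gamma>). \<bar>X n \<rho> \<gamma> \<omega>\<bar> > K}) < ereal e"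
          using elim by (rule le_less_trans)
        then show "measure (M n \<rho> \<gamma>) {\<omega> \<in> space (M n \<rho> \<gamma>). \<bar>X n \<rho> \<gamma> \<omega>\<bar> > K} \<le> e" by simp
      qed
    qed
  qed
qed

lemma local_rate_bounds:
  assumes "0 \<le> c" "c \<le> C"
  shows "0 \<le> local_rate c n" "local_rate c n \<le> 1" "local_rate c n \<le> C / sqrt (real n)"
  using assms by (auto simp: local_rate_def min_le_iff_disj divide_right_mono)

theorem theorem2p1:
  fixes p :: nat and \<beta> :: "nat \<Rightarrow> real" and \<nu> \<mu> \<theta>\<^sub>0 :: real
    and H :: "real \<Rightarrow> real" and H_law Q :: "real measure"
    and M :: "nat \<Rightarrow> real \<Rightarrow> real \<Rightarrow> 'a measure"
    and \<epsilon> z \<xi> v :: "nat \<Rightarrow> real \<Rightarrow> real \<Rightarrow> int \<Rightarrow> 'a \<Rightarrow> real"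
    and \<mu>hat :: "nat \<Rightarrow> (int \<Rightarrow> real) \<Rightarrow> real"
    and \<beta>hat :: "nat \<Rightarrow> nat \<Rightarrow> (int \<Rightarrow> real) \<Rightarrow> real"
    and y :: "nat \<Rightarrow> real \<Rightarrow> real \<Rightarrow> 'a \<Rightarrow> int \<Rightarrow> real"
    and R \<Gamma> x \<delta> :: real
  assumes theta_pos: "\<theta>\<^sub>0 > 0"
    and mu: "\<nu> = (1 - (\<Sum>j=1..p. \<beta> j)) * \<mu>"
    and Q_law: "real_distribution Q"
    and H_distribution: "real_distribution H_law" "H = cdf H_law"
    and H_mean: "integrable H_law (\<lambda>u. u)" "(\<integral>u. u \<partial>H_law) = 0"
    and H_variance: "integrable H_law (\<lambda>u. u\<^sup>2)"
    and H_smooth: "\<And>u. H differentiable (at u)" "\<And>u. deriv H differentiable (at u)"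
      "bounded (range (deriv (deriv H)))"
    and model: "\<And>n \<rho> \<gamma>. 1 \<le> n \<Longrightarrow> 0 \<le> \<rho> \<Longrightarrow> 0 \<le> \<gamma> \<Longrightarrow>
      contaminated_ar (M n \<rho> \<gamma>) p \<beta> \<nu> (local_alternative \<theta>\<^sub>0 H \<rho> n) (local_rate \<gamma> n) Q
        (\<epsilon> n \<rho> \<gamma>) (z n \<rho> \<gamma>) (\<xi> n \<rho> \<gamma>) (v n \<rho> \<gamma>)"
    and y_def: "\<And>n \<rho> \<gamma>. y n \<rho> \<gamma> = observations p n (v n \<rho> \<gamma>) (z n \<rho> \<gamma>) (\<xi> n \<rho> \<gamma>)"
    and mu_estimator: "estimator p \<mu>hat"
    and beta_estimator: "\<And>j. j \<in> {1..p} \<Longrightarrow> estimator p (\<lambda>n. \<beta>hat n j)"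
    and mu_rate: "\<And>R \<Gamma>. 0 \<le> R \<Longrightarrow> 0 \<le> \<Gamma> \<Longrightarrow>
      unif_OP1 R \<Gamma> M (\<lambda>n \<rho> \<gamma> \<omega>. sqrt (real n) * (\<mu>hat n (y n \<rho> \<gamma> \<omega>) - \<mu>))"
    and beta_rate: "\<And>R \<Gamma>. 0 \<le> R \<Longrightarrow> 0 \<le> \<Gamma> \<Longrightarrow>
      unif_OP1 R \<Gamma> M (\<lambda>n \<rho> \<gamma> \<omega>.
        sqrt (real n) * L2_set (\<lambda>j. \<beta>hat n j (y n \<rho> \<gamma> \<omega>) - \<beta> j) {1..p})"
    and "0 \<le> R" "0 \<le> \<Gamma>" "\<delta> > 0"
  shows "sup_prob R \<Gamma> M
    (\<lambda>n \<rho> \<gamma> \<omega>.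
       let m = \<mu>hat n (y n \<rho> \<gamma> \<omega>);
           b = (\<lambda>j. \<beta>hat n j (y n \<rho> \<gamma> \<omega>));
           \<delta>hat = 1 - (\<Sum>j=1..p. b j);
           Ghat = edf n (residual p m b (y n \<rho> \<gamma> \<omega>));
           Gn = edf n (\<lambda>t. \<epsilon> n \<rho> \<gamma> t \<omega>)
       in sqrt (real n) * (Ghat x - Gn x)
          - 1 / \<theta>\<^sub>0 * std_normal_density (x / \<theta>\<^sub>0) * \<delta>hat * (sqrt (real n) * (m - \<mu>))
          - \<gamma> * Delta0 p \<beta> \<theta>\<^sub>0 Q x) \<delta> \<longlonglongrightarrow> 0"
proof (rule sup_prob_tendsto_0I[OF \<open>0 \<le> R\<close> \<open>0 \<le> \<Gamma>\<close>])
  let ?mu_tail = "\<lambda>K n \<rho> \<gamma>. measure (M n \<rho> \<gamma>) {\<omega> \<in> space (M n \<rho> \<gamma>). \<bar>sqrt (real n) * (\<mu>hat n (y n \<rho> \<gamma> \<omega>) - \<mu>)\<bar> > K}"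
  let ?beta_tail = "\<lambda>K n \<rho> \<gamma>. measure (M n \<rho> \<gamma>) {\<omega> \<in> space (M n \<rho> \<gamma>). \<bar>sqrt (real n) * L2_set (\<lambda>j. \<beta>hat n j (y n \<rho> \<gamma> \<omega>) - \<beta> j) {1..p}\<bar> > K}"
  fix e :: real assume e: "0 < e"
  interpret Q: real_distribution Q by (rule Q_law)
  interpret HL: real_distribution H_law by (rule H_distribution)
  define G0 where "G0 u = std_normal_cdf (u / \<theta>\<^sub>0)" for u
  define f where "f u = 1 / \<theta>\<^sub>0 * std_normal_density (u / \<theta>\<^sub>0)" for u
  obtain CH where CH: "\<bar>deriv (deriv H) u\<bar> \<le> CH" for u
    using H_smooth(3) by (auto simp: bounded_iff)
  define C where "C = max (1 / \<theta>\<^sub>0\<^sup>2) CH"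
  define L where "L = 1 + C"
  have dens_G0: "has_lipschitz_density G0 f C"
    unfolding G0_def[abs_def] f_def[abs_def] C_def
    by (rule has_lipschitz_density_mono[OF has_lipschitz_density_normal[OF theta_pos]]) simp
  have dens_H: "has_lipschitz_density H (deriv H) C"
    unfolding C_def by (rule has_lipschitz_density_mono[OF has_lipschitz_density_deriv[OF H_smooth(1,2) CH]]) simp
  have G0_range: "0 \<le> G0 u \<and> G0 u \<le> 1" for u
    by (simp add: G0_def std_normal_cdf_range)
  have H_range: "0 \<le> H u \<and> H u \<le> 1" for u
    unfolding H_distribution(2) by (simp add: HL.cdf_nonneg HL.cdf_bounded_prob)
  have C0: "0 \<le> C" by (rule lipschitz_density_const_nonneg[OF dens_H])
  have L0: "0 \<le> L" using C0 by (simp add: L_def)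
  have G0_meas: "G0 \<in> borel_measurable borel"
    by (rule borel_measurable_continuous_onI, rule continuous_at_imp_continuous_on)
       (use dens_G0 in \<open>auto simp: has_lipschitz_density_def intro: DERIV_isCont\<close>)
  define v2 where "v2 = \<theta>\<^sub>0\<^sup>2 + (\<integral>u. u\<^sup>2 \<partial>H_law)"
  define lv where "lv = (\<Sum>k. \<bar>ma_weight p \<beta> k\<bar>)\<^sup>2 * v2"
  define sb where "sb = real (p + 1) * (1 + real p * lv)"
  have v2: "0 \<le> v2" unfolding v2_def by (intro add_nonneg_nonneg integral_nonneg_AE) auto
  have lv: "0 \<le> lv" using v2 by (simp add: lv_def)
  have sb: "0 \<le> sb" using lv by (simp add: sb_def)

  \<comment> \<open>The truncation level for the normalized estimators is fixed first, then the mesh, then \<open>n\<close>.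
    The tails of the \<open>p + 1\<close> coordinates cost \<open>e / 4\<close> together, and \<open>\<eta>\<close> is such that the mesh costs less than \<open>e / 4\<close>.\<close>
  define e1 where "e1 = e / (8 * real (p + 1))"
  have e1: "0 < e1" using e by (simp add: e1_def)
  have ev: "\<forall>\<^sub>F K in at_top. 0 \<le> K \<and>
      (\<forall>\<^sub>F n in sequentially. \<forall>\<rho>\<in>{0..R}. \<forall>\<gamma>\<in>{0..\<Gamma>}.
        ?mu_tail K n \<rho> \<gamma> \<le> e1) \<and>
      (\<forall>\<^sub>F n in sequentially. \<forall>\<rho>\<in>{0..R}. \<forall>\<gamma>\<in>{0..\<Gamma>}.
        ?beta_tail K n \<rho> \<gamma> \<le> e1)"
    using unif_OP1D[OF mu_rate[OF \<open>0 \<le> R\<close> \<open>0 \<le> \<Gamma>\<close>] e1] unif_OP1D[OF beta_rate[OF \<open>0 \<le> R\<close> \<open>0 \<le> \<Gamma>\<close>] e1]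
      eventually_ge_at_top[of "0::real"]
    by eventually_elim simp
  obtain K where K: "0 \<le> K"
    and K1: "\<forall>\<^sub>F n in sequentially. \<forall>\<rho>\<in>{0..R}. \<forall>\<gamma>\<in>{0..\<Gamma>}.
        ?mu_tail K n \<rho> \<gamma> \<le> e1"
    and K2: "\<forall>\<^sub>F n in sequentially. \<forall>\<rho>\<in>{0..R}. \<forall>\<gamma>\<in>{0..\<Gamma>}.
        ?beta_tail K n \<rho> \<gamma> \<le> e1"
    using eventually_happens'[OF trivial_limit_at_top_linorder ev] by (elim exE conjE)
  define b where "b = K + (\<bar>1 - (\<Sum>j=1..p. \<beta> j)\<bar> + real p * K) * K"
  have b: "0 \<le> b" using K by (simp add: b_def)
  define \<eta> where "\<eta> = min 1 (\<delta> * e / (16 * (L * sb + L + 1)))"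
  have den: "0 < L * sb + L + 1" using L0 sb by (intro add_nonneg_pos add_nonneg_nonneg mult_nonneg_nonneg) auto
  have \<eta>: "0 < \<eta>" "\<eta> \<le> 1" using den e \<open>\<delta> > 0\<close> by (auto simp: \<eta>_def)
  have \<eta>_small: "(L * \<eta> * sb + L * \<eta>) / (\<delta> / 2) < e / 4"
  proof -
    have "L * \<eta> * sb + L * \<eta> \<le> (L * sb + L + 1) * \<eta>"
      using \<eta> by (simp add: algebra_simps)
    also have "\<dots> \<le> (L * sb + L + 1) * (\<delta> * e / (16 * (L * sb + L + 1)))"
      using den by (intro mult_left_mono) (auto simp: \<eta>_def)
    also have "\<dots> = \<delta> * e / 16"
    proof -
      have "c * (\<delta> * e / (16 * c)) = \<delta> * e / 16" if "0 < c" for c :: real using that by simp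
      then show ?thesis using den by blast
    qed
    finally have "(L * \<eta> * sb + L * \<eta>) / (\<delta> / 2) \<le> (\<delta> * e / 16) / (\<delta> / 2)"
      using \<open>\<delta> > 0\<close> by (intro divide_right_mono) auto
    also have "\<dots> = e / 8" using \<open>\<delta> > 0\<close> by simp
    also have "\<dots> < e / 4" using e by simp
    finally show ?thesis .
  qed
  obtain S :: "(nat \<Rightarrow> real) set" where S: "finite S" "\<And>\<tau> j. \<tau> \<in> S \<Longrightarrow> j \<le> p \<Longrightarrow> \<bar>\<tau> j\<bar> \<le> b + 2"
    "\<And>s. (\<And>j. j \<le> p \<Longrightarrow> \<bar>s j\<bar> \<le> b) \<Longrightarrow> \<exists>\<tau>\<in>S. \<forall>j\<le>p. \<bar>s j - \<tau> j\<bar> \<le> \<eta>"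
    using finite_parameter_grid[OF b \<eta>, of p] by blast

  define q where "q n = 1 / sqrt (real n)" for n
  have q: "q \<longlonglongrightarrow> 0"
    unfolding q_def[abs_def] by (rule tendsto_divide_0[OF tendsto_const]) (simp add: filterlim_compose[OF sqrt_at_top filterlim_real_sequentially] filterlim_at_top_imp_at_infinity)
  define w where "w n = (\<integral>u. min 1 \<bar>(L * (b + 3) / sqrt (real n)) * u\<bar> \<partial>Q)" for n
  have w: "w \<longlonglongrightarrow> 0"
    unfolding w_def[abs_def]
  proof (rule integral_min_one_scaled_tendsto_0[OF Q_law])
    have "(\<lambda>n. L * (b + 3) * q n) \<longlonglongrightarrow> L * (b + 3) * 0" by (intro tendsto_mult tendsto_const q)
    then show "(\<lambda>n. L * (b + 3) / sqrt (real n)) \<longlonglongrightarrow> 0" by (simp add: q_def)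
  qed
  define c1 where "c1 = C * (b + 3)\<^sup>2 * sb + real (p + 1) * \<Gamma> * (2 * L * (b + 3) * sb + 2 * R)
      + 2 * (real (p + 1) * real p * \<Gamma>\<^sup>2) + L * (b + 3) * (real p * sqrt lv)"
  define bound where "bound n = (2 * real (card S) * sqrt (real (p + 1) * (\<Gamma> * q n) + L * (b + 3) * sb * q n)
      + (c1 * q n + real (p + 1) * \<Gamma> * (real (p + 1) * w n) + real (p + 1) * sqrt (\<Gamma> * q n) + L * \<eta> * sb) + L * \<eta>) / (\<delta> / 2)" for n
  have "bound \<longlonglongrightarrow> (2 * real (card S) * sqrt (real (p + 1) * (\<Gamma> * 0) + L * (b + 3) * sb * 0)
      + (c1 * 0 + real (p + 1) * \<Gamma> * (real (p + 1) * 0) + real (p + 1) * sqrt (\<Gamma> * 0) + L * \<eta> * sb) + L * \<eta>) / (\<delta> / 2)"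
    unfolding bound_def[abs_def] using \<open>\<delta> > 0\<close> by (intro tendsto_intros q w) auto
  then have "bound \<longlonglongrightarrow> (L * \<eta> * sb + L * \<eta>) / (\<delta> / 2)" by simp
  then have N_bound: "\<forall>\<^sub>F n in sequentially. bound n < e / 4"
    using \<eta>_small by (rule order_tendstoD(2))
  have "(\<lambda>n. R * q n * (2 * L) * b) \<longlonglongrightarrow> R * 0 * (2 * L) * b" by (intro tendsto_intros q)
  then have N_slope: "\<forall>\<^sub>F n in sequentially. R * q n * (2 * L) * b < \<delta> / 2"
    using \<open>\<delta> > 0\<close> by (intro order_tendstoD(2)) auto
  have N_rate: "\<forall>\<^sub>F n in sequentially. \<Gamma> \<le> sqrt (real n)"
    using filterlim_compose[OF sqrt_at_top filterlim_real_sequentially] by (simp add: filterlim_at_top)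

  show "\<forall>\<^sub>F n in sequentially. \<forall>\<rho>\<in>{0..R}. \<forall>\<gamma>\<in>{0..\<Gamma>}.
      measure (M n \<rho> \<gamma>) {\<omega> \<in> space (M n \<rho> \<gamma>).
        \<bar>let m = \<mu>hat n (y n \<rho> \<gamma> \<omega>); b = (\<lambda>j. \<beta>hat n j (y n \<rho> \<gamma> \<omega>)); \<delta>hat = 1 - (\<Sum>j=1..p. b j);
           Ghat = edf n (residual p m b (y n \<rho> \<gamma> \<omega>)); Gn = edf n (\<lambda>t. \<epsilon> n \<rho> \<gamma> t \<omega>)
         in sqrt (real n) * (Ghat x - Gn x)
          - 1 / \<theta>\<^sub>0 * std_normal_density (x / \<theta>\<^sub>0) * \<delta>hat * (sqrt (real n) * (m - \<mu>))
          - \<gamma> * Delta0 p \<beta> \<theta>\<^sub>0 Q x\<bar> > \<delta>} \<le> e"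
    using K1 K2 N_bound N_slope N_rate eventually_ge_at_top[of "1::nat"]
  proof eventually_elim
    case (elim n)
    show ?case
    proof (intro ballI)
      fix \<rho> \<gamma> assume \<rho>: "\<rho> \<in> {0..R}" and \<gamma>: "\<gamma> \<in> {0..\<Gamma>}"
      have n: "1 \<le> n" using elim by simp
      then have n0: "0 < sqrt (real n)" by simp
      define r where "r = local_rate \<rho> n"
      define g where "g = local_rate \<gamma> n"
      have r: "0 \<le> r" "r \<le> 1" "r \<le> R / sqrt (real n)"
        unfolding r_def using \<rho> by (auto intro: local_rate_bounds)
      have g: "0 \<le> g" "g \<le> \<Gamma> / sqrt (real n)"
        unfolding g_def using \<gamma> by (auto intro: local_rate_bounds)
      define A where "A u = (1 - r) * G0 u + r * H u" for u
      define a where "a = (1 - r) * f x + r * deriv H x"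
      have A_eq: "local_alternative \<theta>\<^sub>0 H \<rho> n = A"
        by (simp add: fun_eq_iff local_alternative_def A_def G0_def r_def)
      have dens_A: "has_lipschitz_density A (\<lambda>u. (1 - r) * f u + r * deriv H u) C"
        unfolding A_def[abs_def] by (rule has_lipschitz_density_mixture[OF dens_G0 dens_H r(1,2)])
      have A_range: "0 \<le> A u \<and> A u \<le> 1" for u
        unfolding A_def using G0_range[of u] H_range[of u] r(1,2)
          convex_bound_le[of "G0 u" 1 "H u" "1 - r" r] by auto
      have near: "\<bar>A u - G0 u\<bar> \<le> r" for u
      proof -
        have "A u - G0 u = r * (H u - G0 u)" by (simp add: A_def algebra_simps)
        then have "\<bar>A u - G0 u\<bar> = r * \<bar>H u - G0 u\<bar>"
          by (simp only: abs_mult abs_of_nonneg[OF r(1)])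
        also have "\<dots> \<le> r * 1"
          using G0_range[of u] H_range[of u] r by (intro mult_left_mono) auto
        finally show ?thesis by simp
      qed
      have slope: "\<bar>a\<bar> \<le> L"
        unfolding a_def L_def by (rule lipschitz_density_bounded[OF dens_A A_range])
      interpret model: contaminated_ar "M n \<rho> \<gamma>" p \<beta> \<nu> A g Q "\<epsilon> n \<rho> \<gamma>" "z n \<rho> \<gamma>" "\<xi> n \<rho> \<gamma>" "v n \<rho> \<gamma>"
        using model[of n \<rho> \<gamma>] n \<rho> \<gamma> unfolding A_eq g_def by auto
      interpret T: threshold_model "M n \<rho> \<gamma>" p \<beta> \<nu> A g Q "\<epsilon> n \<rho> \<gamma>" "z n \<rho> \<gamma>" "\<xi> n \<rho> \<gamma>" "v n \<rho> \<gamma>" n x a L C r G0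
      proof unfold_locales
        show "\<bar>A u - A w\<bar> \<le> L * \<bar>u - w\<bar>" for u w
          unfolding L_def by (rule lipschitz_density_lipschitz[OF dens_A A_range])
        show "\<bar>A (x + d) - A x - a * d\<bar> \<le> C * d\<^sup>2" for d
          unfolding a_def by (rule taylor_lipschitz_density[OF dens_A])
      qed (use n slope C0 near G0_range G0_meas in auto)
      have var: "model.expectation (\<lambda>\<omega>. (\<epsilon> n \<rho> \<gamma> 1 \<omega>)\<^sup>2) \<le> v2"
      proof -
        have "(\<integral>u. u\<^sup>2 \<partial>distr (M n \<rho> \<gamma>) borel (\<epsilon> n \<rho> \<gamma> 1)) \<le> v2"
          unfolding v2_def
          by (rule second_moment_normal_mixture[OF model.innovation_distribution(1) H_distribution(1) theta_pos r(1,2) _ H_variance])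
             (simp add: model.eps_cdf A_def G0_def H_distribution(2))
        then show ?thesis by (simp add: integral_distr)
      qed
      have lp: "model.lp_var \<le> lv"
        unfolding model.lp_var_def lv_def by (rule mult_left_mono[OF var]) simp
      have size: "model.size_bound \<le> sb"
        unfolding model.size_bound_def sb_def using lp by (intro mult_left_mono add_left_mono) auto
      have D: "sqrt (real n) * g * T.outlier_drift = \<gamma> * Delta0 p \<beta> \<theta>\<^sub>0 Q x"
      proof -
        have "sqrt (real n) * g = \<gamma>"
          using elim \<gamma> n0 by (auto simp: g_def local_rate_def min_def field_simps)
        moreover have "T.outlier_drift = Delta0 p \<beta> \<theta>\<^sub>0 Q x"
        proof -
          have i: "integrable Q (\<lambda>u. G0 (x + c * u))" for c
            by (rule Q.integrable_const_bound[of _ 1]) (use G0_range G0_meas in auto)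
          have "(\<integral>u. T.jump j u \<partial>Q) = (\<integral>u. G0 (x + (\<beta>(0 := -1)) j * u) \<partial>Q) - G0 x" for j
            unfolding T.jump_def model.outlier_coeff_def using i Q.prob_space by simp
          then show ?thesis
            unfolding T.outlier_drift_def Delta0_def by (simp add: Let_def G0_def atMost_atLeast0)
        qed
        ultimately show ?thesis by simp
      qed
      have slope_diff: "\<bar>a - f x\<bar> * b \<le> \<delta> / 2"
      proof -
        have "a - f x = r * (deriv H x - f x)" by (simp add: a_def algebra_simps)
        then have "\<bar>a - f x\<bar> = r * \<bar>deriv H x - f x\<bar>"
          by (simp only: abs_mult abs_of_nonneg[OF r(1)])
        also have "\<dots> \<le> (R * q n) * (2 * L)"
        proof (rule mult_mono)
          show "\<bar>deriv H x - f x\<bar> \<le> 2 * L"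
            by (rule order_trans[OF abs_triangle_ineq4 order_trans[OF add_mono[OF
                lipschitz_density_bounded[OF dens_H H_range] lipschitz_density_bounded[OF dens_G0 G0_range]]]])
               (simp add: L_def)
        qed (use r in \<open>auto simp: q_def\<close>)
        finally have "\<bar>a - f x\<bar> * b \<le> (R * q n) * (2 * L) * b" by (rule mult_right_mono[OF _ b])
        then show ?thesis using elim by linarith
      qed
      have y_eq: "observations p n (v n \<rho> \<gamma>) (z n \<rho> \<gamma>) (\<xi> n \<rho> \<gamma>) \<omega> = y n \<rho> \<gamma> \<omega>" for \<omega>
        by (simp add: y_def)
      have ym: "y n \<rho> \<gamma> \<in> M n \<rho> \<gamma> \<rightarrow>\<^sub>M (\<Pi>\<^sub>M t\<in>obs_times p n. borel)"
        unfolding y_def by (rule model.measurable_observations)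
      have mh: "(\<lambda>\<omega>. \<mu>hat n (y n \<rho> \<gamma> \<omega>)) \<in> borel_measurable (M n \<rho> \<gamma>)"
        using measurable_compose[OF ym] mu_estimator n by (auto simp: estimator_def)
      have bh: "(\<lambda>\<omega>. \<beta>hat n j (y n \<rho> \<gamma> \<omega>)) \<in> borel_measurable (M n \<rho> \<gamma>)" if "j \<in> {1..p}" for j
        using measurable_compose[OF ym] beta_estimator[OF that] n by (auto simp: estimator_def)
      have main: "measure (M n \<rho> \<gamma>) {\<omega> \<in> space (M n \<rho> \<gamma>).
          \<bar>sqrt (real n) * (edf n (residual p (\<mu>hat n (y n \<rho> \<gamma> \<omega>)) (\<lambda>j. \<beta>hat n j (y n \<rho> \<gamma> \<omega>)) (y n \<rho> \<gamma> \<omega>)) x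
              - edf n (\<lambda>t. \<epsilon> n \<rho> \<gamma> t \<omega>) x)
            - f x * (1 - (\<Sum>j=1..p. \<beta>hat n j (y n \<rho> \<gamma> \<omega>))) * (sqrt (real n) * (\<mu>hat n (y n \<rho> \<gamma> \<omega>) - \<mu>))
            - \<gamma> * Delta0 p \<beta> \<theta>\<^sub>0 Q x\<bar> > \<delta>}
        \<le> real (p + 1) * (?mu_tail K n \<rho> \<gamma> + ?beta_tail K n \<rho> \<gamma>)
          + (2 * real (card S) * sqrt (real (p + 1) * g + L * (b + 3) * model.size_bound / sqrt (real n))
             + T.error_bound (b + 3) \<eta> + L * \<eta>) / (\<delta> / 2)"
        unfolding D[symmetric] y_def
      proof (rule T.residual_edf_bound)
        show "\<exists>\<tau>\<in>S. \<forall>j\<le>p. \<bar>s j - \<tau> j\<bar> \<le> \<eta>" if "\<And>j. j \<le> p \<Longrightarrow> \<bar>s j\<bar> \<le> b" for s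
          using S(3) that by blast
      qed (use b_def mu mh bh K S(1,2) \<eta> \<open>\<delta> > 0\<close> slope_diff in \<open>auto simp: y_def\<close>)
      have rate: "(2 * real (card S) * sqrt (real (p + 1) * g + L * (b + 3) * model.size_bound / sqrt (real n))
          + T.error_bound (b + 3) \<eta> + L * \<eta>) / (\<delta> / 2) \<le> bound n"
      proof -
        have "T.truncated_outlier_mean (b + 3) = w n"
          by (simp add: T.truncated_outlier_mean_def w_def)
        then have eb: "T.error_bound (b + 3) \<eta> \<le> c1 * q n + real (p + 1) * \<Gamma> * (real (p + 1) * w n)
            + real (p + 1) * sqrt (\<Gamma> * q n) + L * \<eta> * sb"
          using T.error_bound_rate[OF g(2) r(3) lp size, of "b + 3" \<eta>] b \<eta> unfolding c1_def q_def by simp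
        have rad: "real (p + 1) * g + L * (b + 3) * model.size_bound / sqrt (real n)
            \<le> real (p + 1) * (\<Gamma> * q n) + L * (b + 3) * sb * q n"
        proof (rule add_mono)
          show "real (p + 1) * g \<le> real (p + 1) * (\<Gamma> * q n)" using g by (intro mult_left_mono) (auto simp: q_def)
          have "L * (b + 3) * model.size_bound / sqrt (real n) \<le> L * (b + 3) * sb / sqrt (real n)"
            using L0 b size by (intro divide_right_mono mult_left_mono mult_nonneg_nonneg) auto
          then show "L * (b + 3) * model.size_bound / sqrt (real n) \<le> L * (b + 3) * sb * q n" by (simp add: q_def)
        qed
        show ?thesis
          unfolding bound_def using \<open>\<delta> > 0\<close>
          by (intro divide_right_mono add_mono[OF add_mono[OF mult_left_mono[OF real_sqrt_le_mono[OF rad]] eb] order_refl]) auto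
      qed
      have "real (p + 1) * (?mu_tail K n \<rho> \<gamma> + ?beta_tail K n \<rho> \<gamma>)
          \<le> real (p + 1) * (e1 + e1)"
        using elim(1,2) \<rho> \<gamma> by (intro mult_left_mono add_mono) auto
      also have "real (p + 1) * (e1 + e1) = e / 4"
      proof -
        have "c * (e / (8 * c) + e / (8 * c)) = e / 4" if "0 < c" for c :: real
          using that by (simp add: field_simps)
        from this[of "real (p + 1)"] show ?thesis unfolding e1_def by simp
      qed
      finally have tails: "real (p + 1) * (?mu_tail K n \<rho> \<gamma> + ?beta_tail K n \<rho> \<gamma>) \<le> e / 4" .
      show "measure (M n \<rho> \<gamma>) {\<omega> \<in> space (M n \<rho> \<gamma>).
        \<bar>let m = \<mu>hat n (y n \<rho> \<gamma> \<omega>); b = (\<lambda>j. \<beta>hat n j (y n \<rho> \<gamma> \<omega>)); \<delta>hat = 1 - (\<Sum>j=1..p. b j);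
           Ghat = edf n (residual p m b (y n \<rho> \<gamma> \<omega>)); Gn = edf n (\<lambda>t. \<epsilon> n \<rho> \<gamma> t \<omega>)
         in sqrt (real n) * (Ghat x - Gn x)
          - 1 / \<theta>\<^sub>0 * std_normal_density (x / \<theta>\<^sub>0) * \<delta>hat * (sqrt (real n) * (m - \<mu>))
          - \<gamma> * Delta0 p \<beta> \<theta>\<^sub>0 Q x\<bar> > \<delta>} \<le> e"
        using main tails rate elim(3) e unfolding Let_def f_def by linarith
    qed
  qed
qed

end
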